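(* Let $(h,\nabla,\nabla^* )$ be a dually flat structure on a manifold $M$, and let $g$ be the Riemannian metric on $TM$ associated to $(h,\nabla)$ via Dombrowski's construction. Let $d$ and $\rho$ be the Riemannian distances on $M$ and $TM$ corresponding to $h$ and $g$, respectively. Then $(TM,\rho)$ is complete if and only if $(M,d)$ is complete.
   Context: Let $h$ be a Riemannian metric and $\nabla$ an affine connection on $M$. The dual connection $\nabla^*$ is the unique connection with $X(h(Y,Z))=h(\nabla_XY,Z)+h(Y,\nabla^*_XZ)$ for all vector fields $X,Y,Z$; $(h,\nabla,\nabla^* )$ is dually flat if both $\nabla$ and $\nabla^*$ have zero torsion and zero curvature. Dombrowski's construction: let $\pi:TM\to M$ be the canonical projection and $K:T(TM)\to TM$ the connector of $\nabla$ (the unique map with $\nabla_XY=K\,Y_*X$ for all vector fields $X,Y$). Identify $A\in T_{u}(TM)$, $u\in T_pM$, with $(u,v,w)=(u,\pi_*A,KA)$, $v,w\in T_pM$; then $g_u((u,v,w),(u,\bar v,\bar w))=h_p(v,\bar v)+h_p(w,\bar w)$. If $M$ is not connected, the distance between points of different components is taken to be $+\infty$. *)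

theory Defs
  imports "HOL-Analysis.Analysis"
begin

section \<open>Smooth maps between open subsets of normed spaces\<close>

text \<open>For open \<open>S\<close>, a map is \<open>C\<^sup>k\<^sup>+\<^sup>1\<close> iff it is differentiable and all its directional derivatives
  are \<open>C\<^sup>k\<close> (the domains below are finite-dimensional).\<close>

primrec k_smooth_on :: "nat \<Rightarrow> 'a set \<Rightarrow> ('a::real_normed_vector \<Rightarrow> 'b::real_normed_vector) \<Rightarrow> bool" where
  "k_smooth_on 0 S f \<longleftrightarrow> continuous_on S f"
| "k_smooth_on (Suc k) S f \<longleftrightarrow>
     (\<forall>x\<in>S. f differentiable at x) \<and> (\<forall>v. k_smooth_on k S (\<lambda>x. frechet_derivative f (at x) v))"

definition smooth_on :: "'a set \<Rightarrow> ('a::real_normed_vector \<Rightarrow> 'b::real_normed_vector) \<Rightarrow> bool" where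
  "smooth_on S f \<longleftrightarrow> (\<forall>k. k_smooth_on k S f)"

section \<open>Manifolds, tangent vectors, vector fields\<close>

text \<open>A chart is a pair of a domain and a coordinate map; the coordinate map is meaningful on the
  domain only. The manifold is the space of a topology \<open>T\<close>, which need not be connected;
  its dimension is \<open>DIM('e)\<close>.\<close>

type_synonym ('m, 'e) chart = "'m set \<times> ('m \<Rightarrow> 'e)"

abbreviation chart_inv :: "('m, 'e) chart \<Rightarrow> 'e \<Rightarrow> 'm" where
  "chart_inv c \<equiv> inv_into (fst c) (snd c)"

definition smooth_manifold :: "'m topology \<Rightarrow> ('m, 'e::euclidean_space) chart set \<Rightarrow> bool" where
  "smooth_manifold T A \<longleftrightarrow>
     Hausdorff_space T \<and> second_countable T \<and> (\<Union>c\<in>A. fst c) = topspace T \<and>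
     (\<forall>c\<in>A. openin T (fst c) \<and> open (snd c ` fst c) \<and>
        homeomorphic_map (subtopology T (fst c)) (top_of_set (snd c ` fst c)) (snd c)) \<and>
     (\<forall>c\<in>A. \<forall>c'\<in>A. smooth_on (snd c ` (fst c \<inter> fst c')) (snd c' \<circ> chart_inv c))"

definition mpoints :: "('m, 'e) chart set \<Rightarrow> 'm set" where
  "mpoints A = (\<Union>c\<in>A. fst c)"

definition chart_at :: "('m, 'e) chart set \<Rightarrow> 'm \<Rightarrow> ('m, 'e) chart" where
  "chart_at A p = (SOME c. c \<in> A \<and> p \<in> fst c)"

text \<open>A tangent vector at \<open>p\<close> is the family of its coordinate vectors in all charts around \<open>p\<close>,
  related by the derivatives of the transition maps; the entries at all other charts are
  normalised to 0. Linear operations are entrywise.\<close>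

type_synonym ('m, 'e) tvec = "('m, 'e) chart \<Rightarrow> 'e"

definition tangent_space ::
    "('m, 'e::real_normed_vector) chart set \<Rightarrow> 'm \<Rightarrow> ('m, 'e) tvec set" where
  "tangent_space A p =
     {v. (\<forall>c\<in>A. \<forall>c'\<in>A. p \<in> fst c \<and> p \<in> fst c' \<longrightarrow>
            v c' = frechet_derivative (snd c' \<circ> chart_inv c) (at (snd c p)) (v c)) \<and>
         (\<forall>c. \<not> (c \<in> A \<and> p \<in> fst c) \<longrightarrow> v c = 0)}"

definition tangent_bundle ::
    "('m, 'e::real_normed_vector) chart set \<Rightarrow> ('m \<times> ('m, 'e) tvec) set" where
  "tangent_bundle A = {(p, v). p \<in> mpoints A \<and> v \<in> tangent_space A p}"

definition bundle_chart ::
    "('m, 'e::real_normed_vector) chart set \<Rightarrow> ('m, 'e) chart \<Rightarrow> ('m \<times> ('m, 'e) tvec, 'e \<times> 'e) chart" where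
  "bundle_chart A c = ({u \<in> tangent_bundle A. fst u \<in> fst c}, \<lambda>(p, v). (snd c p, v c))"

definition bundle_atlas ::
    "('m, 'e::real_normed_vector) chart set \<Rightarrow> ('m \<times> ('m, 'e) tvec, 'e \<times> 'e) chart set" where
  "bundle_atlas A = bundle_chart A ` A"

text \<open>The differential of \<open>F\<close> at \<open>p\<close>. It does not depend on the chart chosen around \<open>p\<close>.\<close>

definition differential ::
    "('m, 'e::real_normed_vector) chart set \<Rightarrow> ('n, 'f::real_normed_vector) chart set \<Rightarrow>
     ('m \<Rightarrow> 'n) \<Rightarrow> 'm \<Rightarrow> ('m, 'e) tvec \<Rightarrow> ('n, 'f) tvec" where
  "differential A B F p v = (\<lambda>d.
     if d \<in> B \<and> F p \<in> fst d then
       (let c = chart_at A p in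
        frechet_derivative (snd d \<circ> F \<circ> chart_inv c) (at (snd c p)) (v c))
     else 0)"

definition smooth_fun :: "('m, 'e::real_normed_vector) chart set \<Rightarrow> ('m \<Rightarrow> real) \<Rightarrow> bool" where
  "smooth_fun A f \<longleftrightarrow> (\<forall>c\<in>A. smooth_on (snd c ` fst c) (f \<circ> chart_inv c))"

definition dir_deriv ::
    "('m, 'e::real_normed_vector) chart set \<Rightarrow> 'm \<Rightarrow> ('m, 'e) tvec \<Rightarrow> ('m \<Rightarrow> real) \<Rightarrow> real" where
  "dir_deriv A p v f =
     (let c = chart_at A p in frechet_derivative (f \<circ> chart_inv c) (at (snd c p)) (v c))"

text \<open>Smooth vector fields, extended by 0 outside the manifold.\<close>

definition vector_field ::
    "('m, 'e::real_normed_vector) chart set \<Rightarrow> ('m \<Rightarrow> ('m, 'e) tvec) \<Rightarrow> bool" where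
  "vector_field A X \<longleftrightarrow>
     (\<forall>p\<in>mpoints A. X p \<in> tangent_space A p) \<and>
     (\<forall>p. p \<notin> mpoints A \<longrightarrow> X p = (\<lambda>c. 0)) \<and>
     (\<forall>c\<in>A. smooth_on (snd c ` fst c) (\<lambda>x. X (chart_inv c x) c))"

text \<open>\<open>[X, Y]\<close>, with coordinate vector \<open>DY(X) - DX(Y)\<close> in each chart, so that
  \<open>[X, Y] f = X (Y f) - Y (X f)\<close>.\<close>

definition lie_bracket ::
    "('m, 'e::real_normed_vector) chart set \<Rightarrow>
     ('m \<Rightarrow> ('m, 'e) tvec) \<Rightarrow> ('m \<Rightarrow> ('m, 'e) tvec) \<Rightarrow> ('m \<Rightarrow> ('m, 'e) tvec)" where
  "lie_bracket A X Y = (\<lambda>p c.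
     if c \<in> A \<and> p \<in> fst c then
       frechet_derivative (\<lambda>x. Y (chart_inv c x) c) (at (snd c p)) (X p c) -
       frechet_derivative (\<lambda>x. X (chart_inv c x) c) (at (snd c p)) (Y p c)
     else 0)"

section \<open>Riemannian metrics and distances\<close>

definition riemannian_metric ::
    "('m, 'e::real_normed_vector) chart set \<Rightarrow> ('m \<Rightarrow> ('m, 'e) tvec \<Rightarrow> ('m, 'e) tvec \<Rightarrow> real) \<Rightarrow> bool" where
  "riemannian_metric A h \<longleftrightarrow>
     (\<forall>p\<in>mpoints A. \<forall>u\<in>tangent_space A p. \<forall>v\<in>tangent_space A p.
        h p u v = h p v u \<and>
        (u \<noteq> (\<lambda>c. 0) \<longrightarrow> h p u u > 0) \<and>
        (\<forall>w\<in>tangent_space A p. \<forall>a b.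
           h p (\<lambda>c. a *\<^sub>R u c + b *\<^sub>R v c) w = a * h p u w + b * h p v w)) \<and>
     (\<forall>X Y. vector_field A X \<and> vector_field A Y \<longrightarrow> smooth_fun A (\<lambda>p. h p (X p) (Y p)))"

definition C1_curve_on ::
    "('m, 'e::real_normed_vector) chart set \<Rightarrow> (real \<Rightarrow> 'm) \<Rightarrow> real \<Rightarrow> real \<Rightarrow> bool" where
  "C1_curve_on A \<gamma> a b \<longleftrightarrow>
     (\<forall>t\<in>{a..b}. \<exists>c\<in>A. \<exists>\<epsilon>>0. let I = {a..b} \<inter> ball t \<epsilon> in
        \<gamma> ` I \<subseteq> fst c \<and>
        (\<exists>D. (\<forall>s\<in>I. ((snd c \<circ> \<gamma>) has_vector_derivative D s) (at s within I)) \<and> continuous_on I D))"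

text \<open>\<open>P\<close> is the set of break points: the curve is \<open>C\<^sup>1\<close>, including one-sided derivatives at the
  end points, on each closed subinterval without a break point in its interior.\<close>

definition piecewise_C1_curve ::
    "('m, 'e::real_normed_vector) chart set \<Rightarrow> (real \<Rightarrow> 'm) \<Rightarrow> bool" where
  "piecewise_C1_curve A \<gamma> \<longleftrightarrow>
     (\<exists>P. finite P \<and>
        (\<forall>a b. 0 \<le> a \<and> a < b \<and> b \<le> 1 \<and> {a<..<b} \<inter> P = {} \<longrightarrow> C1_curve_on A \<gamma> a b))"

definition velocity ::
    "('m, 'e::real_normed_vector) chart set \<Rightarrow> (real \<Rightarrow> 'm) \<Rightarrow> real \<Rightarrow> ('m, 'e) tvec" where
  "velocity A \<gamma> t = (\<lambda>c.
     if c \<in> A \<and> \<gamma> t \<in> fst c then vector_derivative (snd c \<circ> \<gamma>) (at t) else 0)"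

text \<open>The velocity is arbitrary at the finitely many break points, which do not contribute to the
  length.\<close>

definition curve_length ::
    "('m, 'e::real_normed_vector) chart set \<Rightarrow> ('m \<Rightarrow> ('m, 'e) tvec \<Rightarrow> ('m, 'e) tvec \<Rightarrow> real) \<Rightarrow>
     (real \<Rightarrow> 'm) \<Rightarrow> real" where
  "curve_length A h \<gamma> =
     integral {0..1} (\<lambda>t. sqrt (h (\<gamma> t) (velocity A \<gamma> t) (velocity A \<gamma> t)))"

text \<open>The infimum over the empty set is \<open>\<infinity>\<close>: this is the distance between points of different
  components.\<close>

definition riemannian_dist ::
    "('m, 'e::real_normed_vector) chart set \<Rightarrow> ('m \<Rightarrow> ('m, 'e) tvec \<Rightarrow> ('m, 'e) tvec \<Rightarrow> real) \<Rightarrow>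
     'm \<Rightarrow> 'm \<Rightarrow> ereal" where
  "riemannian_dist A h p q =
     (INF \<gamma>\<in>{\<gamma>. piecewise_C1_curve A \<gamma> \<and> \<gamma> 0 = p \<and> \<gamma> 1 = q}. ereal (curve_length A h \<gamma>))"

definition complete_dist :: "'a set \<Rightarrow> ('a \<Rightarrow> 'a \<Rightarrow> ereal) \<Rightarrow> bool" where
  "complete_dist S d \<longleftrightarrow>
     (\<forall>x::nat \<Rightarrow> 'a.
        range x \<subseteq> S \<and> (\<forall>\<epsilon>>0. \<exists>N. \<forall>m\<ge>N. \<forall>n\<ge>N. d (x m) (x n) < ereal \<epsilon>) \<longrightarrow>
        (\<exists>l\<in>S. \<forall>\<epsilon>>0. \<exists>N. \<forall>n\<ge>N. d (x n) l < ereal \<epsilon>))"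

section \<open>Affine connections and dually flat structures\<close>

type_synonym ('m, 'e) connection =
  "('m \<Rightarrow> ('m, 'e) tvec) \<Rightarrow> ('m \<Rightarrow> ('m, 'e) tvec) \<Rightarrow> ('m \<Rightarrow> ('m, 'e) tvec)"

text \<open>Real homogeneity in the second argument is the Leibniz rule for constant \<open>f\<close>.\<close>

definition affine_connection ::
    "('m, 'e::real_normed_vector) chart set \<Rightarrow> ('m, 'e) connection \<Rightarrow> bool" where
  "affine_connection A nabla \<longleftrightarrow>
     (\<forall>X Y. vector_field A X \<and> vector_field A Y \<longrightarrow> vector_field A (nabla X Y)) \<and>
     (\<forall>X X' Y. vector_field A X \<and> vector_field A X' \<and> vector_field A Y \<longrightarrow>
        nabla (\<lambda>p c. X p c + X' p c) Y = (\<lambda>p c. nabla X Y p c + nabla X' Y p c)) \<and>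
     (\<forall>X Y Y'. vector_field A X \<and> vector_field A Y \<and> vector_field A Y' \<longrightarrow>
        nabla X (\<lambda>p c. Y p c + Y' p c) = (\<lambda>p c. nabla X Y p c + nabla X Y' p c)) \<and>
     (\<forall>f X Y. smooth_fun A f \<and> vector_field A X \<and> vector_field A Y \<longrightarrow>
        nabla (\<lambda>p c. f p *\<^sub>R X p c) Y = (\<lambda>p c. f p *\<^sub>R nabla X Y p c) \<and>
        nabla X (\<lambda>p c. f p *\<^sub>R Y p c) =
          (\<lambda>p c. f p *\<^sub>R nabla X Y p c + dir_deriv A p (X p) f *\<^sub>R Y p c))"

definition torsion ::
    "('m, 'e::real_normed_vector) chart set \<Rightarrow> ('m, 'e) connection \<Rightarrow>
     ('m \<Rightarrow> ('m, 'e) tvec) \<Rightarrow> ('m \<Rightarrow> ('m, 'e) tvec) \<Rightarrow> ('m \<Rightarrow> ('m, 'e) tvec)" where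
  "torsion A nabla X Y = (\<lambda>p c. nabla X Y p c - nabla Y X p c - lie_bracket A X Y p c)"

definition curvature ::
    "('m, 'e::real_normed_vector) chart set \<Rightarrow> ('m, 'e) connection \<Rightarrow>
     ('m \<Rightarrow> ('m, 'e) tvec) \<Rightarrow> ('m \<Rightarrow> ('m, 'e) tvec) \<Rightarrow> ('m \<Rightarrow> ('m, 'e) tvec) \<Rightarrow>
     ('m \<Rightarrow> ('m, 'e) tvec)" where
  "curvature A nabla X Y Z = (\<lambda>p c.
     nabla X (nabla Y Z) p c - nabla Y (nabla X Z) p c - nabla (lie_bracket A X Y) Z p c)"

definition flat_connection ::
    "('m, 'e::real_normed_vector) chart set \<Rightarrow> ('m, 'e) connection \<Rightarrow> bool" where
  "flat_connection A nabla \<longleftrightarrow>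
     (\<forall>X Y. vector_field A X \<and> vector_field A Y \<longrightarrow> torsion A nabla X Y = (\<lambda>p c. 0)) \<and>
     (\<forall>X Y Z. vector_field A X \<and> vector_field A Y \<and> vector_field A Z \<longrightarrow>
        curvature A nabla X Y Z = (\<lambda>p c. 0))"

definition dual_connections ::
    "('m, 'e::real_normed_vector) chart set \<Rightarrow> ('m \<Rightarrow> ('m, 'e) tvec \<Rightarrow> ('m, 'e) tvec \<Rightarrow> real) \<Rightarrow>
     ('m, 'e) connection \<Rightarrow> ('m, 'e) connection \<Rightarrow> bool" where
  "dual_connections A h nabla nabla_star \<longleftrightarrow>
     (\<forall>X Y Z. vector_field A X \<and> vector_field A Y \<and> vector_field A Z \<longrightarrow>
        (\<forall>p\<in>mpoints A.
           dir_deriv A p (X p) (\<lambda>q. h q (Y q) (Z q)) =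
             h p (nabla X Y p) (Z p) + h p (Y p) (nabla_star X Z p)))"

definition dually_flat ::
    "('m, 'e::real_normed_vector) chart set \<Rightarrow> ('m \<Rightarrow> ('m, 'e) tvec \<Rightarrow> ('m, 'e) tvec \<Rightarrow> real) \<Rightarrow>
     ('m, 'e) connection \<Rightarrow> ('m, 'e) connection \<Rightarrow> bool" where
  "dually_flat A h nabla nabla_star \<longleftrightarrow>
     riemannian_metric A h \<and>
     affine_connection A nabla \<and> affine_connection A nabla_star \<and>
     dual_connections A h nabla nabla_star \<and>
     flat_connection A nabla \<and> flat_connection A nabla_star"

section \<open>Dombrowski's construction\<close>

text \<open>\<open>K u a\<close> is the value of the connector \<open>K : T(TM) \<rightarrow> TM\<close> at \<open>a \<in> T\<^sub>u(TM)\<close>, a tangent vector at the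
  base point of \<open>u\<close>. Linearity on the fibres \<open>T\<^sub>u(TM)\<close> is part of the notion: vectors \<open>Y\<^sub>*X\<close>
  include no nonzero vertical vector, but they span \<open>T\<^sub>u(TM)\<close>, so that with linearity the identity
  \<open>nabla X Y = K (Y\<^sub>*X)\<close> determines \<open>K\<close> uniquely.\<close>

definition connector ::
    "('m, 'e::real_normed_vector) chart set \<Rightarrow> ('m, 'e) connection \<Rightarrow>
     ('m \<times> ('m, 'e) tvec \<Rightarrow> ('m \<times> ('m, 'e) tvec, 'e \<times> 'e) tvec \<Rightarrow> ('m, 'e) tvec) \<Rightarrow> bool" where
  "connector A nabla K \<longleftrightarrow>
     (\<forall>u\<in>tangent_bundle A. \<forall>a\<in>tangent_space (bundle_atlas A) u.
        K u a \<in> tangent_space A (fst u) \<and>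
        (\<forall>b\<in>tangent_space (bundle_atlas A) u. \<forall>r s.
           K u (\<lambda>d. r *\<^sub>R a d + s *\<^sub>R b d) = (\<lambda>c. r *\<^sub>R K u a c + s *\<^sub>R K u b c))) \<and>
     (\<forall>X Y. vector_field A X \<and> vector_field A Y \<longrightarrow>
        (\<forall>p\<in>mpoints A.
           nabla X Y p =
             K (p, Y p) (differential A (bundle_atlas A) (\<lambda>q. (q, Y q)) p (X p))))"

definition dombrowski_metric ::
    "('m, 'e::real_normed_vector) chart set \<Rightarrow> ('m \<Rightarrow> ('m, 'e) tvec \<Rightarrow> ('m, 'e) tvec \<Rightarrow> real) \<Rightarrow>
     ('m \<times> ('m, 'e) tvec \<Rightarrow> ('m \<times> ('m, 'e) tvec, 'e \<times> 'e) tvec \<Rightarrow> ('m, 'e) tvec) \<Rightarrow>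
     'm \<times> ('m, 'e) tvec \<Rightarrow>
     ('m \<times> ('m, 'e) tvec, 'e \<times> 'e) tvec \<Rightarrow> ('m \<times> ('m, 'e) tvec, 'e \<times> 'e) tvec \<Rightarrow> real" where
  "dombrowski_metric A h K u a b =
     h (fst u) (differential (bundle_atlas A) A fst u a) (differential (bundle_atlas A) A fst u b) +
     h (fst u) (K u a) (K u b)"

end

(* For a curve (x(t), w(t)) in a bundle chart, Dombrowski's metric controls x' and the covariant derivative
   k = w' + \<Gamma>(x', w), where w' differs from k by a term of size O(|x'| |w|). If M is complete, the base points
   of a Cauchy sequence in TM converge, so short curves between its members stay over a compact ball of one chart.
   There ln (1 + |w|^2) is Lipschitz in the arc length, hence w is bounded, hence w is itself Lipschitz in the arc
   length and converges. Conversely, the zero section preserves lengths and the projection does not increase them,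
   so completeness of TM passes to M. *)

theory Submission
  imports Defs
begin

section \<open>Calculus of smooth maps\<close>

text \<open>The hypotheses describe h, the connection and the connector only through vector fields
  defined on all of M, whereas the estimates need coordinate expressions: the coefficients of h and
  of \<Gamma>, and bounds for them on a compact ball. Multiplying constant fields in a chart by a
  bump function turns local data into global fields; dividing by the bump recovers the coefficients.
  Smoothness of the extended fields rests on the Hausdorff property, and so does the fact that a
  curve cannot slip out of a chart while its coordinates stay in a closed ball. The logarithm works
  because \<Gamma> is linear in w: |w'| grows at most linearly with |w|, so w cannot blow up along a
  curve of finite length. Distances enter directly through their definition: a distance below
  \<epsilon> yields a curve shorter than \<epsilon>, and closeness in a chart yields a short curve,
  a straight segment in coordinates.\<close>

lemma k_smooth_on_Suc_imp:
  assumes "k_smooth_on (Suc k) S f" shows "k_smooth_on k S f"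
  using assms
proof (induction k arbitrary: f)
  case 0
  then show ?case
    by (auto intro!: continuous_at_imp_continuous_on differentiable_imp_continuous_within)
next
  case (Suc k)
  then show ?case by (metis k_smooth_on.simps(2))
qed

lemma k_smooth_on_transform:
  assumes "k_smooth_on k S f" "open S" "\<And>x. x \<in> S \<Longrightarrow> f x = g x"
  shows "k_smooth_on k S g"
  using assms
proof (induction k arbitrary: f g)
  case 0
  then show ?case by (auto cong: continuous_on_cong)
next
  case (Suc k)
  have "g differentiable at x" if "x \<in> S" for x
  proof -
    have "(f has_derivative frechet_derivative f (at x)) (at x)"
      using Suc.prems that by (auto simp: frechet_derivative_works[symmetric])
    then have "(g has_derivative frechet_derivative f (at x)) (at x)"
      by (rule has_derivative_transform_within_open) (use Suc.prems that in auto)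
    then show ?thesis unfolding differentiable_def by blast
  qed
  moreover have "frechet_derivative f (at x) = frechet_derivative g (at x)" if "x \<in> S" for x
    using Suc.prems that by (intro frechet_derivative_transform_within_open) auto
  ultimately show ?case
    using Suc.prems(1,2) Suc.IH[OF _ Suc.prems(2)] by (metis (no_types, lifting) k_smooth_on.simps(2))
qed

lemma k_smooth_on_const: "k_smooth_on k S (\<lambda>x. c)"
  by (induction k arbitrary: c) auto

lemma frechet_derivative_eqI: "(f has_derivative f') (at x) \<Longrightarrow> frechet_derivative f (at x) = f'"
  using frechet_derivative_at by metis

text \<open>The recursive definition speaks of \<open>frechet_derivative\<close>, a choice. By
  uniqueness of derivatives any explicit derivative can replace it on an open set, so the usual
  rules of differentiation become available.\<close>

lemma k_smooth_on_SucI: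
  assumes "\<And>x. x \<in> S \<Longrightarrow> (f has_derivative f' x) (at x)"
    and "\<And>v. k_smooth_on k S (\<lambda>x. f' x v)" "open S"
  shows "k_smooth_on (Suc k) S f"
proof -
  have "k_smooth_on k S (\<lambda>x. frechet_derivative f (at x) v)" for v
    using assms(2)[of v] \<open>open S\<close>
    by (rule k_smooth_on_transform) (use assms(1) frechet_derivative_eqI in metis)
  then show ?thesis
    using assms(1) by (auto simp: differentiable_def)
qed

lemma k_smooth_on_SucD:
  assumes "k_smooth_on (Suc k) S f" "x \<in> S"
  shows "(f has_derivative frechet_derivative f (at x)) (at x)"
  using assms by (auto simp: frechet_derivative_works[symmetric])

lemma k_smooth_on_bounded_linear:
  assumes "bounded_linear f" "open S"
  shows "k_smooth_on k S f"
proof (cases k)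
  case 0
  then show ?thesis using assms by (auto intro!: linear_continuous_on)
next
  case (Suc j)
  show ?thesis unfolding Suc
    by (rule k_smooth_on_SucI[where f' = "\<lambda>x. f"])
      (use assms in \<open>auto intro: bounded_linear_imp_has_derivative k_smooth_on_const\<close>)
qed

lemma k_smooth_on_add:
  assumes "k_smooth_on k S f" "k_smooth_on k S g" "open S"
  shows "k_smooth_on k S (\<lambda>x. f x + g x)"
  using assms
proof (induction k arbitrary: f g)
  case 0
  then show ?case by (auto intro: continuous_on_add)
next
  case (Suc k)
  show ?case
  proof (rule k_smooth_on_SucI)
    show "((\<lambda>x. f x + g x) has_derivative
        (\<lambda>v. frechet_derivative f (at x) v + frechet_derivative g (at x) v)) (at x)" if "x \<in> S" for x
      using Suc.prems that by (intro has_derivative_add k_smooth_on_SucD) auto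
  qed (use Suc in auto)
qed

lemma k_smooth_on_linear_comp:
  assumes "bounded_linear L" "k_smooth_on k S f" "open S"
  shows "k_smooth_on k S (\<lambda>x. L (f x))"
  using assms(2)
proof (induction k arbitrary: f)
  case 0
  then show ?case using assms by (auto intro: bounded_linear.continuous_on)
next
  case (Suc k)
  show ?case
  proof (rule k_smooth_on_SucI)
    show "((\<lambda>x. L (f x)) has_derivative (\<lambda>v. L (frechet_derivative f (at x) v))) (at x)" if "x \<in> S" for x
      using Suc.prems that by (intro bounded_linear.has_derivative[OF assms(1)] k_smooth_on_SucD) auto
  qed (use Suc assms in auto)
qed

lemma k_smooth_on_bilinear:
  assumes "bounded_bilinear prd" "k_smooth_on k S f" "k_smooth_on k S g" "open S"
  shows "k_smooth_on k S (\<lambda>x. prd (f x) (g x))"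
  using assms(2,3)
proof (induction k arbitrary: f g)
  case 0
  then show ?case using assms by (auto intro: bounded_bilinear.continuous_on)
next
  case (Suc k)
  show ?case
  proof (rule k_smooth_on_SucI)
    show "((\<lambda>x. prd (f x) (g x)) has_derivative
        (\<lambda>v. prd (f x) (frechet_derivative g (at x) v) + prd (frechet_derivative f (at x) v) (g x))) (at x)"
      if "x \<in> S" for x
      using Suc.prems that by (intro bounded_bilinear.FDERIV[OF assms(1)] k_smooth_on_SucD) auto
    \<comment> \<open>Each product in the Leibniz rule keeps one factor undifferentiated; that
      factor has to be lowered from order k+1 to k before the induction hypothesis applies.\<close>
    show "k_smooth_on k S
          (\<lambda>x. prd (f x) (frechet_derivative g (at x) v) + prd (frechet_derivative f (at x) v) (g x))" for v
      using Suc.prems assms(4) k_smooth_on_Suc_imp[OF Suc.prems(1)] k_smooth_on_Suc_imp[OF Suc.prems(2)]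
      by (intro k_smooth_on_add Suc.IH) auto
  qed (use assms in auto)
qed

lemma k_smooth_on_sum:
  assumes "\<And>i. i \<in> I \<Longrightarrow> k_smooth_on k S (f i)" "open S"
  shows "k_smooth_on k S (\<lambda>x. \<Sum>i\<in>I. f i x)"
  using assms
  by (induction I rule: infinite_finite_induct) (auto intro: k_smooth_on_const k_smooth_on_add)

lemma linear_euclidean_sum:
  fixes v :: "'a::euclidean_space"
  assumes "linear f" shows "f v = (\<Sum>i\<in>Basis. (v \<bullet> i) *\<^sub>R f i)"
proof -
  have "f v = f (\<Sum>i\<in>Basis. (v \<bullet> i) *\<^sub>R i)" by (simp add: euclidean_representation)
  also have "\<dots> = (\<Sum>i\<in>Basis. (v \<bullet> i) *\<^sub>R f i)"
    by (simp add: linear_sum[OF assms] linear_cmul[OF assms])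
  finally show ?thesis .
qed

lemma k_smooth_on_compose:
  fixes f :: "'b::euclidean_space \<Rightarrow> 'c::real_normed_vector" and g :: "'a::real_normed_vector \<Rightarrow> 'b"
  assumes "k_smooth_on k U f" "k_smooth_on k S g" "open S" "g ` S \<subseteq> U"
  shows "k_smooth_on k S (\<lambda>x. f (g x))"
  using assms(1,2)
proof (induction k arbitrary: f)
  case 0
  then show ?case using assms by (auto intro: continuous_on_compose2)
next
  case (Suc k)
  show ?case
  proof (rule k_smooth_on_SucI)
    show "((\<lambda>x. f (g x)) has_derivative
        (\<lambda>v. frechet_derivative f (at (g x)) (frechet_derivative g (at x) v))) (at x)"
      if "x \<in> S" for x
    proof -
      have "g x \<in> U" using that assms(4) by blast
      from diff_chain_at[OF k_smooth_on_SucD[OF Suc.prems(2) that] k_smooth_on_SucD[OF Suc.prems(1) this]]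
      show ?thesis by (simp add: o_def)
    qed
    \<comment> \<open>The direction \<open>frechet_derivative g (at x) v\<close> moves with x, but
      only derivatives of f in fixed directions are known to be smooth. The basis expansion leaves
      products of scalar coordinates with such derivatives.\<close>
    show "k_smooth_on k S (\<lambda>x. frechet_derivative f (at (g x)) (frechet_derivative g (at x) v))" for v
    proof (rule k_smooth_on_transform)
      show "k_smooth_on k S (\<lambda>x. \<Sum>i\<in>Basis. (frechet_derivative g (at x) v \<bullet> i) *\<^sub>R frechet_derivative f (at (g x)) i)"
        using Suc.prems assms(3)
        by (intro k_smooth_on_sum k_smooth_on_bilinear[OF bounded_bilinear_scaleR] Suc.IH
            k_smooth_on_linear_comp[OF bounded_linear_inner_left] k_smooth_on_Suc_imp[OF Suc.prems(2)]) auto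
      show "(\<Sum>i\<in>Basis. (frechet_derivative g (at x) v \<bullet> i) *\<^sub>R frechet_derivative f (at (g x)) i) =
        frechet_derivative f (at (g x)) (frechet_derivative g (at x) v)" if "x \<in> S" for x
      proof -
        have "f differentiable at (g x)" using Suc.prems(1) that assms(4) by auto
        then show ?thesis using linear_euclidean_sum[OF linear_frechet_derivative] by metis
      qed
    qed (use assms in auto)
  qed (use assms in auto)
qed

text \<open>Derivatives at a point see only a neighbourhood of it. This glues local data with the
  zero function when they are extended to the whole manifold.\<close>

lemma k_smooth_on_local:
  assumes "\<And>x. x \<in> S \<Longrightarrow> \<exists>U. open U \<and> x \<in> U \<and> k_smooth_on k U f"
  shows "k_smooth_on k S f"
  using assms
proof (induction k arbitrary: f)
  case 0
  then show ?case
    by (metis continuous_at_imp_continuous_on continuous_on_eq_continuous_at k_smooth_on.simps(1))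
next
  case (Suc k)
  have "f differentiable at x" if "x \<in> S" for x
    using Suc.prems[OF that] by auto
  moreover have "k_smooth_on k S (\<lambda>x. frechet_derivative f (at x) v)" for v
    by (rule Suc.IH) (use Suc.prems in fastforce)
  ultimately show ?case by simp
qed

section \<open>Closure properties of smooth maps\<close>

lemma smooth_on_differentiable: "smooth_on S f \<Longrightarrow> x \<in> S \<Longrightarrow> f differentiable at x"
  unfolding smooth_on_def by (metis k_smooth_on.simps(2))

lemma smooth_on_deriv: "smooth_on S f \<Longrightarrow> smooth_on S (\<lambda>x. frechet_derivative f (at x) v)"
  unfolding smooth_on_def by (metis k_smooth_on.simps(2))

lemma smooth_on_continuous: "smooth_on S f \<Longrightarrow> continuous_on S f"
  unfolding smooth_on_def by (metis k_smooth_on.simps(1))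

lemma smooth_on_transform:
  "smooth_on S f \<Longrightarrow> open S \<Longrightarrow> (\<And>x. x \<in> S \<Longrightarrow> f x = g x) \<Longrightarrow> smooth_on S g"
  unfolding smooth_on_def using k_smooth_on_transform by blast

lemma smooth_on_const: "smooth_on S (\<lambda>x. c)"
  unfolding smooth_on_def using k_smooth_on_const by blast

lemma smooth_on_bounded_linear: "bounded_linear f \<Longrightarrow> open S \<Longrightarrow> smooth_on S f"
  unfolding smooth_on_def using k_smooth_on_bounded_linear by blast

lemma smooth_on_add: "smooth_on S f \<Longrightarrow> smooth_on S g \<Longrightarrow> open S \<Longrightarrow> smooth_on S (\<lambda>x. f x + g x)"
  unfolding smooth_on_def using k_smooth_on_add by blast

lemma smooth_on_linear_comp:
  "bounded_linear L \<Longrightarrow> smooth_on S f \<Longrightarrow> open S \<Longrightarrow> smooth_on S (\<lambda>x. L (f x))"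
  unfolding smooth_on_def using k_smooth_on_linear_comp by blast

lemma smooth_on_bilinear:
  "bounded_bilinear prd \<Longrightarrow> smooth_on S f \<Longrightarrow> smooth_on S g \<Longrightarrow> open S \<Longrightarrow>
    smooth_on S (\<lambda>x. prd (f x) (g x))"
  unfolding smooth_on_def using k_smooth_on_bilinear by blast

lemma smooth_on_sum:
  "(\<And>i. i \<in> I \<Longrightarrow> smooth_on S (f i)) \<Longrightarrow> open S \<Longrightarrow> smooth_on S (\<lambda>x. \<Sum>i\<in>I. f i x)"
  unfolding smooth_on_def by (auto intro: k_smooth_on_sum)

lemma smooth_on_compose:
  fixes f :: "'b::euclidean_space \<Rightarrow> 'c::real_normed_vector" and g :: "'a::real_normed_vector \<Rightarrow> 'b"
  shows "smooth_on U f \<Longrightarrow> smooth_on S g \<Longrightarrow> open S \<Longrightarrow> g ` S \<subseteq> U \<Longrightarrow> smooth_on S (\<lambda>x. f (g x))"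
  unfolding smooth_on_def using k_smooth_on_compose by blast

lemma smooth_on_local:
  assumes "\<And>x. x \<in> S \<Longrightarrow> \<exists>U. open U \<and> x \<in> U \<and> smooth_on U f" shows "smooth_on S f"
  unfolding smooth_on_def
proof
  fix k show "k_smooth_on k S f"
    by (rule k_smooth_on_local) (use assms smooth_on_def in metis)
qed

lemma smooth_on_Pair:
  assumes "smooth_on S f" "smooth_on S g" "open S"
  shows "smooth_on S (\<lambda>x. (f x, g x))"
proof -
  have "bounded_linear (\<lambda>y::'b. (y, 0::'c))" "bounded_linear (\<lambda>y::'c. (0::'b, y))"
    by (rule bounded_linear_Pair[OF bounded_linear_ident bounded_linear_zero],
        rule bounded_linear_Pair[OF bounded_linear_zero bounded_linear_ident])
  then have "smooth_on S (\<lambda>x. (f x, 0) + (0, g x))"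
    using smooth_on_add[OF smooth_on_linear_comp[OF _ assms(1,3)]
        smooth_on_linear_comp[OF _ assms(2,3)] assms(3)] by blast
  then show ?thesis by simp
qed

text \<open>The functions \<open>t\<^sup>-\<^sup>n exp (-1/t)\<close>, extended by 0, span a space closed under differentiation.\<close>

definition exp_flat :: "nat \<Rightarrow> real \<Rightarrow> real" where
  "exp_flat n t = (if t > 0 then (1 / t) ^ n * exp (- (1 / t)) else 0)"

lemma exp_flat_tendsto_0: "(exp_flat n \<longlongrightarrow> 0) (at 0)"
proof -
  have "((\<lambda>t. (1 / t) ^ n * exp (- (1 / t))) \<longlongrightarrow> 0) (at_right (0::real))"
  proof -
    have "((\<lambda>x::real. x ^ n / exp x) \<longlongrightarrow> 0) at_top" by (rule tendsto_power_div_exp_0)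
    then have "(((\<lambda>x. x ^ n / exp x) \<circ> inverse) \<longlongrightarrow> 0) (at_right (0::real))"
      unfolding o_def using filterlim_compose filterlim_inverse_at_top_right by blast
    moreover have "(\<lambda>x::real. x ^ n / exp x) \<circ> inverse = (\<lambda>t. (1 / t) ^ n * exp (- (1 / t)))"
      by (auto simp: fun_eq_iff exp_minus field_simps)
    ultimately show ?thesis by simp
  qed
  moreover have "eventually (\<lambda>t. t > 0) (at_right (0::real))" by (rule eventually_at_right_less)
  ultimately have "(exp_flat n \<longlongrightarrow> 0) (at_right 0)"
    by (rule_tac Lim_transform_eventually) (auto elim: eventually_mono simp: exp_flat_def)
  moreover have "(exp_flat n \<longlongrightarrow> 0) (at_left 0)"
    by (rule Lim_transform_eventually[OF tendsto_const])
      (auto simp: exp_flat_def eventually_at intro: exI[of _ 1])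
  ultimately show ?thesis using filterlim_split_at by blast
qed

lemma exp_flat_has_derivative:
  "(exp_flat n has_field_derivative (- real n * exp_flat (Suc n) x + exp_flat (n + 2) x)) (at x)"
proof -
  consider "x > 0" | "x < 0" | "x = 0" by linarith
  then show ?thesis
  proof cases
    case 1
    have "((\<lambda>t. (1 / t) ^ n * exp (- (1 / t))) has_field_derivative
        (- real n * exp_flat (Suc n) x + exp_flat (n + 2) x)) (at x)"
    proof (cases n)
      case 0
      then show ?thesis using 1
        by (auto intro!: derivative_eq_intros simp: exp_flat_def field_simps power2_eq_square)
    next
      case (Suc m)
      have inv: "((\<lambda>t. 1 / t) has_field_derivative - ((1 / x) * (1 / x))) (at x)"
        using 1 by (auto intro!: derivative_eq_intros simp: field_simps)
      have "((\<lambda>t. (1 / t) ^ Suc m * exp (- (1 / t))) has_field_derivative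
          real (Suc m) * (- ((1 / x) * (1 / x)) * (1 / x) ^ m) * exp (- (1 / x)) +
          exp (- (1 / x)) * - (- ((1 / x) * (1 / x))) * (1 / x) ^ Suc m) (at x)"
        using DERIV_mult[OF DERIV_power_Suc[OF inv, of m]
            DERIV_fun_exp[OF DERIV_minus[OF inv]]] by (simp only: of_nat_Suc add.commute)
      then show ?thesis using 1 unfolding Suc by (auto elim!: DERIV_cong simp: exp_flat_def field_simps)
    qed
    then show ?thesis
      by (rule has_field_derivative_transform_within_open[of _ _ _ "{0<..}"]) (use 1 in \<open>auto simp: exp_flat_def\<close>)
  next
    case 2
    have "((\<lambda>t. 0) has_field_derivative (- real n * exp_flat (Suc n) x + exp_flat (n + 2) x)) (at x)"
      using 2 by (auto simp: exp_flat_def)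
    then show ?thesis
      by (rule has_field_derivative_transform_within_open[of _ _ _ "{..<0}"]) (use 2 in \<open>auto simp: exp_flat_def\<close>)
  next
    case 3
    \<comment> \<open>The difference quotient of \<open>exp_flat n\<close> at 0 is
      \<open>exp_flat (Suc n)\<close>, which tends to 0.\<close>
    have "((\<lambda>y. (exp_flat n y - exp_flat n 0) / (y - 0)) \<longlongrightarrow> 0) (at 0)"
    proof (rule Lim_transform_eventually[OF exp_flat_tendsto_0[of "Suc n"]])
      show "\<forall>\<^sub>F x in at 0. exp_flat (Suc n) x = (exp_flat n x - exp_flat n 0) / (x - 0)"
        by (auto simp: exp_flat_def field_simps)
    qed
    then show ?thesis using 3 by (simp add: has_field_derivative_iff exp_flat_def)
  qed
qed

lemma smooth_on_exp_flat: "smooth_on UNIV (exp_flat n)"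
  unfolding smooth_on_def
proof
  fix k show "k_smooth_on k UNIV (exp_flat n)"
  proof (induction k arbitrary: n)
    case 0
    show ?case using exp_flat_has_derivative
      by (auto intro!: continuous_at_imp_continuous_on DERIV_isCont)
  next
    case (Suc k)
    show ?case
    proof (rule k_smooth_on_SucI)
      show "(exp_flat n has_derivative (\<lambda>v. (- real n * exp_flat (Suc n) x + exp_flat (n + 2) x) * v)) (at x)" for x
        using exp_flat_has_derivative[of n x] by (simp add: has_field_derivative_def)
      show "k_smooth_on k UNIV (\<lambda>x. (- real n * exp_flat (Suc n) x + exp_flat (n + 2) x) * v)" for v
        by (intro k_smooth_on_bilinear[OF bounded_bilinear_mult] k_smooth_on_add k_smooth_on_const Suc.IH open_UNIV)
    qed auto
  qed
qed

text \<open>The classical exp (-1 / (r^2 - |x - a|^2)) inside the open ball. It has no plateau of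
  value 1, so its value and derivative show up in later formulas and are divided out or subtracted
  there.\<close>

definition bump :: "'a::euclidean_space \<Rightarrow> real \<Rightarrow> 'a \<Rightarrow> real" where
  "bump a r x = exp_flat 0 (r\<^sup>2 - (x - a) \<bullet> (x - a))"

lemma smooth_on_bump: "smooth_on UNIV (bump a r)"
proof -
  have id: "smooth_on UNIV (\<lambda>x::'a. x + (- a))"
    by (intro smooth_on_add smooth_on_bounded_linear smooth_on_const bounded_linear_ident open_UNIV)
  have "smooth_on UNIV (\<lambda>x. r\<^sup>2 + (- 1) * ((x + (- a)) \<bullet> (x + (- a))))"
    by (intro smooth_on_add smooth_on_const smooth_on_bilinear[OF bounded_bilinear_mult]
        smooth_on_bilinear[OF bounded_bilinear_inner] id open_UNIV)
  from smooth_on_compose[OF smooth_on_exp_flat this, of 0] show ?thesis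
    unfolding bump_def by simp
qed

lemma bump_pos_iff:
  assumes "r > 0" shows "bump a r x > 0 \<longleftrightarrow> x \<in> ball a r"
proof -
  have "bump a r x > 0 \<longleftrightarrow> (norm (x - a))\<^sup>2 < r\<^sup>2"
    by (auto simp: bump_def exp_flat_def power2_norm_eq_inner)
  also have "\<dots> \<longleftrightarrow> norm (x - a) < r"
    using assms power2_less_imp_less[of "norm (x - a)" r] power_strict_mono[of "norm (x - a)" r 2] by auto
  finally show ?thesis by (simp add: dist_norm norm_minus_commute)
qed

lemma bump_eq_0_iff: "r > 0 \<Longrightarrow> bump a r x = 0 \<longleftrightarrow> x \<notin> ball a r"
  using bump_pos_iff[of r a x] by (auto simp: bump_def exp_flat_def)

section \<open>Atlases and tangent vectors\<close>

lemma chart_chart_inv: "x \<in> snd c ` fst c \<Longrightarrow> snd c (chart_inv c x) = x"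
  by (rule f_inv_into_f)

lemma chart_inv_mem: "x \<in> snd c ` fst c \<Longrightarrow> chart_inv c x \<in> fst c"
  by (rule inv_into_into)

text \<open>The tangent vector with prescribed coordinates e in the chart c. It is the inverse of
  evaluation at c and identifies \<open>tangent_space A p\<close> with \<open>'e\<close>.\<close>

definition tvec_at :: "('m, 'e::real_normed_vector) chart set \<Rightarrow> ('m, 'e) chart \<Rightarrow> 'm \<Rightarrow> 'e \<Rightarrow> ('m, 'e) tvec" where
  "tvec_at A c p e = (\<lambda>d. if d \<in> A \<and> p \<in> fst d
     then frechet_derivative (snd d \<circ> chart_inv c) (at (snd c p)) e else 0)"

text \<open>Only the charts, without a topology on \<open>'m\<close>: the tangent bundle is given by
  its atlas alone, and in this form the same theory serves both M and TM.\<close>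

locale smooth_atlas =
  fixes A :: "('m, 'e::euclidean_space) chart set"
  assumes inj_chart: "c \<in> A \<Longrightarrow> inj_on (snd c) (fst c)"
    and open_overlap: "c \<in> A \<Longrightarrow> d \<in> A \<Longrightarrow> open (snd c ` (fst c \<inter> fst d))"
    and smooth_transition:
      "c \<in> A \<Longrightarrow> d \<in> A \<Longrightarrow> smooth_on (snd c ` (fst c \<inter> fst d)) (snd d \<circ> chart_inv c)"
begin

lemma open_chart_image: "c \<in> A \<Longrightarrow> open (snd c ` fst c)"
  using open_overlap[of c c] by simp

lemma chart_inv_chart [simp]: "c \<in> A \<Longrightarrow> p \<in> fst c \<Longrightarrow> chart_inv c (snd c p) = p"
  by (rule inv_into_f_f[OF inj_chart])

lemma chart_at: "p \<in> mpoints A \<Longrightarrow> chart_at A p \<in> A \<and> p \<in> fst (chart_at A p)"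
  unfolding chart_at_def mpoints_def by (rule someI_ex) auto

lemma chart_mpoints: "c \<in> A \<Longrightarrow> p \<in> fst c \<Longrightarrow> p \<in> mpoints A"
  by (auto simp: mpoints_def)

lemma transition_has_derivative:
  assumes "c \<in> A" "d \<in> A" "p \<in> fst c" "p \<in> fst d"
  shows "((snd d \<circ> chart_inv c) has_derivative
    frechet_derivative (snd d \<circ> chart_inv c) (at (snd c p))) (at (snd c p))"
  using smooth_on_differentiable[OF smooth_transition[OF assms(1,2)], of "snd c p"] assms(3,4)
  by (auto simp: frechet_derivative_works)

lemma linear_transition_derivative:
  assumes "c \<in> A" "d \<in> A" "p \<in> fst c" "p \<in> fst d"
  shows "linear (frechet_derivative (snd d \<circ> chart_inv c) (at (snd c p)))"
  using transition_has_derivative[OF assms] by (rule has_derivative_linear)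

lemma has_derivative_change_chart:
  assumes "c \<in> A" "d \<in> A" "p \<in> fst c" "p \<in> fst d"
    and "((G \<circ> chart_inv d) has_derivative D) (at (snd d p))"
  shows "((G \<circ> chart_inv c) has_derivative
    (D \<circ> frechet_derivative (snd d \<circ> chart_inv c) (at (snd c p)))) (at (snd c p))"
proof -
  have "(snd d \<circ> chart_inv c) (snd c p) = snd d p" using assms by simp
  then have "(((G \<circ> chart_inv d) \<circ> (snd d \<circ> chart_inv c)) has_derivative
    (D \<circ> frechet_derivative (snd d \<circ> chart_inv c) (at (snd c p)))) (at (snd c p))"
    using assms by (intro diff_chain_at transition_has_derivative) auto
  then show ?thesis
    by (rule has_derivative_transform_within_open[OF _ open_overlap[OF assms(1,2)]])
      (use assms in auto)
qed

lemma transition_derivative_compose: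
  assumes "c \<in> A" "d \<in> A" "b \<in> A" "p \<in> fst c" "p \<in> fst d" "p \<in> fst b"
  shows "frechet_derivative (snd b \<circ> chart_inv c) (at (snd c p)) e =
    frechet_derivative (snd b \<circ> chart_inv d) (at (snd d p))
      (frechet_derivative (snd d \<circ> chart_inv c) (at (snd c p)) e)"
  using frechet_derivative_eqI[OF has_derivative_change_chart[OF assms(1,2,4,5)
        transition_has_derivative[OF assms(2,3,5,6)]]] by simp

lemma transition_derivative_refl:
  assumes "c \<in> A" "p \<in> fst c"
  shows "frechet_derivative (snd c \<circ> chart_inv c) (at (snd c p)) e = e"
proof -
  have "((\<lambda>x. x) has_derivative (\<lambda>x. x)) (at (snd c p))" by (rule has_derivative_ident)
  then have "((snd c \<circ> chart_inv c) has_derivative (\<lambda>x. x)) (at (snd c p))"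
    by (rule has_derivative_transform_within_open[OF _ open_chart_image[OF assms(1)]])
      (use assms in auto)
  then show ?thesis using frechet_derivative_eqI by metis
qed

lemma tangent_spaceD:
  assumes "v \<in> tangent_space A p" "c \<in> A" "d \<in> A" "p \<in> fst c" "p \<in> fst d"
  shows "v d = frechet_derivative (snd d \<circ> chart_inv c) (at (snd c p)) (v c)"
  using assms unfolding tangent_space_def by blast

lemma tvec_at_mem:
  assumes "c \<in> A" "p \<in> fst c" shows "tvec_at A c p e \<in> tangent_space A p"
  unfolding tangent_space_def
proof (intro CollectI conjI ballI impI allI)
  fix b d assume bd: "b \<in> A" "d \<in> A" "p \<in> fst b \<and> p \<in> fst d"
  then show "tvec_at A c p e d =
      frechet_derivative (snd d \<circ> chart_inv b) (at (snd b p)) (tvec_at A c p e b)"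
    using transition_derivative_compose[OF assms(1) bd(1,2) assms(2)] by (simp add: tvec_at_def)
qed (auto simp: tvec_at_def)

lemma tvec_at_self [simp]: "c \<in> A \<Longrightarrow> p \<in> fst c \<Longrightarrow> tvec_at A c p e c = e"
  by (simp add: tvec_at_def transition_derivative_refl)

lemma tangent_eq_tvec_at:
  assumes "v \<in> tangent_space A p" "c \<in> A" "p \<in> fst c"
  shows "v = tvec_at A c p (v c)"
proof
  fix d
  show "v d = tvec_at A c p (v c) d"
  proof (cases "d \<in> A \<and> p \<in> fst d")
    case True
    then show ?thesis
      using tangent_spaceD[OF assms(1,2) _ assms(3)] by (simp add: tvec_at_def)
  next
    case False
    then have "v d = 0" using assms(1) unfolding tangent_space_def by blast
    then show ?thesis using False by (auto simp: tvec_at_def)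
  qed
qed

lemma tangent_eqI:
  assumes "v \<in> tangent_space A p" "w \<in> tangent_space A p" "c \<in> A" "p \<in> fst c" "v c = w c"
  shows "v = w"
  using tangent_eq_tvec_at assms by metis

lemma tangent_space_lincomb:
  assumes "v \<in> tangent_space A p" "w \<in> tangent_space A p"
  shows "(\<lambda>c. a *\<^sub>R v c + b *\<^sub>R w c) \<in> tangent_space A p"
  unfolding tangent_space_def
proof (intro CollectI conjI ballI impI allI)
  fix c d assume cd: "c \<in> A" "d \<in> A" "p \<in> fst c \<and> p \<in> fst d"
  note lin = linear_transition_derivative[OF cd(1,2) conjunct1[OF cd(3)] conjunct2[OF cd(3)]]
  show "a *\<^sub>R v d + b *\<^sub>R w d =
      frechet_derivative (snd d \<circ> chart_inv c) (at (snd c p)) (a *\<^sub>R v c + b *\<^sub>R w c)"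
    using cd assms tangent_spaceD[of v p c d] tangent_spaceD[of w p c d]
    by (simp add: linear_add[OF lin] linear_cmul[OF lin])
qed (use assms in \<open>auto simp: tangent_space_def\<close>)

lemma zero_tangent: "(\<lambda>c. 0) \<in> tangent_space A p"
  unfolding tangent_space_def
  using linear_0[OF linear_transition_derivative] by auto

lemma tvec_at_lincomb:
  assumes "c \<in> A" "p \<in> fst c"
  shows "tvec_at A c p (a *\<^sub>R e + b *\<^sub>R e') = (\<lambda>d. a *\<^sub>R tvec_at A c p e d + b *\<^sub>R tvec_at A c p e' d)"
  by (rule tangent_eqI[of _ p _ c]) (use assms in \<open>auto intro: tvec_at_mem tangent_space_lincomb\<close>)

lemma tvec_at_0: "c \<in> A \<Longrightarrow> p \<in> fst c \<Longrightarrow> tvec_at A c p 0 = (\<lambda>c. 0)"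
  by (rule tangent_eqI[of _ p _ c]) (auto intro: tvec_at_mem zero_tangent)

text \<open>The definition uses the arbitrary chart \<open>chart_at A p\<close>. Passing to c
  composes the derivative with the transition derivative, which is exactly what turns the
  coordinates of v in that chart into \<open>v c\<close>.\<close>

lemma differential_chart:
  assumes "c \<in> A" "p \<in> fst c" "v \<in> tangent_space A p" "d \<in> B" "F p \<in> fst d"
    and "((snd d \<circ> F \<circ> chart_inv c) has_derivative D) (at (snd c p))"
  shows "differential A B F p v d = D (v c)"
proof -
  define b where "b = chart_at A p"
  have b: "b \<in> A" "p \<in> fst b" using chart_at assms chart_mpoints b_def by auto
  have "frechet_derivative (snd d \<circ> F \<circ> chart_inv b) (at (snd b p)) =
      D \<circ> frechet_derivative (snd c \<circ> chart_inv b) (at (snd b p))"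
    by (intro frechet_derivative_eqI has_derivative_change_chart) (use assms b in auto)
  then show ?thesis
    using assms tangent_spaceD[OF assms(3) b(1) assms(1) b(2) assms(2)]
    by (simp add: differential_def b_def Let_def)
qed

lemma dir_deriv_chart:
  assumes "c \<in> A" "p \<in> fst c" "v \<in> tangent_space A p"
    and "((f \<circ> chart_inv c) has_derivative D) (at (snd c p))"
  shows "dir_deriv A p v f = D (v c)"
proof -
  define b where "b = chart_at A p"
  have b: "b \<in> A" "p \<in> fst b" using chart_at assms chart_mpoints b_def by auto
  have "frechet_derivative (f \<circ> chart_inv b) (at (snd b p)) =
      D \<circ> frechet_derivative (snd c \<circ> chart_inv b) (at (snd b p))"
    by (intro frechet_derivative_eqI has_derivative_change_chart) (use assms b in auto)
  then show ?thesis
    using tangent_spaceD[OF assms(3) b(1) assms(1) b(2) assms(2)]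
    by (simp add: dir_deriv_def b_def Let_def)
qed

section \<open>Charts of the tangent bundle\<close>

lemma fst_bundle_chart: "u \<in> fst (bundle_chart A c) \<longleftrightarrow> u \<in> tangent_bundle A \<and> fst u \<in> fst c"
  by (simp add: bundle_chart_def)

lemma snd_bundle_chart: "snd (bundle_chart A c) u = (snd c (fst u), snd u c)"
  by (simp add: bundle_chart_def case_prod_beta)

lemma tangent_bundle_iff: "(p, v) \<in> tangent_bundle A \<longleftrightarrow> p \<in> mpoints A \<and> v \<in> tangent_space A p"
  by (simp add: tangent_bundle_def)

text \<open>The fibre coordinate is unrestricted because \<open>tvec_at A c p e\<close> realises
  every e over every point p of the chart domain.\<close>

lemma bundle_chart_overlap_image:
  assumes "c \<in> A"
  shows "snd (bundle_chart A c) ` (fst (bundle_chart A c) \<inter> fst (bundle_chart A d)) =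
    (snd c ` (fst c \<inter> fst d)) \<times> UNIV"
proof (intro equalityI subsetI)
  fix y assume "y \<in> (snd c ` (fst c \<inter> fst d)) \<times> (UNIV :: 'e set)"
  then obtain p e where p: "p \<in> fst c" "p \<in> fst d" "y = (snd c p, e)" by auto
  then have "(p, tvec_at A c p e) \<in> tangent_bundle A"
    using assms by (auto simp: tangent_bundle_iff tvec_at_mem chart_mpoints)
  moreover have "y = snd (bundle_chart A c) (p, tvec_at A c p e)"
    using p assms by (simp add: snd_bundle_chart)
  ultimately show "y \<in> snd (bundle_chart A c) ` (fst (bundle_chart A c) \<inter> fst (bundle_chart A d))"
    using p by (intro image_eqI) (auto simp: fst_bundle_chart)
qed (auto simp: fst_bundle_chart snd_bundle_chart)

lemma bundle_chart_image:
  "c \<in> A \<Longrightarrow> snd (bundle_chart A c) ` fst (bundle_chart A c) = (snd c ` fst c) \<times> UNIV"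
  using bundle_chart_overlap_image[of c c] by simp

lemma inj_bundle_chart:
  assumes "c \<in> A" shows "inj_on (snd (bundle_chart A c)) (fst (bundle_chart A c))"
proof (rule inj_onI)
  fix u u' assume *: "u \<in> fst (bundle_chart A c)" "u' \<in> fst (bundle_chart A c)"
    "snd (bundle_chart A c) u = snd (bundle_chart A c) u'"
  then have "fst u = fst u'"
    using inj_chart[OF assms] by (auto simp: fst_bundle_chart snd_bundle_chart inj_on_def)
  moreover have "snd u = snd u'"
    using * assms calculation tangent_eqI[of "snd u" "fst u" "snd u'" c]
    by (auto simp: fst_bundle_chart snd_bundle_chart tangent_bundle_def)
  ultimately show "u = u'" by (simp add: prod_eq_iff)
qed

lemma bundle_chart_inv:
  assumes "c \<in> A" "x \<in> snd c ` fst c"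
  shows "chart_inv (bundle_chart A c) (x, e) = (chart_inv c x, tvec_at A c (chart_inv c x) e)"
proof -
  let ?u = "(chart_inv c x, tvec_at A c (chart_inv c x) e)"
  have p: "chart_inv c x \<in> fst c" using assms(2) by (rule chart_inv_mem)
  then have "?u \<in> fst (bundle_chart A c)"
    using assms by (auto simp: fst_bundle_chart tangent_bundle_iff tvec_at_mem chart_mpoints)
  moreover have "snd (bundle_chart A c) ?u = (x, e)"
    using assms p chart_chart_inv by (auto simp: snd_bundle_chart)
  ultimately show ?thesis
    using inv_into_f_f[OF inj_bundle_chart[OF assms(1)]] by metis
qed

lemma bundle_transition:
  assumes "c \<in> A" "d \<in> A" "x \<in> snd c ` (fst c \<inter> fst d)"
  shows "(snd (bundle_chart A d) \<circ> chart_inv (bundle_chart A c)) (x, e) =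
    ((snd d \<circ> chart_inv c) x, frechet_derivative (snd d \<circ> chart_inv c) (at x) e)"
proof -
  have "x \<in> snd c ` fst c" "chart_inv c x \<in> fst d" using assms by auto
  then show ?thesis
    using assms(1,2) chart_chart_inv[of x c] by (simp add: bundle_chart_inv snd_bundle_chart tvec_at_def)
qed

lemma smooth_atlas_bundle: "smooth_atlas (bundle_atlas A)"
proof
  fix C assume "C \<in> bundle_atlas A"
  then obtain c where c: "c \<in> A" "C = bundle_chart A c" by (auto simp: bundle_atlas_def)
  then show "inj_on (snd C) (fst C)" using inj_bundle_chart by simp
  fix D assume "D \<in> bundle_atlas A"
  then obtain d where d: "d \<in> A" "D = bundle_chart A d" by (auto simp: bundle_atlas_def)
  let ?S = "snd c ` (fst c \<inter> fst d)" let ?f = "snd d \<circ> chart_inv c"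
  have im: "snd C ` (fst C \<inter> fst D) = ?S \<times> UNIV"
    using bundle_chart_overlap_image[OF c(1)] c d by simp
  have S: "open ?S" "open (?S \<times> (UNIV :: 'e set))"
    using open_overlap[OF c(1) d(1)] by (auto intro: open_Times)
  then show "open (snd C ` (fst C \<inter> fst D))" using im by simp
  note f = smooth_transition[OF c(1) d(1)]
  have fst': "smooth_on (?S \<times> (UNIV :: 'e set)) (fst :: _ \<Rightarrow> 'e)"
    and snd': "smooth_on (?S \<times> (UNIV :: 'e set)) (snd :: _ \<Rightarrow> 'e)"
    by (auto intro: smooth_on_bounded_linear bounded_linear_fst bounded_linear_snd S)
  have f1: "smooth_on (?S \<times> (UNIV :: 'e set)) (\<lambda>y. ?f (fst y))"
    by (rule smooth_on_compose[OF f fst' S(2)]) auto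
  have f2: "smooth_on (?S \<times> (UNIV :: 'e set)) (\<lambda>y. frechet_derivative ?f (at (fst y)) i)" for i
    by (rule smooth_on_compose[OF smooth_on_deriv[OF f] fst' S(2)]) auto
  \<comment> \<open>The fibre part of the transition applies a derivative to the moving vector
    \<open>snd y\<close>; the basis expansion makes it a sum of products of smooth
    functions.\<close>
  have f3: "smooth_on (?S \<times> (UNIV :: 'e set))
    (\<lambda>y. \<Sum>i\<in>Basis. (snd y \<bullet> i) *\<^sub>R frechet_derivative ?f (at (fst y)) i)"
    by (rule smooth_on_sum[OF smooth_on_bilinear[OF bounded_bilinear_scaleR
        smooth_on_linear_comp[OF bounded_linear_inner_left snd' S(2)] f2 S(2)] S(2)])
  have "smooth_on (?S \<times> (UNIV :: 'e set)) (snd D \<circ> chart_inv C)"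
  proof (rule smooth_on_transform[OF smooth_on_Pair[OF f1 f3 S(2)] S(2)])
    fix y :: "'e \<times> 'e" assume "y \<in> ?S \<times> UNIV"
    then obtain p e where p: "p \<in> fst c" "p \<in> fst d" "y = (snd c p, e)" by auto
    note lin = linear_transition_derivative[OF c(1) d(1) p(1,2)]
    show "(?f (fst y), \<Sum>i\<in>Basis. (snd y \<bullet> i) *\<^sub>R frechet_derivative ?f (at (fst y)) i) =
        (snd D \<circ> chart_inv C) y"
      using bundle_transition[OF c(1) d(1), of "snd c p" e] p
        linear_euclidean_sum[OF lin, of e] c(2) d(2) by (simp del: o_apply)
  qed
  then show "smooth_on (snd C ` (fst C \<inter> fst D)) (snd D \<circ> chart_inv C)" using im by simp
qed

lemma fst_bundle_transition_has_derivative: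
  assumes "c \<in> A" "d \<in> A" "p \<in> fst c" "p \<in> fst d"
  shows "((snd d \<circ> fst \<circ> chart_inv (bundle_chart A c)) has_derivative
    (\<lambda>a. frechet_derivative (snd d \<circ> chart_inv c) (at (snd c p)) (fst a))) (at (snd c p, e))"
proof -
  let ?S = "snd c ` (fst c \<inter> fst d)"
  have "(((snd d \<circ> chart_inv c) \<circ> fst) has_derivative
    (frechet_derivative (snd d \<circ> chart_inv c) (at (snd c p)) \<circ> fst)) (at (snd c p, e))"
    using transition_has_derivative[OF assms]
    by (intro diff_chain_at bounded_linear_imp_has_derivative bounded_linear_fst) auto
  then have "((snd d \<circ> fst \<circ> chart_inv (bundle_chart A c)) has_derivative
    (frechet_derivative (snd d \<circ> chart_inv c) (at (snd c p)) \<circ> fst)) (at (snd c p, e))"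
  proof (rule has_derivative_transform_within_open)
    show "open (?S \<times> (UNIV :: 'e set))" by (intro open_Times open_overlap open_UNIV assms)
  qed (use assms in \<open>auto simp: bundle_chart_inv\<close>)
  then show ?thesis by (simp add: o_def)
qed

text \<open>Read in bundle charts, the projection is a base transition applied to the first
  component, so its differential sees only that component of a.\<close>

lemma differential_fst:
  assumes "u \<in> tangent_bundle A" "a \<in> tangent_space (bundle_atlas A) u" "c \<in> A" "fst u \<in> fst c"
  shows "differential (bundle_atlas A) A fst u a = tvec_at A c (fst u) (fst (a (bundle_chart A c)))"
proof
  interpret TM: smooth_atlas "bundle_atlas A" by (rule smooth_atlas_bundle)
  fix d
  show "differential (bundle_atlas A) A fst u a d = tvec_at A c (fst u) (fst (a (bundle_chart A c))) d"
  proof (cases "d \<in> A \<and> fst u \<in> fst d")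
    case True
    have "((snd d \<circ> fst \<circ> chart_inv (bundle_chart A c)) has_derivative
      (\<lambda>a. frechet_derivative (snd d \<circ> chart_inv c) (at (snd c (fst u))) (fst a)))
      (at (snd (bundle_chart A c) u))"
      using fst_bundle_transition_has_derivative[OF assms(3) _ assms(4)] True
      by (simp add: snd_bundle_chart)
    from TM.differential_chart[OF _ _ assms(2) _ _ this] True assms show ?thesis
      by (auto simp: bundle_atlas_def fst_bundle_chart tvec_at_def)
  qed (auto simp: differential_def tvec_at_def)
qed

end

section \<open>Curves and their lengths\<close>

lemma continuous_on_frechet_derivative:
  fixes f :: "'a::euclidean_space \<Rightarrow> 'b::real_normed_vector"
  assumes "smooth_on S f"
  shows "continuous_on (S \<times> UNIV) (\<lambda>y. frechet_derivative f (at (fst y)) (snd y))"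
proof -
  have "continuous_on (S \<times> UNIV) (\<lambda>y. frechet_derivative f (at (fst y)) i)" for i
    by (rule continuous_on_compose2[OF smooth_on_continuous[OF smooth_on_deriv[OF assms]]])
      (auto intro: continuous_intros)
  then have "continuous_on (S \<times> UNIV)
      (\<lambda>y. \<Sum>i\<in>Basis. (snd y \<bullet> i) *\<^sub>R frechet_derivative f (at (fst y)) i)"
    by (intro continuous_intros)
  moreover have "(\<Sum>i\<in>Basis. (snd y \<bullet> i) *\<^sub>R frechet_derivative f (at (fst y)) i) =
      frechet_derivative f (at (fst y)) (snd y)" if "y \<in> S \<times> UNIV" for y
    using that linear_euclidean_sum[OF linear_frechet_derivative[OF smooth_on_differentiable[OF assms]], of "fst y" "snd y"]
    by auto
  ultimately show ?thesis
    by (subst continuous_on_cong[OF refl, symmetric]) auto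
qed

text \<open>\<open>C\<close> is the set of times at which a path lies in a compact set, \<open>G\<close> the set of times at which
  it lies in its interior: a path that cannot reach the boundary never leaves.\<close>

lemma trapped_interval:
  fixes I :: "real set"
  assumes "convex I" "openin (top_of_set I) G" "closedin (top_of_set I) C" "G \<subseteq> C" "s \<in> G"
    and trap: "\<And>t. t \<in> I \<Longrightarrow> closed_segment s t \<subseteq> C \<Longrightarrow> t \<in> G"
  shows "I \<subseteq> G"
proof -
  have GI: "G \<subseteq> I" using assms(2) openin_imp_subset by blast
  define Q where "Q = connected_component_set G s"
  have "openin (top_of_set I) Q"
    unfolding Q_def
    by (rule locally_connected_2[OF convex_imp_locally_connected[OF assms(1)] assms(2,5)])
  have sQ: "s \<in> Q" using assms(5) by (simp add: Q_def)
  have QG: "Q \<subseteq> G" by (simp add: Q_def connected_component_subset)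
  obtain C' where C': "closed C'" "C = I \<inter> C'"
    using assms(3) by (auto simp: closedin_closed)
  \<comment> \<open>For a point t of R the segment from s to t lies in R, hence in C, so the
    trapping property puts t into G. Thus R is a connected part of G containing s, which forces it
    into the component Q: the component is closed as well as open.\<close>
  define R where "R = closure Q \<inter> I"
  have "closure Q \<subseteq> C'" using QG assms(4) C' by (intro closure_minimal) auto
  then have RC: "R \<subseteq> C" using C' R_def by auto
  have QR: "Q \<subseteq> R" using QG GI closure_subset by (auto simp: R_def)
  have "connected R"
    by (rule connected_intermediate_closure[OF _ QR]) (auto simp: Q_def R_def)
  then have Rc: "convex R" using is_interval_connected_1 is_interval_convex_1 by blast
  have "R \<subseteq> G"
  proof
    fix t assume "t \<in> R"
    then have "closed_segment s t \<subseteq> R"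
      using Rc sQ QR by (intro closed_segment_subset) auto
    then show "t \<in> G" using trap[of t] RC \<open>t \<in> R\<close> by (auto simp: R_def)
  qed
  then have "R \<subseteq> Q"
    unfolding Q_def using \<open>connected R\<close> sQ QR by (intro connected_component_maximal) auto
  then have "closedin (top_of_set I) Q"
    using QR by (metis R_def closed_closure closedin_closed_Int inf_commute subset_antisym)
  with \<open>openin (top_of_set I) Q\<close> have "Q = {} \<or> Q = I"
    using convex_connected[OF assms(1)] by (auto simp: connected_clopen)
  then show ?thesis using sQ QG by auto
qed

text \<open>Turns a pointwise bound on a derivative by the speed into a bound on the displacement by
  the length. The integral on the right runs over all of {0..1}, since the length of the whole curve
  is what is known to be small.\<close>

lemma norm_diff_le_integral:
  fixes y :: "real \<Rightarrow> 'a::euclidean_space"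
  assumes "continuous_on {s..t} y" "finite P" "0 \<le> s" "s \<le> t" "t \<le> 1"
    and deriv: "\<And>\<tau>. \<tau> \<in> {s<..<t} - P \<Longrightarrow> \<exists>y'. (y has_vector_derivative y') (at \<tau>) \<and> norm y' \<le> C * f \<tau>"
    and f: "\<And>\<tau>. 0 \<le> f \<tau>" "f integrable_on {0..1}" and "0 \<le> C"
  shows "norm (y t - y s) \<le> C * integral {0..1} f"
proof -
  obtain z where z: "\<And>\<tau>. \<tau> \<in> {s<..<t} - P \<Longrightarrow>
      (y has_vector_derivative z \<tau>) (at \<tau>) \<and> norm (z \<tau>) \<le> C * f \<tau>"
    using deriv by metis
  \<comment> \<open>With the value 0 at exceptional times the bound by \<open>C * f\<close> holds
    everywhere, because f is nonnegative.\<close>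
  define w where "w = (\<lambda>\<tau>. if \<tau> \<in> {s<..<t} - P then z \<tau> else 0)"
  have w: "(w has_integral (y t - y s)) {s..t}"
    by (rule fundamental_theorem_of_calculus_interior_strong[OF assms(2,4) _ assms(1)])
      (use z in \<open>auto simp: w_def\<close>)
  have fst: "f integrable_on {s..t}"
    by (rule integrable_on_subinterval[OF f(2)]) (use assms in auto)
  have "norm (integral {s..t} w) \<le> integral {s..t} (\<lambda>\<tau>. C * f \<tau>)"
  proof (rule integral_norm_bound_integral)
    show "norm (w \<tau>) \<le> C * f \<tau>" for \<tau>
      using z[of \<tau>] f(1)[of \<tau>] \<open>0 \<le> C\<close> by (auto simp: w_def)
  qed (use w fst in \<open>auto intro: integrable_on_mult_right\<close>)
  also have "\<dots> = C * integral {s..t} f" by simp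
  also have "\<dots> \<le> C * integral {0..1} f"
    using \<open>0 \<le> C\<close> f fst assms by (intro mult_left_mono integral_subset_le) auto
  finally show ?thesis using w by (simp add: integral_unique)
qed

lemma has_vector_derivative_interior:
  assumes "(f has_vector_derivative D) (at s within I)" "s \<in> interior I"
  shows "(f has_vector_derivative D) (at s)"
  using assms at_within_interior by metis

lemma finite_avoid_right:
  fixes P :: "real set"
  assumes "finite P" "t < b"
  obtains d where "0 < d" "t + d \<le> b" "{t<..<t+d} \<inter> P = {}"
proof -
  obtain e where e: "e > 0" "\<forall>x\<in>P. x \<noteq> t \<longrightarrow> e \<le> dist t x"
    using finite_set_avoid[OF assms(1)] by metis
  show ?thesis
    by (rule that[of "min e (b - t)"]) (use e assms in \<open>auto simp: dist_real_def min_def abs_if split: if_splits\<close>)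
qed

lemma finite_avoid_left:
  fixes P :: "real set"
  assumes "finite P" "a < t"
  obtains d where "0 < d" "a \<le> t - d" "{t-d<..<t} \<inter> P = {}"
proof -
  obtain e where e: "e > 0" "\<forall>x\<in>P. x \<noteq> t \<longrightarrow> e \<le> dist t x"
    using finite_set_avoid[OF assms(1)] by metis
  show ?thesis
    by (rule that[of "min e (t - a)"]) (use e assms in \<open>auto simp: dist_real_def min_def abs_if split: if_splits\<close>)
qed

section \<open>Piecewise C1 curves in charts\<close>

context smooth_atlas
begin

text \<open>A C1 curve comes with one suitable chart at each time. The transition maps carry its
  derivative to any prescribed chart around the point.\<close>

lemma C1_curve_on_chart:
  assumes "C1_curve_on A \<gamma> a b" "t \<in> {a..b}" "c \<in> A" "\<gamma> t \<in> fst c"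
  shows "\<exists>\<epsilon>>0. \<exists>D. \<gamma> ` ({a..b} \<inter> ball t \<epsilon>) \<subseteq> fst c \<and>
    (\<forall>s\<in>{a..b} \<inter> ball t \<epsilon>. ((snd c \<circ> \<gamma>) has_vector_derivative D s) (at s within {a..b} \<inter> ball t \<epsilon>)) \<and>
    continuous_on ({a..b} \<inter> ball t \<epsilon>) D"
proof -
  obtain d \<epsilon>' D' where d: "d \<in> A" "\<epsilon>' > 0" "\<gamma> ` ({a..b} \<inter> ball t \<epsilon>') \<subseteq> fst d"
    "\<forall>s\<in>{a..b} \<inter> ball t \<epsilon>'. ((snd d \<circ> \<gamma>) has_vector_derivative D' s) (at s within {a..b} \<inter> ball t \<epsilon>')"
    "continuous_on ({a..b} \<inter> ball t \<epsilon>') D'"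
    using assms(1,2) unfolding C1_curve_on_def Let_def by meson
  let ?I' = "{a..b} \<inter> ball t \<epsilon>'" let ?x = "snd d \<circ> \<gamma>" let ?S = "snd d ` (fst d \<inter> fst c)"
  have tI: "t \<in> ?I'" using d assms by auto
  have cx: "continuous_on ?I' ?x"
    using d(4) by (meson continuous_on_eq_continuous_within has_vector_derivative_continuous)
  have "\<gamma> t \<in> fst d" using d(3) tI by blast
  then have "?x t \<in> ?S" using assms(4) by auto
  \<comment> \<open>The curve is continuous in d and the overlap is open in the coordinates of d, so
    the curve stays in c for nearby times.\<close>
  then obtain \<delta> where \<delta>: "\<delta> > 0" "\<And>s. s \<in> ?I' \<Longrightarrow> dist s t < \<delta> \<Longrightarrow> ?x s \<in> ?S"
    using cx tI open_overlap[OF d(1) assms(3)] unfolding continuous_on_iff open_dist by metis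
  define \<epsilon> where "\<epsilon> = min \<epsilon>' \<delta>"
  let ?I = "{a..b} \<inter> ball t \<epsilon>"
  have II: "?I \<subseteq> ?I'" by (auto simp: \<epsilon>_def)
  have xS: "?x s \<in> ?S" if "s \<in> ?I" for s
    using that \<delta>(2)[of s] by (auto simp: \<epsilon>_def dist_commute)
  have mem: "\<gamma> s \<in> fst c" "\<gamma> s \<in> fst d" if "s \<in> ?I" for s
  proof -
    show "\<gamma> s \<in> fst d" using d(3) II that by blast
    then show "\<gamma> s \<in> fst c"
      using xS[OF that] inj_chart[OF d(1)] by (auto simp: inj_on_def)
  qed
  let ?\<phi> = "snd c \<circ> chart_inv d"
  define D where "D = (\<lambda>s. frechet_derivative ?\<phi> (at (?x s)) (D' s))"
  have "((snd c \<circ> \<gamma>) has_vector_derivative D s) (at s within ?I)" if "s \<in> ?I" for s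
  proof -
    have "(?x has_vector_derivative D' s) (at s within ?I)"
      using d(4) that II by (blast intro: has_vector_derivative_within_subset)
    moreover have "(?\<phi> has_derivative frechet_derivative ?\<phi> (at (?x s))) (at (?x s))"
      using transition_has_derivative[OF d(1) assms(3)] mem[OF that] by auto
    then have "(?\<phi> has_derivative frechet_derivative ?\<phi> (at (?x s))) (at (?x s) within ?x ` ?I)"
      by (rule has_derivative_at_withinI)
    ultimately have "((?\<phi> \<circ> ?x) has_vector_derivative D s) (at s within ?I)"
      unfolding D_def by (rule vector_derivative_diff_chain_within)
    then show ?thesis
      by (rule has_vector_derivative_transform[rotated 2]) (use that mem d in auto)
  qed
  moreover have "continuous_on ?I D"
  proof -
    have "continuous_on ?I (\<lambda>s. (?x s, D' s))"
      using continuous_on_subset[OF cx II] continuous_on_subset[OF d(5) II]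
      by (intro continuous_on_Pair)
    from continuous_on_compose2[OF continuous_on_frechet_derivative[OF smooth_transition[OF d(1) assms(3)]] this]
    show ?thesis using xS by (auto simp: D_def image_subset_iff)
  qed
  moreover have "\<epsilon> > 0" using d(2) \<delta>(1) by (simp add: \<epsilon>_def)
  ultimately show ?thesis using mem by (intro exI[of _ \<epsilon>] conjI exI[of _ D]) auto
qed

text \<open>A closed interval with one-sided derivatives at its ends. A break point can only be an
  end, so facts at a break point are assembled from a left and a right piece.\<close>

definition C1_piece :: "('m, 'e) chart \<Rightarrow> (real \<Rightarrow> 'm) \<Rightarrow> real \<Rightarrow> real \<Rightarrow> (real \<Rightarrow> 'e) \<Rightarrow> bool" where
  "C1_piece c \<gamma> l r D \<longleftrightarrow> l < r \<and> \<gamma> ` {l..r} \<subseteq> fst c \<and>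
    (\<forall>s\<in>{l..r}. ((snd c \<circ> \<gamma>) has_vector_derivative D s) (at s within {l..r})) \<and> continuous_on {l..r} D"

lemma C1_pieceI:
  assumes "C1_curve_on A \<gamma> a b" "t \<in> {a..b}" "c \<in> A" "\<gamma> t \<in> fst c"
  shows "\<exists>\<epsilon>>0. \<forall>l r. l < r \<and> {l..r} \<subseteq> {a..b} \<inter> ball t \<epsilon> \<longrightarrow> (\<exists>D. C1_piece c \<gamma> l r D)"
proof -
  obtain \<epsilon> D where \<epsilon>: "\<epsilon> > 0" "\<gamma> ` ({a..b} \<inter> ball t \<epsilon>) \<subseteq> fst c"
    "\<forall>s\<in>{a..b} \<inter> ball t \<epsilon>. ((snd c \<circ> \<gamma>) has_vector_derivative D s) (at s within {a..b} \<inter> ball t \<epsilon>)"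
    "continuous_on ({a..b} \<inter> ball t \<epsilon>) D"
    using C1_curve_on_chart[OF assms] by blast
  show ?thesis
    unfolding C1_piece_def
  proof (intro exI[of _ \<epsilon>] conjI \<epsilon>(1) allI impI exI[of _ D] ballI)
    fix l r assume lr: "l < r \<and> {l..r} \<subseteq> {a..b} \<inter> ball t \<epsilon>"
    show "l < r" using lr by simp
    show "\<gamma> ` {l..r} \<subseteq> fst c" using lr \<epsilon>(2) by blast
    show "continuous_on {l..r} D" using lr continuous_on_subset[OF \<epsilon>(4)] by blast
    fix s assume "s \<in> {l..r}"
    then show "((snd c \<circ> \<gamma>) has_vector_derivative D s) (at s within {l..r})"
      using lr \<epsilon>(3) has_vector_derivative_within_subset by blast
  qed
qed

lemma C1_piece_right:
  assumes "piecewise_C1_curve A \<gamma>" "0 \<le> t" "t < 1" "c \<in> A" "\<gamma> t \<in> fst c"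
  shows "\<exists>d>0. t + d \<le> 1 \<and> (\<exists>D. C1_piece c \<gamma> t (t + d) D)"
proof -
  obtain P where P: "finite P"
    "\<And>a b. 0 \<le> a \<and> a < b \<and> b \<le> 1 \<and> {a<..<b} \<inter> P = {} \<Longrightarrow> C1_curve_on A \<gamma> a b"
    using assms(1) unfolding piecewise_C1_curve_def by blast
  obtain d where d: "0 < d" "t + d \<le> 1" "{t<..<t+d} \<inter> P = {}"
    using finite_avoid_right[OF P(1) assms(3)] by blast
  have "C1_curve_on A \<gamma> t (t + d)" using d assms by (intro P(2)) auto
  from C1_pieceI[OF this _ assms(4,5)] d obtain \<epsilon> where \<epsilon>: "\<epsilon> > 0"
    "\<And>l r. l < r \<and> {l..r} \<subseteq> {t..t+d} \<inter> ball t \<epsilon> \<Longrightarrow> \<exists>D. C1_piece c \<gamma> l r D"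
    by auto
  show ?thesis
    by (rule exI[of _ "min d (\<epsilon> / 2)"])
      (use d \<epsilon>(1) in \<open>auto intro!: \<epsilon>(2) simp: dist_real_def\<close>)
qed

lemma C1_piece_left:
  assumes "piecewise_C1_curve A \<gamma>" "0 < t" "t \<le> 1" "c \<in> A" "\<gamma> t \<in> fst c"
  shows "\<exists>d>0. 0 \<le> t - d \<and> (\<exists>D. C1_piece c \<gamma> (t - d) t D)"
proof -
  obtain P where P: "finite P"
    "\<And>a b. 0 \<le> a \<and> a < b \<and> b \<le> 1 \<and> {a<..<b} \<inter> P = {} \<Longrightarrow> C1_curve_on A \<gamma> a b"
    using assms(1) unfolding piecewise_C1_curve_def by blast
  obtain d where d: "0 < d" "0 \<le> t - d" "{t-d<..<t} \<inter> P = {}"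
    using finite_avoid_left[OF P(1) assms(2)] by blast
  have "C1_curve_on A \<gamma> (t - d) t" using d assms by (intro P(2)) auto
  from C1_pieceI[OF this _ assms(4,5)] d obtain \<epsilon> where \<epsilon>: "\<epsilon> > 0"
    "\<And>l r. l < r \<and> {l..r} \<subseteq> {t-d..t} \<inter> ball t \<epsilon> \<Longrightarrow> \<exists>D. C1_piece c \<gamma> l r D"
    by auto
  show ?thesis
    by (rule exI[of _ "min d (\<epsilon> / 2)"])
      (use d \<epsilon>(1) in \<open>auto intro!: \<epsilon>(2) simp: dist_real_def\<close>)
qed

lemma curve_mpoints:
  assumes "piecewise_C1_curve A \<gamma>" "t \<in> {0..1}" shows "\<gamma> t \<in> mpoints A"
proof -
  obtain P where P: "finite P"
    "\<And>a b. 0 \<le> a \<and> a < b \<and> b \<le> 1 \<and> {a<..<b} \<inter> P = {} \<Longrightarrow> C1_curve_on A \<gamma> a b"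
    using assms(1) unfolding piecewise_C1_curve_def by blast
  have "\<exists>a b. t \<in> {a..b} \<and> C1_curve_on A \<gamma> a b"
  proof (cases "t < 1")
    case True
    obtain d where "0 < d" "t + d \<le> 1" "{t<..<t+d} \<inter> P = {}"
      using finite_avoid_right[OF P(1) True] by blast
    then show ?thesis using assms by (intro exI[of _ t] exI[of _ "t + d"]) (auto intro!: P(2))
  next
    case False
    then have "0 < t" using assms by simp
    then obtain d where "0 < d" "0 \<le> t - d" "{t-d<..<t} \<inter> P = {}"
      using finite_avoid_left[OF P(1)] by blast
    then show ?thesis using assms by (intro exI[of _ "t - d"] exI[of _ t]) (auto intro!: P(2))
  qed
  then obtain a b where ab: "t \<in> {a..b}" "C1_curve_on A \<gamma> a b" by blast
  then obtain c \<epsilon> where "c \<in> A" "\<epsilon> > 0" "\<gamma> ` ({a..b} \<inter> ball t \<epsilon>) \<subseteq> fst c"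
    unfolding C1_curve_on_def Let_def by blast
  then have "\<gamma> t \<in> fst c" using ab by auto
  then show ?thesis using \<open>c \<in> A\<close> by (rule chart_mpoints[rotated])
qed

lemma C1_piece_continuous:
  assumes "C1_piece c \<gamma> l r D" shows "continuous_on {l..r} (snd c \<circ> \<gamma>)"
  using assms unfolding C1_piece_def
  by (meson continuous_on_eq_continuous_within has_vector_derivative_continuous)

text \<open>Continuity of the curve, phrased through a chart because the locale has no topology on
  \<open>'m\<close>. It holds at break points too: the closed pieces on both sides share the point
  itself.\<close>

lemma curve_continuous:
  assumes "piecewise_C1_curve A \<gamma>" "t \<in> {0..1}" "c \<in> A" "\<gamma> t \<in> fst c" "open U" "snd c (\<gamma> t) \<in> U"
  shows "\<exists>e>0. \<forall>s\<in>{0..1}. dist s t < e \<longrightarrow> \<gamma> s \<in> fst c \<and> snd c (\<gamma> s) \<in> U"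
proof -
  have near: "\<exists>e>0. \<forall>s\<in>{l..r}. dist s t < e \<longrightarrow> \<gamma> s \<in> fst c \<and> snd c (\<gamma> s) \<in> U"
    if piece: "C1_piece c \<gamma> l r D" "t \<in> {l..r}" for l r D
  proof -
    obtain e where "e > 0" "\<forall>s\<in>{l..r}. dist s t < e \<longrightarrow> (snd c \<circ> \<gamma>) s \<in> U"
      using C1_piece_continuous[OF piece(1)] piece(2) assms(5,6) unfolding continuous_on_iff open_dist
      by (metis o_apply)
    then show ?thesis using piece(1) unfolding C1_piece_def by fastforce
  qed
  have "\<exists>e>0. \<forall>s\<in>{t..1}. dist s t < e \<longrightarrow> \<gamma> s \<in> fst c \<and> snd c (\<gamma> s) \<in> U"
  proof (cases "t < 1")
    case True
    then obtain d D where d: "d > 0" "t + d \<le> 1" "C1_piece c \<gamma> t (t + d) D"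
      using C1_piece_right[OF assms(1) _ _ assms(3,4)] assms(2) by auto
    with near[OF d(3)] obtain e where "e > 0"
      "\<forall>s\<in>{t..t+d}. dist s t < e \<longrightarrow> \<gamma> s \<in> fst c \<and> snd c (\<gamma> s) \<in> U" by auto
    then show ?thesis using d by (intro exI[of _ "min e d"]) (auto simp: dist_real_def)
  next
    case False
    then show ?thesis using assms by (intro exI[of _ 1]) auto
  qed
  then obtain e1 where e1: "e1 > 0" "\<forall>s\<in>{t..1}. dist s t < e1 \<longrightarrow> \<gamma> s \<in> fst c \<and> snd c (\<gamma> s) \<in> U" by blast
  have "\<exists>e>0. \<forall>s\<in>{0..t}. dist s t < e \<longrightarrow> \<gamma> s \<in> fst c \<and> snd c (\<gamma> s) \<in> U"
  proof (cases "t > 0")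
    case True
    then obtain d D where d: "d > 0" "0 \<le> t - d" "C1_piece c \<gamma> (t - d) t D"
      using C1_piece_left[OF assms(1) _ _ assms(3,4)] assms(2) by auto
    with near[OF d(3)] obtain e where "e > 0"
      "\<forall>s\<in>{t-d..t}. dist s t < e \<longrightarrow> \<gamma> s \<in> fst c \<and> snd c (\<gamma> s) \<in> U" by auto
    then show ?thesis using d by (intro exI[of _ "min e d"]) (auto simp: dist_real_def)
  next
    case False
    then show ?thesis using assms by (intro exI[of _ 1]) auto
  qed
  then obtain e2 where "e2 > 0" "\<forall>s\<in>{0..t}. dist s t < e2 \<longrightarrow> \<gamma> s \<in> fst c \<and> snd c (\<gamma> s) \<in> U" by blast
  with e1 show ?thesis by (intro exI[of _ "min e1 e2"]) (auto simp: linorder_class.linear)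
qed

lemma curve_continuous_on:
  assumes "piecewise_C1_curve A \<gamma>" "c \<in> A" "{u..v} \<subseteq> {0..1}" "\<gamma> ` {u..v} \<subseteq> fst c"
  shows "continuous_on {u..v} (snd c \<circ> \<gamma>)"
  unfolding continuous_on_iff
proof (intro ballI allI impI)
  fix t and e :: real assume te: "t \<in> {u..v}" "0 < e"
  then have "\<gamma> t \<in> fst c" using assms(4) by blast
  with te obtain d where "d > 0" "\<forall>s\<in>{0..1}. dist s t < d \<longrightarrow> \<gamma> s \<in> fst c \<and> snd c (\<gamma> s) \<in> ball (snd c (\<gamma> t)) e"
    using curve_continuous[OF assms(1) _ assms(2), of t "ball (snd c (\<gamma> t)) e"] assms(3,4) by auto
  then show "\<exists>d>0. \<forall>x'\<in>{u..v}. dist x' t < d \<longrightarrow> dist ((snd c \<circ> \<gamma>) x') ((snd c \<circ> \<gamma>) t) < e"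
    using assms(3) by (intro exI[of _ d]) (auto simp: dist_commute)
qed

text \<open>At a break point \<open>vector_derivative\<close> may be an arbitrary value. P collects
  finitely many such times; away from them the velocity is a genuine two-sided derivative in every
  chart and obeys the transformation law of tangent vectors.\<close>

definition regular_off :: "(real \<Rightarrow> 'm) \<Rightarrow> real set \<Rightarrow> bool" where
  "regular_off \<gamma> P \<longleftrightarrow> finite P \<and> (\<forall>t\<in>{0<..<1} - P. velocity A \<gamma> t \<in> tangent_space A (\<gamma> t) \<and>
    (\<forall>c\<in>A. \<gamma> t \<in> fst c \<longrightarrow> ((snd c \<circ> \<gamma>) has_vector_derivative velocity A \<gamma> t c) (at t)))"

lemma regular_offD:
  assumes "regular_off \<gamma> P"
  shows "finite P" "t \<in> {0<..<1} - P \<Longrightarrow> velocity A \<gamma> t \<in> tangent_space A (\<gamma> t)"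
    "t \<in> {0<..<1} - P \<Longrightarrow> c \<in> A \<Longrightarrow> \<gamma> t \<in> fst c \<Longrightarrow>
      ((snd c \<circ> \<gamma>) has_vector_derivative velocity A \<gamma> t c) (at t)"
  using assms unfolding regular_off_def by auto

lemma regular_off_superset: "regular_off \<gamma> P \<Longrightarrow> P \<subseteq> Q \<Longrightarrow> finite Q \<Longrightarrow> regular_off \<gamma> Q"
  unfolding regular_off_def by blast

lemma curve_regular:
  assumes "piecewise_C1_curve A \<gamma>" shows "\<exists>P. regular_off \<gamma> P"
proof -
  obtain P where P: "finite P"
    "\<And>a b. 0 \<le> a \<and> a < b \<and> b \<le> 1 \<and> {a<..<b} \<inter> P = {} \<Longrightarrow> C1_curve_on A \<gamma> a b"
    using assms(1) unfolding piecewise_C1_curve_def by blast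
  have "velocity A \<gamma> t \<in> tangent_space A (\<gamma> t) \<and>
    (\<forall>c\<in>A. \<gamma> t \<in> fst c \<longrightarrow> ((snd c \<circ> \<gamma>) has_vector_derivative velocity A \<gamma> t c) (at t))"
    if t: "t \<in> {0<..<1} - P" for t
  proof -
    obtain d1 where d1: "0 < d1" "t + d1 \<le> 1" "{t<..<t+d1} \<inter> P = {}"
      using finite_avoid_right[OF P(1), of t 1] t by auto
    obtain d2 where d2: "0 < d2" "0 \<le> t - d2" "{t-d2<..<t} \<inter> P = {}"
      using finite_avoid_left[OF P(1), of 0 t] t by auto
    \<comment> \<open>As t is not in P, the gaps on its two sides join to one interval without break
      points that has t in its interior.\<close>
    have "{t-d2<..<t+d1} = {t-d2<..<t} \<union> {t} \<union> {t<..<t+d1}" using d1 d2 by auto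
    then have C1: "C1_curve_on A \<gamma> (t - d2) (t + d1)"
      using d1 d2 t by (intro P(2)) auto
    have deriv: "\<exists>\<epsilon>>0. (\<forall>s\<in>ball t \<epsilon>. \<gamma> s \<in> fst c) \<and>
        ((snd c \<circ> \<gamma>) has_vector_derivative velocity A \<gamma> t c) (at t)" if c: "c \<in> A" "\<gamma> t \<in> fst c" for c
    proof -
      obtain \<epsilon> D where \<epsilon>: "\<epsilon> > 0" "\<gamma> ` ({t-d2..t+d1} \<inter> ball t \<epsilon>) \<subseteq> fst c"
        "((snd c \<circ> \<gamma>) has_vector_derivative D t) (at t within {t-d2..t+d1} \<inter> ball t \<epsilon>)"
      proof -
        obtain \<epsilon> D where "\<epsilon> > 0" "\<gamma> ` ({t-d2..t+d1} \<inter> ball t \<epsilon>) \<subseteq> fst c"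
          "\<forall>s\<in>{t-d2..t+d1} \<inter> ball t \<epsilon>.
            ((snd c \<circ> \<gamma>) has_vector_derivative D s) (at s within {t-d2..t+d1} \<inter> ball t \<epsilon>)"
          using C1_curve_on_chart[OF C1 _ c] d1(1) d2(1) by auto
        moreover have "t \<in> {t-d2..t+d1} \<inter> ball t \<epsilon>"
          using d1(1) d2(1) \<open>\<epsilon> > 0\<close> by auto
        ultimately show ?thesis using that by blast
      qed
      have "((snd c \<circ> \<gamma>) has_vector_derivative D t) (at t)"
        by (rule has_vector_derivative_interior[OF \<epsilon>(3)]) (use d1 d2 \<epsilon>(1) in auto)
      moreover have "velocity A \<gamma> t c = D t"
        using c vector_derivative_at[OF calculation] by (simp add: velocity_def)
      ultimately show ?thesis using d1 d2 \<epsilon>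
        by (intro exI[of _ "min \<epsilon> (min d1 d2)"]) (auto simp: dist_real_def image_subset_iff abs_if split: if_splits)
    qed
    have "velocity A \<gamma> t \<in> tangent_space A (\<gamma> t)"
      unfolding tangent_space_def
    proof (intro CollectI conjI ballI impI allI)
      fix c d assume cd: "c \<in> A" "d \<in> A" "\<gamma> t \<in> fst c \<and> \<gamma> t \<in> fst d"
      let ?\<phi> = "snd d \<circ> chart_inv c"
      obtain \<epsilon> where \<epsilon>: "\<epsilon> > 0" "\<forall>s\<in>ball t \<epsilon>. \<gamma> s \<in> fst c"
        "((snd c \<circ> \<gamma>) has_vector_derivative velocity A \<gamma> t c) (at t)"
        using deriv[of c] cd by blast
      have "(?\<phi> has_derivative frechet_derivative ?\<phi> (at (snd c (\<gamma> t)))) (at ((snd c \<circ> \<gamma>) t))"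
        using transition_has_derivative[of c d "\<gamma> t"] cd by simp
      then have "((?\<phi> \<circ> (snd c \<circ> \<gamma>)) has_vector_derivative
          frechet_derivative ?\<phi> (at (snd c (\<gamma> t))) (velocity A \<gamma> t c)) (at t)"
        using has_derivative_at_withinI by (intro vector_derivative_diff_chain_within \<epsilon>(3))
      then have "((snd d \<circ> \<gamma>) has_vector_derivative
          frechet_derivative ?\<phi> (at (snd c (\<gamma> t))) (velocity A \<gamma> t c)) (at t)"
        by (rule has_vector_derivative_transform_within_open[of _ _ _ "ball t \<epsilon>"])
          (use \<epsilon> cd in auto)
      moreover have "((snd d \<circ> \<gamma>) has_vector_derivative velocity A \<gamma> t d) (at t)"
        using deriv[of d] cd by blast
      ultimately show "velocity A \<gamma> t d = frechet_derivative ?\<phi> (at (snd c (\<gamma> t))) (velocity A \<gamma> t c)"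
        using vector_derivative_unique_at by blast
    qed (auto simp: velocity_def)
    then show ?thesis using deriv by blast
  qed
  then show ?thesis using P(1) unfolding regular_off_def by blast
qed

end

text \<open>What lengths of curves require of a metric, expressed through its quadratic form. Both h
  on M and Dombrowski's metric on TM are instances, the latter by way of its coordinate
  formula.\<close>

locale metric_atlas = smooth_atlas A for A :: "('m, 'e::euclidean_space) chart set" +
  fixes h :: "'m \<Rightarrow> ('m, 'e) tvec \<Rightarrow> ('m, 'e) tvec \<Rightarrow> real"
  assumes h_nonneg: "p \<in> mpoints A \<Longrightarrow> v \<in> tangent_space A p \<Longrightarrow> 0 \<le> h p v v"
    and h_zero: "p \<in> mpoints A \<Longrightarrow> h p (\<lambda>c. 0) (\<lambda>c. 0) = 0"
    and h_continuous: "c \<in> A \<Longrightarrow> continuous_on ((snd c ` fst c) \<times> UNIV)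
      (\<lambda>y. h (chart_inv c (fst y)) (tvec_at A c (chart_inv c (fst y)) (snd y))
        (tvec_at A c (chart_inv c (fst y)) (snd y)))"
begin

section \<open>Speed, length and distance\<close>

definition speed :: "(real \<Rightarrow> 'm) \<Rightarrow> real \<Rightarrow> real" where
  "speed \<gamma> t = sqrt (h (\<gamma> t) (velocity A \<gamma> t) (velocity A \<gamma> t))"

text \<open>Except at break points and at the ends of the piece, the speed is a continuous function
  of the position and the derivative in the chart; finitely many values do not affect
  integrability.\<close>

lemma speed_integrable_piece:
  assumes "piecewise_C1_curve A \<gamma>" "c \<in> A" "C1_piece c \<gamma> l r D" "0 \<le> l" "r \<le> 1" "{u..v} \<subseteq> {l..r}"
  shows "speed \<gamma> integrable_on {u..v}"
proof -
  obtain P where "regular_off \<gamma> P" using curve_regular[OF assms(1)] by blast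
  note P = regular_offD[OF this]
  note D = assms(3)[unfolded C1_piece_def]
  let ?H = "\<lambda>y. h (chart_inv c (fst y)) (tvec_at A c (chart_inv c (fst y)) (snd y))
        (tvec_at A c (chart_inv c (fst y)) (snd y))"
  let ?g = "\<lambda>s. sqrt (?H (snd c (\<gamma> s), D s))"
  have "continuous_on {l..r} (\<lambda>s. (snd c (\<gamma> s), D s))"
    using C1_piece_continuous[OF assms(3)] D by (auto intro!: continuous_on_Pair simp: o_def)
  then have "continuous_on {l..r} (\<lambda>s. ?H (snd c (\<gamma> s), D s))"
    by (rule continuous_on_compose2[OF h_continuous[OF assms(2)]]) (use D in auto)
  then have "continuous_on {u..v} ?g"
    by (rule continuous_on_real_sqrt[OF continuous_on_subset[OF _ assms(6)]])
  then have "?g integrable_on {u..v}" by (rule integrable_continuous_real)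
  then show ?thesis
  proof (rule integrable_spike_finite[rotated 2])
    show "finite (P \<union> {l, r})" using P by simp
    fix s assume s: "s \<in> {u..v} - (P \<union> {l, r})"
    then have s': "s \<in> {0<..<1} - P" "s \<in> {l<..<r}" using assms by (auto simp: subset_iff less_le)
    have mem: "\<gamma> s \<in> fst c" using D s' by auto
    have "((snd c \<circ> \<gamma>) has_vector_derivative D s) (at s)"
      by (rule has_vector_derivative_interior[of _ _ _ "{l..r}"]) (use D s' in auto)
    then have "velocity A \<gamma> s c = D s"
      using P(3)[OF s'(1) assms(2) mem] vector_derivative_unique_at by blast
    then have "velocity A \<gamma> s = tvec_at A c (\<gamma> s) (D s)"
      using tangent_eq_tvec_at[OF P(2)[OF s'(1)] assms(2) mem] by simp
    then show "speed \<gamma> s = ?g s"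
      using mem assms(2) by (simp add: speed_def)
  qed
qed

text \<open>The integral of a non-integrable function is 0 by convention, so lengths mean something
  only after this. Integrability is local; around each time the left and the right half lie in
  separate pieces.\<close>

lemma speed_integrable:
  assumes "piecewise_C1_curve A \<gamma>" shows "speed \<gamma> integrable_on {0..1}"
proof -
  have "\<exists>d>0. \<forall>u v. t \<in> {u..v} \<and> {u..v} \<subseteq> ball t d \<and> {u..v} \<subseteq> {0..1} \<longrightarrow> speed \<gamma> integrable_on {u..v}"
    if t: "t \<in> {0..1}" for t
  proof -
    obtain c where c: "c \<in> A" "\<gamma> t \<in> fst c"
      using curve_mpoints[OF assms t] by (auto simp: mpoints_def)
    have "\<exists>d>0. \<forall>v. t \<le> v \<and> v < t + d \<and> v \<le> 1 \<longrightarrow> speed \<gamma> integrable_on {t..v}"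
    proof (cases "t < 1")
      case True
      then obtain d D where d: "d > 0" "t + d \<le> 1" "C1_piece c \<gamma> t (t + d) D"
        using C1_piece_right[OF assms _ _ c] t by auto
      show ?thesis
        by (intro exI[of _ d] conjI d allI impI speed_integrable_piece[OF assms c(1) d(3)])
          (use t d in auto)
    next
      case False
      then have "speed \<gamma> integrable_on {t..v}" if "v \<le> 1" for v
        using t that integrable_on_refl[of "speed \<gamma>" t] by (cases "v = t") auto
      then show ?thesis by (intro exI[of _ 1]) auto
    qed
    then obtain d1 where d1: "d1 > 0" "\<And>v. t \<le> v \<and> v < t + d1 \<and> v \<le> 1 \<Longrightarrow> speed \<gamma> integrable_on {t..v}" by blast
    have "\<exists>d>0. \<forall>u. u \<le> t \<and> t - d < u \<and> 0 \<le> u \<longrightarrow> speed \<gamma> integrable_on {u..t}"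
    proof (cases "t > 0")
      case True
      then obtain d D where d: "d > 0" "0 \<le> t - d" "C1_piece c \<gamma> (t - d) t D"
        using C1_piece_left[OF assms _ _ c] t by auto
      show ?thesis
        by (intro exI[of _ d] conjI d allI impI speed_integrable_piece[OF assms c(1) d(3)])
          (use t d in auto)
    next
      case False
      then have "speed \<gamma> integrable_on {u..t}" if "0 \<le> u" for u
        using t that integrable_on_refl[of "speed \<gamma>" t] by (cases "u = t") auto
      then show ?thesis by (intro exI[of _ 1]) auto
    qed
    then obtain d2 where d2: "d2 > 0" "\<And>u. u \<le> t \<and> t - d2 < u \<and> 0 \<le> u \<Longrightarrow> speed \<gamma> integrable_on {u..t}" by blast
    show ?thesis
    proof (intro exI[of _ "min d1 d2"] conjI allI impI)
      fix u v assume uv: "t \<in> {u..v} \<and> {u..v} \<subseteq> ball t (min d1 d2) \<and> {u..v} \<subseteq> {0..1}"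
      then have "u \<in> ball t (min d1 d2)" "v \<in> ball t (min d1 d2)" "0 \<le> u" "v \<le> 1"
        by (auto simp: subset_iff)
      then show "speed \<gamma> integrable_on {u..v}"
        using uv d1(2)[of v] d2(2)[of u]
        by (intro Henstock_Kurzweil_Integration.integrable_combine[of u t v]) (auto simp: dist_real_def abs_if split: if_splits)
    qed (use d1 d2 in auto)
  qed
  then show ?thesis
    using integrable_on_little_subintervals[of 0 1 "speed \<gamma>"] by simp
qed

text \<open>The integrand of the length, with the undetermined values at the break points set to 0.\<close>

definition speed_off :: "(real \<Rightarrow> 'm) \<Rightarrow> real set \<Rightarrow> real \<Rightarrow> real" where
  "speed_off \<gamma> P t = (if t \<in> {0<..<1} - P then speed \<gamma> t else 0)"

lemma speed_off:
  assumes "piecewise_C1_curve A \<gamma>" "regular_off \<gamma> P"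
  shows "0 \<le> speed_off \<gamma> P t" "speed_off \<gamma> P integrable_on {0..1}"
    "integral {0..1} (speed_off \<gamma> P) = curve_length A h \<gamma>"
proof -
  note P = regular_offD[OF assms(2)]
  have fin: "finite (P \<union> {0, 1})" using P(1) by simp
  have eq: "speed_off \<gamma> P t = speed \<gamma> t" if "t \<in> {0..1} - (P \<union> {0, 1})" for t
    using that by (auto simp: speed_off_def)
  show "speed_off \<gamma> P integrable_on {0..1}"
    by (rule integrable_spike_finite[OF fin eq speed_integrable[OF assms(1)]])
  have "integral {0..1} (speed_off \<gamma> P) = integral {0..1} (speed \<gamma>)"
    by (rule integral_spike[OF negligible_finite[OF fin]]) (use eq in auto)
  then show "integral {0..1} (speed_off \<gamma> P) = curve_length A h \<gamma>"
    by (simp add: curve_length_def speed_def[abs_def])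
  show "0 \<le> speed_off \<gamma> P t"
    using P(2) curve_mpoints[OF assms(1), of t] by (auto simp: speed_off_def speed_def h_nonneg)
qed

text \<open>Converts convergence of coordinates into convergence for the distance. The connecting
  curve is a straight segment in the chart with constant derivative y - x; near (y, 0) its speed is
  small because the quadratic form is continuous and vanishes there.\<close>

lemma dist_tendsto_0:
  assumes "c \<in> A" "y \<in> snd c ` fst c" "\<epsilon> > 0"
  shows "\<exists>\<delta>>0. \<forall>x. dist x y < \<delta> \<longrightarrow>
    riemannian_dist A h (chart_inv c x) (chart_inv c y) < ereal \<epsilon>"
proof -
  let ?H = "\<lambda>y. h (chart_inv c (fst y)) (tvec_at A c (chart_inv c (fst y)) (snd y))
        (tvec_at A c (chart_inv c (fst y)) (snd y))"
  let ?S = "(snd c ` fst c) \<times> (UNIV :: 'e set)"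
  have "open ?S" using open_chart_image[OF assms(1)] by (auto intro: open_Times)
  moreover have yS: "(y, 0) \<in> ?S" using assms by auto
  ultimately obtain \<delta>0 where \<delta>0: "\<delta>0 > 0" "ball (y, 0) \<delta>0 \<subseteq> ?S" using open_contains_ball by blast
  have "chart_inv c y \<in> fst c" using assms(2) by (rule chart_inv_mem)
  then have H0: "?H (y, 0) = 0"
    using assms by (simp add: tvec_at_0 h_zero chart_mpoints)
  obtain \<delta>1 where \<delta>1: "\<delta>1 > 0"
    "\<And>z. z \<in> ?S \<Longrightarrow> dist z (y, 0) < \<delta>1 \<Longrightarrow> dist (?H z) (?H (y, 0)) < (\<epsilon> / 2)\<^sup>2"
    using h_continuous[OF assms(1)] yS assms(3) unfolding continuous_on_iff
    by (metis half_gt_zero zero_less_power)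
  have small: "?H z < (\<epsilon> / 2)\<^sup>2" if "z \<in> ?S" "dist z (y, 0) < \<delta>1" for z
  proof -
    have "\<bar>?H z\<bar> < (\<epsilon> / 2)\<^sup>2" using \<delta>1(2)[OF that] H0 by simp
    then show ?thesis by linarith
  qed
  \<comment> \<open>Position and derivative of the segment both differ from (y, 0) by at most |x -
    y|, hence the half. The radius \<delta>0 keeps the segment in the chart, \<delta>1 bounds its
    speed by \<epsilon> / 2.\<close>
  define \<delta> where "\<delta> = min \<delta>0 \<delta>1 / 2"
  have "riemannian_dist A h (chart_inv c x) (chart_inv c y) < ereal \<epsilon>" if x: "dist x y < \<delta>" for x
  proof -
    define \<xi> where "\<xi> t = x + t *\<^sub>R (y - x)" for t :: real
    define \<gamma> where "\<gamma> = chart_inv c \<circ> \<xi>"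
    have \<xi>: "dist (\<xi> t, y - x) (y, 0) < min \<delta>0 \<delta>1" if "t \<in> {0..1}" for t
    proof -
      have "\<xi> t - y = (1 - t) *\<^sub>R (x - y)" by (simp add: \<xi>_def algebra_simps)
      then have "norm (\<xi> t - y) \<le> norm (x - y)"
        using that by (simp add: mult_left_le_one_le)
      moreover have "dist (\<xi> t, y - x) (y, 0) \<le> norm (\<xi> t - y) + norm (y - x)"
        using norm_Pair_le[of "\<xi> t - y" "y - x"] by (simp add: dist_norm)
      ultimately show ?thesis using x by (simp add: \<delta>_def dist_norm norm_minus_commute)
    qed
    have S: "(\<xi> t, y - x) \<in> ?S" if "t \<in> {0..1}" for t
    proof -
      have "(\<xi> t, y - x) \<in> ball (y, 0) \<delta>0" using \<xi>[OF that] by (simp add: dist_commute)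
      then show ?thesis using \<delta>0(2) by blast
    qed
    have \<gamma>: "\<gamma> t \<in> fst c" "snd c (\<gamma> t) = \<xi> t" if "t \<in> {0..1}" for t
      using S[OF that] by (auto simp: \<gamma>_def chart_inv_mem chart_chart_inv)
    have d\<xi>: "(\<xi> has_vector_derivative (y - x)) (at t within I)" for t I
      unfolding \<xi>_def by (auto intro!: derivative_eq_intros)
    have "C1_curve_on A \<gamma> a b" if "0 \<le> a" "a < b" "b \<le> 1" for a b
      unfolding C1_curve_on_def Let_def
    proof (intro ballI bexI[of _ c] exI[of _ 1] conjI assms(1) exI[of _ "\<lambda>s. y - x"])
      fix t s assume "s \<in> {a..b} \<inter> ball t 1"
      then show "((snd c \<circ> \<gamma>) has_vector_derivative (y - x)) (at s within {a..b} \<inter> ball t 1)"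
        by (intro has_vector_derivative_transform[OF _ _ d\<xi>]) (use that \<gamma>(2) in auto)
    qed (use \<gamma> that in auto)
    then have curve: "piecewise_C1_curve A \<gamma>"
      unfolding piecewise_C1_curve_def by (intro exI[of _ "{}"]) auto
    obtain P where reg: "regular_off \<gamma> P" using curve_regular[OF curve] by blast
    note P = regular_offD[OF reg] and f = speed_off[OF curve reg]
    let ?f = "speed_off \<gamma> P"
    have le: "?f t \<le> \<epsilon> / 2" for t
    proof (cases "t \<in> {0<..<1} - P")
      case True
      then have t: "t \<in> {0..1}" by auto
      have "(\<xi> has_vector_derivative velocity A \<gamma> t c) (at t)"
        by (rule has_vector_derivative_transform_within_open[OF P(3)[OF True assms(1)], of "{0<..<1}"])
          (use \<gamma> t True in auto)
      then have "velocity A \<gamma> t c = y - x" using d\<xi> vector_derivative_unique_at by blast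
      then have "velocity A \<gamma> t = tvec_at A c (\<gamma> t) (y - x)"
        using tangent_eq_tvec_at[OF P(2)[OF True] assms(1) \<gamma>(1)[OF t]] by simp
      then have "?f t = sqrt (?H (\<xi> t, y - x))"
        using True \<gamma>[OF t] by (simp add: speed_off_def speed_def \<gamma>_def)
      also have "\<dots> \<le> sqrt ((\<epsilon> / 2)\<^sup>2)"
        using small[OF S[OF t]] \<xi>[OF t] by (intro real_sqrt_le_mono) auto
      finally show ?thesis using assms(3) by simp
    qed (use assms(3) in \<open>auto simp: speed_off_def\<close>)
    have "integral {0..1} ?f \<le> integral {0..1::real} (\<lambda>t. \<epsilon> / 2)"
      by (rule integral_le[OF f(2)]) (use le in auto)
    then have "curve_length A h \<gamma> < \<epsilon>" using f(3) assms(3) by simp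
    moreover have "riemannian_dist A h (chart_inv c x) (chart_inv c y) \<le> ereal (curve_length A h \<gamma>)"
      unfolding riemannian_dist_def
      by (rule INF_lower) (use curve in \<open>auto simp: \<gamma>_def \<xi>_def\<close>)
    ultimately show ?thesis by (meson ereal_less_eq(3) le_less_trans less_ereal.simps(1))
  qed
  then show ?thesis using \<delta>0(1) \<delta>1(1) by (intro exI[of _ \<delta>]) (auto simp: \<delta>_def)
qed

end

lemma riemannian_dist_lessD:
  assumes "riemannian_dist A h p q < ereal \<epsilon>"
  shows "\<exists>\<gamma>. piecewise_C1_curve A \<gamma> \<and> \<gamma> 0 = p \<and> \<gamma> 1 = q \<and> curve_length A h \<gamma> < \<epsilon>"
  using assms unfolding riemannian_dist_def by (auto simp: INF_less_iff)

lemma riemannian_dist_lessI: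
  assumes "piecewise_C1_curve A \<gamma>" "\<gamma> 0 = p" "\<gamma> 1 = q" "curve_length A h \<gamma> < \<epsilon>"
  shows "riemannian_dist A h p q < ereal \<epsilon>"
  using assms unfolding riemannian_dist_def by (auto simp: INF_less_iff)

section \<open>Extending local data by zero\<close>

text \<open>The last assumption is the only trace of the Hausdorff topology of the manifold: compact subsets
  of chart domains are closed.\<close>

locale manifold = smooth_atlas A for A :: "('m, 'e::euclidean_space) chart set" +
  assumes open_minus_compact: "c \<in> A \<Longrightarrow> d \<in> A \<Longrightarrow> compact C \<Longrightarrow> C \<subseteq> snd c ` fst c \<Longrightarrow>
    open (snd d ` (fst d - chart_inv c ` C))"

lemma smooth_manifold_imp_manifold:
  assumes "smooth_manifold T A" shows "manifold A"
proof -
  have H: "Hausdorff_space T"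
    and op: "\<And>c. c \<in> A \<Longrightarrow> openin T (fst c)" "\<And>c. c \<in> A \<Longrightarrow> open (snd c ` fst c)"
    and hom: "\<And>c. c \<in> A \<Longrightarrow> homeomorphic_map (subtopology T (fst c)) (top_of_set (snd c ` fst c)) (snd c)"
    and sm: "\<And>c d. c \<in> A \<Longrightarrow> d \<in> A \<Longrightarrow> smooth_on (snd c ` (fst c \<inter> fst d)) (snd d \<circ> chart_inv c)"
    using assms unfolding smooth_manifold_def by auto
  have top: "topspace (subtopology T (fst c)) = fst c" if "c \<in> A" for c
    using openin_subset[OF op(1)[OF that]] by auto
  have img: "open (snd c ` U)" if "c \<in> A" "openin T U" "U \<subseteq> fst c" for c U
  proof -
    have "openin (subtopology T (fst c)) U" using that unfolding openin_subtopology by blast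
    then have "openin (top_of_set (snd c ` fst c)) (snd c ` U)"
      using homeomorphic_imp_open_map[OF hom[OF that(1)]] unfolding open_map_def by blast
    then show ?thesis using op(2)[OF that(1)] openin_open_eq by blast
  qed
  show ?thesis
  proof
    fix c d assume cd: "c \<in> A" "d \<in> A"
    show "inj_on (snd c) (fst c)"
      using homeomorphic_imp_injective_map[OF hom[OF cd(1)]] top[OF cd(1)] by simp
    show "open (snd c ` (fst c \<inter> fst d))"
      by (intro img cd openin_Int op) auto
    show "smooth_on (snd c ` (fst c \<inter> fst d)) (snd d \<circ> chart_inv c)" by (rule sm[OF cd])
    fix C assume C: "compact C" "C \<subseteq> snd c ` fst c"
    have sub: "chart_inv c ` C \<subseteq> fst c" using C(2) by (auto intro: chart_inv_mem)
    have "snd c ` chart_inv c ` C = C"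
      using C(2) by (rule image_inv_into_cancel[OF refl])
    \<comment> \<open>The chart is a homeomorphism, so the preimage of C is compact, hence closed in
      a Hausdorff space, and its complement in the domain of d is open.\<close>
    then have "compactin (subtopology T (fst c)) (chart_inv c ` C)"
      using homeomorphic_map_compactness_eq[OF hom[OF cd(1)], of "chart_inv c ` C"] sub top[OF cd(1)] C
      by (metis compactin_euclidean_iff compactin_subtopology)
    then have "closedin T (chart_inv c ` C)"
      using compactin_imp_closedin[OF H] by (simp add: compactin_subtopology)
    then have "openin T (fst d - chart_inv c ` C)" using op(1)[OF cd(2)] by blast
    then show "open (snd d ` (fst d - chart_inv c ` C))" by (intro img cd) auto
  qed
qed

context manifold
begin

text \<open>At a point outside the domain of c, the complement of the compact support supplies a
  neighbourhood on which F is zero. This is where \<open>open_minus_compact\<close> is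
  needed.\<close>

lemma smooth_on_extend:
  fixes F :: "'m \<Rightarrow> 'b::real_normed_vector"
  assumes "c \<in> A" "d \<in> A" "compact C" "C \<subseteq> snd c ` fst c"
    and zero: "\<And>p. p \<notin> chart_inv c ` C \<Longrightarrow> F p = 0"
    and smooth: "smooth_on (snd d ` (fst d \<inter> fst c)) (\<lambda>x. F (chart_inv d x))"
  shows "smooth_on (snd d ` fst d) (\<lambda>x. F (chart_inv d x))"
proof (rule smooth_on_local)
  fix x assume "x \<in> snd d ` fst d"
  then obtain p where p: "p \<in> fst d" "x = snd d p" by blast
  show "\<exists>U. open U \<and> x \<in> U \<and> smooth_on U (\<lambda>x. F (chart_inv d x))"
  proof (cases "p \<in> fst c")
    case True
    then show ?thesis
      using p smooth open_overlap[OF assms(2,1)] by (intro exI[of _ "snd d ` (fst d \<inter> fst c)"]) auto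
  next
    case False
    let ?U = "snd d ` (fst d - chart_inv c ` C)"
    have "chart_inv c ` C \<subseteq> fst c" using assms(4) by (auto intro: chart_inv_mem)
    then have xU: "x \<in> ?U" using False p by auto
    have U: "open ?U" by (rule open_minus_compact[OF assms(1-4)])
    have "smooth_on ?U (\<lambda>x. F (chart_inv d x))"
      by (rule smooth_on_transform[OF smooth_on_const U]) (use assms(2) zero in auto)
    then show ?thesis using xU U by blast
  qed
qed

definition extend_fun :: "('m, 'e) chart \<Rightarrow> ('e \<Rightarrow> real) \<Rightarrow> 'm \<Rightarrow> real" where
  "extend_fun c f p = (if p \<in> fst c then f (snd c p) else 0)"

definition extend_field :: "('m, 'e) chart \<Rightarrow> ('e \<Rightarrow> 'e) \<Rightarrow> 'm \<Rightarrow> ('m, 'e) tvec" where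
  "extend_field c g p = (if p \<in> fst c then tvec_at A c p (g (snd c p)) else (\<lambda>d. 0))"

lemma smooth_overlap_compose:
  assumes "c \<in> A" "d \<in> A" "smooth_on UNIV (g :: 'e \<Rightarrow> 'b::real_normed_vector)"
  shows "smooth_on (snd d ` (fst d \<inter> fst c)) (\<lambda>x. g (snd c (chart_inv d x)))"
  using smooth_on_compose[OF assms(3) smooth_transition[OF assms(2,1)] open_overlap[OF assms(2,1)]]
  by (simp add: o_def)

lemma smooth_fun_extend:
  assumes "c \<in> A" "compact C" "C \<subseteq> snd c ` fst c" "smooth_on UNIV f" "\<And>x. x \<notin> C \<Longrightarrow> f x = 0"
  shows "smooth_fun A (extend_fun c f)"
  unfolding smooth_fun_def o_def
proof
  fix d assume d: "d \<in> A"
  show "smooth_on (snd d ` fst d) (\<lambda>x. extend_fun c f (chart_inv d x))"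
  proof (rule smooth_on_extend[OF assms(1) d assms(2,3)])
    fix p assume "p \<notin> chart_inv c ` C"
    then have "p \<in> fst c \<Longrightarrow> snd c p \<notin> C" using chart_inv_chart[OF assms(1)] by (metis imageI)
    then show "extend_fun c f p = 0" using assms(5) by (auto simp: extend_fun_def)
  next
    show "smooth_on (snd d ` (fst d \<inter> fst c)) (\<lambda>x. extend_fun c f (chart_inv d x))"
      by (rule smooth_on_transform[OF smooth_overlap_compose[OF assms(1) d assms(4)] open_overlap[OF d assms(1)]])
        (use d in \<open>auto simp: extend_fun_def\<close>)
  qed
qed

lemma vector_field_extend:
  assumes "c \<in> A" "compact C" "C \<subseteq> snd c ` fst c" "smooth_on UNIV g" "\<And>x. x \<notin> C \<Longrightarrow> g x = 0"
  shows "vector_field A (extend_field c g)"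
  unfolding vector_field_def
proof (intro conjI ballI allI impI)
  show "extend_field c g p \<in> tangent_space A p" for p
    using assms(1) tvec_at_mem zero_tangent by (simp add: extend_field_def)
  show "extend_field c g p = (\<lambda>c. 0)" if "p \<notin> mpoints A" for p
    using that chart_mpoints[OF assms(1)] by (auto simp: extend_field_def)
  fix d assume d: "d \<in> A"
  show "smooth_on (snd d ` fst d) (\<lambda>x. extend_field c g (chart_inv d x) d)"
  proof (rule smooth_on_extend[OF assms(1) d assms(2,3)])
    fix p assume "p \<notin> chart_inv c ` C"
    then have "p \<in> fst c \<Longrightarrow> snd c p \<notin> C" using chart_inv_chart[OF assms(1)] by (metis imageI)
    then show "extend_field c g p d = 0"
      using assms(1,5) by (auto simp: extend_field_def tvec_at_0)
  next
    let ?S = "snd d ` (fst d \<inter> fst c)" let ?\<phi> = "snd d \<circ> chart_inv c"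
    note S = open_overlap[OF d assms(1)]
    have g: "smooth_on ?S (\<lambda>x. g (snd c (chart_inv d x)) \<bullet> i)" for i
      by (rule smooth_on_linear_comp[OF bounded_linear_inner_left smooth_overlap_compose[OF assms(1) d assms(4)] S])
    have "smooth_on ?S (\<lambda>x. frechet_derivative ?\<phi> (at ((snd c \<circ> chart_inv d) x)) i)" for i
      by (rule smooth_on_compose[OF smooth_on_deriv[OF smooth_transition[OF assms(1) d]] smooth_transition[OF d assms(1)] S])
        (use d in auto)
    then have "smooth_on ?S (\<lambda>x. \<Sum>i\<in>Basis. (g (snd c (chart_inv d x)) \<bullet> i) *\<^sub>R
        frechet_derivative ?\<phi> (at ((snd c \<circ> chart_inv d) x)) i)"
      by (intro smooth_on_sum S smooth_on_bilinear[OF bounded_bilinear_scaleR g])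
    then show "smooth_on ?S (\<lambda>x. extend_field c g (chart_inv d x) d)"
    proof (rule smooth_on_transform[OF _ S])
      fix x assume "x \<in> ?S"
      then obtain p where p: "p \<in> fst c" "p \<in> fst d" "x = snd d p" by auto
      show "(\<Sum>i\<in>Basis. (g (snd c (chart_inv d x)) \<bullet> i) *\<^sub>R
          frechet_derivative ?\<phi> (at ((snd c \<circ> chart_inv d) x)) i) = extend_field c g (chart_inv d x) d"
        using p d linear_euclidean_sum[OF linear_transition_derivative[OF assms(1) d p(1,2)], of "g (snd c p)"]
        by (simp add: extend_field_def tvec_at_def)
    qed
  qed
qed

text \<open>A global substitute for the field that is constantly w in the chart c: axioms quantified
  over global vector fields can be applied to it.\<close>

definition bump_field :: "('m, 'e) chart \<Rightarrow> 'e \<Rightarrow> real \<Rightarrow> 'e \<Rightarrow> 'm \<Rightarrow> ('m, 'e) tvec" where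
  "bump_field c a r w = extend_field c (\<lambda>x. bump a r x *\<^sub>R w)"

lemma smooth_on_bump_scaleR: "smooth_on UNIV (\<lambda>x. bump a r x *\<^sub>R w)"
  by (intro smooth_on_bilinear[OF bounded_bilinear_scaleR] smooth_on_bump smooth_on_const open_UNIV)

lemma bump_outside: "r > 0 \<Longrightarrow> x \<notin> cball a r \<Longrightarrow> bump a r x = 0"
  by (subst bump_eq_0_iff) auto

lemma vector_field_bump_field:
  assumes "c \<in> A" "r > 0" "cball a r \<subseteq> snd c ` fst c"
  shows "vector_field A (bump_field c a r w)"
  unfolding bump_field_def
  by (rule vector_field_extend[OF assms(1) compact_cball assms(3)])
    (use assms in \<open>auto intro: smooth_on_bump_scaleR simp: bump_outside\<close>)

lemma bump_field_chart:
  "c \<in> A \<Longrightarrow> p \<in> fst c \<Longrightarrow> bump_field c a r w p = tvec_at A c p (bump a r (snd c p) *\<^sub>R w)"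
  by (simp add: bump_field_def extend_field_def)

lemma bump_field_lincomb:
  assumes "c \<in> A"
  shows "bump_field c a r (s *\<^sub>R w + t *\<^sub>R w') =
    (\<lambda>p d. s *\<^sub>R bump_field c a r w p d + t *\<^sub>R bump_field c a r w' p d)"
proof (intro ext)
  fix p d
  show "bump_field c a r (s *\<^sub>R w + t *\<^sub>R w') p d =
      s *\<^sub>R bump_field c a r w p d + t *\<^sub>R bump_field c a r w' p d"
  proof (cases "p \<in> fst c")
    case True
    have "bump a r (snd c p) *\<^sub>R (s *\<^sub>R w + t *\<^sub>R w') =
        s *\<^sub>R (bump a r (snd c p) *\<^sub>R w) + t *\<^sub>R (bump a r (snd c p) *\<^sub>R w')"
      by (simp add: algebra_simps)
    then show ?thesis
      using True assms by (simp only: bump_field_chart tvec_at_lincomb)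
  qed (simp add: bump_field_def extend_field_def)
qed

text \<open>In coordinates the section Y is the graph x |-> (x, Y x), whose derivative in direction
  v is (v, DY v). These are the vectors on which the connector is prescribed.\<close>

lemma differential_section:
  assumes "c \<in> A" "p \<in> fst c" "v \<in> tangent_space A p" "vector_field A Y"
    and "((\<lambda>x. Y (chart_inv c x) c) has_derivative D) (at (snd c p))"
  shows "differential A (bundle_atlas A) (\<lambda>q. (q, Y q)) p v =
    tvec_at (bundle_atlas A) (bundle_chart A c) (p, Y p) (v c, D (v c))"
proof
  interpret TM: smooth_atlas "bundle_atlas A" by (rule smooth_atlas_bundle)
  let ?s = "\<lambda>q. (q, Y q)" let ?C = "bundle_chart A c"
  have C: "?C \<in> bundle_atlas A" using assms(1) by (simp add: bundle_atlas_def)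
  have sec: "?s q \<in> tangent_bundle A" if "q \<in> mpoints A" for q
    using assms(4) that by (simp add: tangent_bundle_iff vector_field_def)
  have pm: "p \<in> mpoints A" using chart_mpoints assms by blast
  have pC: "?s p \<in> fst ?C" using sec[OF pm] assms by (simp add: fst_bundle_chart)
  fix E
  show "differential A (bundle_atlas A) ?s p v E = tvec_at (bundle_atlas A) ?C (p, Y p) (v c, D (v c)) E"
  proof (cases "E \<in> bundle_atlas A \<and> ?s p \<in> fst E")
    case True
    then obtain d where d: "d \<in> A" "E = bundle_chart A d" "p \<in> fst d"
      by (auto simp: bundle_atlas_def fst_bundle_chart)
    let ?\<Phi> = "snd E \<circ> chart_inv ?C" let ?y = "\<lambda>x. (x, Y (chart_inv c x) c)"
    have y: "(?y has_derivative (\<lambda>v. (v, D v))) (at (snd c p))"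
      by (intro has_derivative_Pair has_derivative_ident assms(5))
    have "?y (snd c p) = snd ?C (?s p)" using assms by (simp add: snd_bundle_chart)
    then have "(?\<Phi> has_derivative frechet_derivative ?\<Phi> (at (snd ?C (?s p)))) (at (?y (snd c p)))"
      using TM.transition_has_derivative[OF C _ pC] True by simp
    from diff_chain_at[OF y this]
    have "((snd E \<circ> ?s \<circ> chart_inv c) has_derivative
        (frechet_derivative ?\<Phi> (at (snd ?C (?s p))) \<circ> (\<lambda>v. (v, D v)))) (at (snd c p))"
    proof (rule has_derivative_transform_within_open)
      show "open (snd c ` fst c)" using open_chart_image assms by blast
      fix x assume "x \<in> snd c ` fst c"
      then obtain q where q: "q \<in> fst c" "x = snd c q" by auto
      then have "?s q \<in> fst ?C" using sec chart_mpoints assms by (simp add: fst_bundle_chart)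
      then have "chart_inv ?C (snd ?C (?s q)) = ?s q" using C by simp
      then show "(?\<Phi> \<circ> ?y) x = (snd E \<circ> ?s \<circ> chart_inv c) x"
        using q assms by (simp add: snd_bundle_chart)
    qed (use assms in auto)
    from differential_chart[OF assms(1-3) _ _ this] True show ?thesis
      by (simp add: tvec_at_def)
  next
    case False
    then show ?thesis by (auto simp: differential_def tvec_at_def)
  qed
qed

end

section \<open>The Riemannian metric in coordinates\<close>

locale riemannian_manifold = manifold A for A :: "('m, 'e::euclidean_space) chart set" +
  fixes h :: "'m \<Rightarrow> ('m, 'e) tvec \<Rightarrow> ('m, 'e) tvec \<Rightarrow> real"
  assumes riemannian: "riemannian_metric A h"
begin

definition hloc :: "('m, 'e) chart \<Rightarrow> 'e \<Rightarrow> 'e \<Rightarrow> 'e \<Rightarrow> real" where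
  "hloc c x v w = h (chart_inv c x) (tvec_at A c (chart_inv c x) v) (tvec_at A c (chart_inv c x) w)"

lemma h_sym: "p \<in> mpoints A \<Longrightarrow> u \<in> tangent_space A p \<Longrightarrow> v \<in> tangent_space A p \<Longrightarrow> h p u v = h p v u"
  using riemannian unfolding riemannian_metric_def by blast

lemma h_pos: "p \<in> mpoints A \<Longrightarrow> u \<in> tangent_space A p \<Longrightarrow> u \<noteq> (\<lambda>c. 0) \<Longrightarrow> h p u u > 0"
  using riemannian unfolding riemannian_metric_def by blast

lemma h_lincomb:
  assumes "p \<in> mpoints A" "u \<in> tangent_space A p" "v \<in> tangent_space A p" "w \<in> tangent_space A p"
  shows "h p (\<lambda>c. a *\<^sub>R u c + b *\<^sub>R v c) w = a * h p u w + b * h p v w"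
  using riemannian assms unfolding riemannian_metric_def by blast

lemma hloc_linear:
  assumes "c \<in> A" "x \<in> snd c ` fst c"
  shows "linear (\<lambda>v. hloc c x v w)" "linear (\<lambda>w. hloc c x v w)"
proof -
  let ?p = "chart_inv c x"
  have p: "?p \<in> fst c" using assms(2) by (rule chart_inv_mem)
  then have pm: "?p \<in> mpoints A" using chart_mpoints assms by blast
  have lc: "hloc c x (a *\<^sub>R u + b *\<^sub>R v) w = a * hloc c x u w + b * hloc c x v w" for a b u v w
    unfolding hloc_def tvec_at_lincomb[OF assms(1) p]
    by (intro h_lincomb pm tvec_at_mem assms p)
  have sym: "hloc c x v w = hloc c x w v" for v w
    unfolding hloc_def by (intro h_sym pm tvec_at_mem assms p)
  show "linear (\<lambda>v. hloc c x v w)" for w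
    by (rule linearI) (use lc[of 1 _ 1 _ w] lc[of _ _ 0 0 w] in auto)
  then show "linear (\<lambda>w. hloc c x v w)" by (subst sym)
qed

lemma hloc_scaleR:
  assumes "c \<in> A" "x \<in> snd c ` fst c"
  shows "hloc c x (a *\<^sub>R v) (b *\<^sub>R w) = a * b * hloc c x v w"
  using linear_cmul[OF hloc_linear(1)[OF assms]] linear_cmul[OF hloc_linear(2)[OF assms]] by simp

text \<open>\<open>riemannian_metric\<close> provides smoothness of h along global fields only. Bump
  fields stand in for the constant fields v and w; on the ball the square of the bump is nonzero and
  can be divided out.\<close>

lemma hloc_continuous:
  assumes "c \<in> A" shows "continuous_on (snd c ` fst c) (\<lambda>x. hloc c x v w)"
proof (rule continuous_at_imp_continuous_on, intro ballI)
  fix a assume "a \<in> snd c ` fst c"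
  then obtain r where r: "r > 0" "cball a r \<subseteq> snd c ` fst c"
    using open_chart_image[OF assms] open_contains_cball by blast
  let ?E = "bump_field c a r"
  have "smooth_fun A (\<lambda>p. h p (?E v p) (?E w p))"
    using riemannian vector_field_bump_field[OF assms r] unfolding riemannian_metric_def by blast
  then have "smooth_on (snd c ` fst c) (\<lambda>x. h (chart_inv c x) (?E v (chart_inv c x)) (?E w (chart_inv c x)))"
    using assms unfolding smooth_fun_def o_def by blast
  then have "continuous_on (ball a r) (\<lambda>x. h (chart_inv c x) (?E v (chart_inv c x)) (?E w (chart_inv c x)))"
    using r ball_subset_cball by (blast intro: continuous_on_subset smooth_on_continuous)
  moreover have "continuous_on (ball a r) (bump a r)"
    using smooth_on_continuous[OF smooth_on_bump] continuous_on_subset by blast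
  ultimately have "continuous_on (ball a r) (\<lambda>x. h (chart_inv c x) (?E v (chart_inv c x)) (?E w (chart_inv c x)) /
      (bump a r x * bump a r x))"
    using r by (intro continuous_intros) (auto simp: bump_eq_0_iff)
  moreover have "h (chart_inv c x) (?E v (chart_inv c x)) (?E w (chart_inv c x)) / (bump a r x * bump a r x) =
      hloc c x v w" if "x \<in> ball a r" for x
  proof -
    have x: "x \<in> snd c ` fst c" using that r by auto
    have "h (chart_inv c x) (?E v (chart_inv c x)) (?E w (chart_inv c x)) =
        hloc c x (bump a r x *\<^sub>R v) (bump a r x *\<^sub>R w)"
      using x assms by (simp add: hloc_def bump_field_chart chart_inv_mem chart_chart_inv)
    then show ?thesis using hloc_scaleR[OF assms x] bump_eq_0_iff[OF r(1), of a x] that by simp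
  qed
  ultimately have "continuous_on (ball a r) (\<lambda>x. hloc c x v w)" by (subst (asm) continuous_on_cong) auto
  then show "isCont (\<lambda>x. hloc c x v w) a" using r(1) by (simp add: continuous_on_eq_continuous_at)
qed

text \<open>By bilinearity the form is a polynomial in the vector with the finitely many continuous
  coefficients \<open>hloc c x i j\<close>.\<close>

lemma hloc_jointly_continuous:
  assumes "c \<in> A"
  shows "continuous_on ((snd c ` fst c) \<times> UNIV) (\<lambda>y. hloc c (fst y) (snd y) (snd y))"
proof -
  have "continuous_on ((snd c ` fst c) \<times> UNIV) (\<lambda>y. hloc c (fst y) i j)" for i j
    by (rule continuous_on_compose2[OF hloc_continuous[OF assms]]) (auto intro: continuous_intros)
  then have cont: "continuous_on ((snd c ` fst c) \<times> UNIV)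
      (\<lambda>y. \<Sum>i\<in>Basis. (snd y \<bullet> i) * (\<Sum>j\<in>Basis. (snd y \<bullet> j) * hloc c (fst y) i j))"
    by (intro continuous_intros)
  have eq: "hloc c x v v = (\<Sum>i\<in>Basis. (v \<bullet> i) * (\<Sum>j\<in>Basis. (v \<bullet> j) * hloc c x i j))"
    if "x \<in> snd c ` fst c" for x v
  proof -
    have "hloc c x v v = (\<Sum>i\<in>Basis. (v \<bullet> i) *\<^sub>R hloc c x i v)"
      by (rule linear_euclidean_sum[OF hloc_linear(1)[OF assms that]])
    also have "\<dots> = (\<Sum>i\<in>Basis. (v \<bullet> i) *\<^sub>R (\<Sum>j\<in>Basis. (v \<bullet> j) *\<^sub>R hloc c x i j))"
      by (intro sum.cong refl arg_cong2[of _ _ _ _ scaleR]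
          linear_euclidean_sum[OF hloc_linear(2)[OF assms that]])
    finally show ?thesis by simp
  qed
  show ?thesis by (rule continuous_on_eq[OF cont]) (auto simp: eq)
qed

lemma hloc_pos:
  assumes "c \<in> A" "x \<in> snd c ` fst c" "v \<noteq> 0" shows "hloc c x v v > 0"
proof -
  have p: "chart_inv c x \<in> fst c" using assms(2) by (rule chart_inv_mem)
  then have "tvec_at A c (chart_inv c x) v \<noteq> (\<lambda>c. 0)"
    using assms tvec_at_self by metis
  then show ?thesis
    unfolding hloc_def by (intro h_pos tvec_at_mem assms p chart_mpoints[OF assms(1) p])
qed

lemma h_zero_right:
  assumes "p \<in> mpoints A" "u \<in> tangent_space A p" shows "h p (\<lambda>c. 0) u = 0"
  using h_lincomb[OF assms(1) zero_tangent zero_tangent assms(2), of 0 0] by simp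

lemma hloc_0: "c \<in> A \<Longrightarrow> x \<in> snd c ` fst c \<Longrightarrow> hloc c x 0 0 = 0"
  using linear_0[OF hloc_linear(1)] by simp

lemma hloc_nonneg: "c \<in> A \<Longrightarrow> x \<in> snd c ` fst c \<Longrightarrow> hloc c x v v \<ge> 0"
  using hloc_pos[of c x v] hloc_0[of c x] by (cases "v = 0") auto

lemma metric_atlas: "metric_atlas A h"
proof
  fix p assume p: "p \<in> mpoints A"
  show "h p (\<lambda>c. 0) (\<lambda>c. 0) = 0" using p zero_tangent by (rule h_zero_right)
  then show "0 \<le> h p v v" if "v \<in> tangent_space A p" for v
    using h_pos[OF p that] by (cases "v = (\<lambda>c. 0)") auto
next
  fix c assume "c \<in> A"
  then show "continuous_on ((snd c ` fst c) \<times> UNIV)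
      (\<lambda>y. h (chart_inv c (fst y)) (tvec_at A c (chart_inv c (fst y)) (snd y))
        (tvec_at A c (chart_inv c (fst y)) (snd y)))"
    using hloc_jointly_continuous unfolding hloc_def by blast
qed

sublocale metric_atlas A h by (rule metric_atlas)

text \<open>Origin of the constant m that compares the coordinate norm with the Riemannian one: the
  minimum of the form over the compact set of base points and unit vectors is positive, and
  homogeneity covers all other vectors.\<close>

lemma hloc_lower_bound:
  assumes "c \<in> A" "compact C" "C \<subseteq> snd c ` fst c"
  shows "\<exists>a>0. \<forall>x\<in>C. \<forall>v. a * norm v \<le> sqrt (hloc c x v v)"
proof (cases "C = {}")
  case False
  let ?S = "C \<times> sphere (0::'e) 1"
  obtain i where "i \<in> (Basis :: 'e set)" using nonempty_Basis by blast
  then have "i \<in> sphere (0::'e) 1" by simp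
  then have "?S \<noteq> {}" using False by blast
  moreover have "compact ?S" using assms by (intro compact_Times) auto
  moreover have "continuous_on ?S (\<lambda>y. hloc c (fst y) (snd y) (snd y))"
    by (rule continuous_on_subset[OF hloc_jointly_continuous[OF assms(1)]]) (use assms in auto)
  ultimately obtain y where y: "y \<in> ?S"
    "\<forall>z\<in>?S. hloc c (fst y) (snd y) (snd y) \<le> hloc c (fst z) (snd z) (snd z)"
    using continuous_attains_inf by blast
  define m where "m = hloc c (fst y) (snd y) (snd y)"
  have m: "m > 0" unfolding m_def using y(1) assms by (intro hloc_pos) auto
  have "sqrt m * norm v \<le> sqrt (hloc c x v v)" if x: "x \<in> C" for x v
  proof (cases "v = 0")
    case False
    have xc: "x \<in> snd c ` fst c" using x assms by blast
    have "m \<le> hloc c x (sgn v) (sgn v)"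
      using y(2) x False by (auto simp: m_def norm_sgn)
    then have "m * (norm v)\<^sup>2 \<le> (norm v)\<^sup>2 * hloc c x (sgn v) (sgn v)"
      by (simp add: mult.commute[of m] mult_left_mono)
    also have "\<dots> = hloc c x (norm v *\<^sub>R sgn v) (norm v *\<^sub>R sgn v)"
      by (simp only: hloc_scaleR[OF assms(1) xc] power2_eq_square)
    also have "norm v *\<^sub>R sgn v = v" using False by (simp add: sgn_div_norm)
    finally show ?thesis using real_sqrt_le_mono by (fastforce simp: real_sqrt_mult)
  qed (use hloc_nonneg[of c x v] x assms in auto)
  then show ?thesis using m by (intro exI[of _ "sqrt m"]) auto
qed (auto intro: exI[of _ 1])

end

section \<open>The connector and Dombrowski's metric in coordinates\<close>

context manifold
begin

lemma vector_field_lincomb: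
  assumes "vector_field A X" "vector_field A Y"
  shows "vector_field A (\<lambda>p c. s *\<^sub>R X p c + t *\<^sub>R Y p c)"
  unfolding vector_field_def
proof (intro conjI ballI allI impI)
  fix c assume c: "c \<in> A"
  show "smooth_on (snd c ` fst c) (\<lambda>x. s *\<^sub>R X (chart_inv c x) c + t *\<^sub>R Y (chart_inv c x) c)"
    by (intro smooth_on_add smooth_on_linear_comp[OF bounded_linear_scaleR_right] open_chart_image c)
      (use assms c in \<open>auto simp: vector_field_def\<close>)
qed (use assms in \<open>auto simp: vector_field_def tangent_space_lincomb\<close>)

lemma vector_field_add:
  "vector_field A X \<Longrightarrow> vector_field A Y \<Longrightarrow> vector_field A (\<lambda>p c. X p c + Y p c)"
  using vector_field_lincomb[of X Y 1 1] by simp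

lemma vector_field_mult:
  assumes "smooth_fun A f" "vector_field A X"
  shows "vector_field A (\<lambda>p c. f p *\<^sub>R X p c)"
  unfolding vector_field_def
proof (intro conjI ballI allI impI)
  fix c assume c: "c \<in> A"
  show "smooth_on (snd c ` fst c) (\<lambda>x. f (chart_inv c x) *\<^sub>R X (chart_inv c x) c)"
    by (intro smooth_on_bilinear[OF bounded_bilinear_scaleR] open_chart_image c)
      (use assms c in \<open>auto simp: vector_field_def smooth_fun_def o_def\<close>)
next
  fix p assume "p \<in> mpoints A"
  then show "(\<lambda>c. f p *\<^sub>R X p c) \<in> tangent_space A p"
    using assms tangent_space_lincomb[of "X p" p "X p" "f p" 0] by (auto simp: vector_field_def)
qed (use assms in \<open>auto simp: vector_field_def\<close>)

lemma bump_has_derivative: "(bump a r has_derivative frechet_derivative (bump a r) (at x)) (at x)"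
  using smooth_on_differentiable[OF smooth_on_bump] by (simp add: frechet_derivative_works[symmetric])

lemma bump_field_has_derivative:
  assumes "c \<in> A" "x \<in> snd c ` fst c"
  shows "((\<lambda>x. bump_field c a r w (chart_inv c x) c) has_derivative
    (\<lambda>v. frechet_derivative (bump a r) (at x) v *\<^sub>R w)) (at x)"
proof -
  have "((\<lambda>x. bump a r x *\<^sub>R w) has_derivative (\<lambda>v. frechet_derivative (bump a r) (at x) v *\<^sub>R w)) (at x)"
    by (intro has_derivative_scaleR_left bump_has_derivative)
  then show ?thesis
    by (rule has_derivative_transform_within_open[OF _ open_chart_image[OF assms(1)] assms(2)])
      (use assms in \<open>auto simp: bump_field_chart\<close>)
qed

end

locale dombrowski_manifold = riemannian_manifold A h
  for A :: "('m, 'e::euclidean_space) chart set"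
    and h :: "'m \<Rightarrow> ('m, 'e) tvec \<Rightarrow> ('m, 'e) tvec \<Rightarrow> real" +
  fixes nabla :: "('m, 'e) connection"
    and K :: "'m \<times> ('m, 'e) tvec \<Rightarrow> ('m \<times> ('m, 'e) tvec, 'e \<times> 'e) tvec \<Rightarrow> ('m, 'e) tvec"
  assumes affine: "affine_connection A nabla" and connector: "connector A nabla K"
begin

sublocale TM: smooth_atlas "bundle_atlas A" by (rule smooth_atlas_bundle)

lemma bundle_chart_mem: "c \<in> A \<Longrightarrow> bundle_chart A c \<in> bundle_atlas A"
  by (simp add: bundle_atlas_def)

lemma nabla_field: "vector_field A X \<Longrightarrow> vector_field A Y \<Longrightarrow> vector_field A (nabla X Y)"
  using affine[unfolded affine_connection_def, THEN conjunct1] by blast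

lemma nabla_add:
  assumes "vector_field A X" "vector_field A Y" "vector_field A Y'"
  shows "nabla X (\<lambda>p c. Y p c + Y' p c) = (\<lambda>p c. nabla X Y p c + nabla X Y' p c)"
  using affine[unfolded affine_connection_def, THEN conjunct2, THEN conjunct2, THEN conjunct1,
      rule_format, of X Y Y'] assms by simp

lemma nabla_mult:
  assumes "vector_field A X" "vector_field A Y" "smooth_fun A f"
  shows "nabla X (\<lambda>p c. f p *\<^sub>R Y p c) =
    (\<lambda>p c. f p *\<^sub>R nabla X Y p c + dir_deriv A p (X p) f *\<^sub>R Y p c)"
  using affine[unfolded affine_connection_def, THEN conjunct2, THEN conjunct2, THEN conjunct2,
      rule_format, of f X Y] assms by simp

lemma nabla_lincomb:
  assumes "vector_field A X" "vector_field A Y" "vector_field A Y'"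
  shows "nabla X (\<lambda>p c. s *\<^sub>R Y p c + t *\<^sub>R Y' p c) = (\<lambda>p c. s *\<^sub>R nabla X Y p c + t *\<^sub>R nabla X Y' p c)"
proof -
  have scale: "nabla X (\<lambda>p c. s *\<^sub>R Y p c) = (\<lambda>p c. s *\<^sub>R nabla X Y p c)"
    "vector_field A (\<lambda>p c. s *\<^sub>R Y p c)" if Y: "vector_field A Y" for s Y
  proof -
    have f: "smooth_fun A (\<lambda>p. s)" by (simp add: smooth_fun_def o_def smooth_on_const)
    moreover have "dir_deriv A p (X p) (\<lambda>p. s) = 0" for p
      by (simp add: dir_deriv_def Let_def o_def)
    ultimately show "nabla X (\<lambda>p c. s *\<^sub>R Y p c) = (\<lambda>p c. s *\<^sub>R nabla X Y p c)"
      using nabla_mult[OF assms(1) Y f] by simp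
    show "vector_field A (\<lambda>p c. s *\<^sub>R Y p c)" by (rule vector_field_mult[OF f Y])
  qed
  have "nabla X (\<lambda>p c. s *\<^sub>R Y p c + t *\<^sub>R Y' p c) =
      (\<lambda>p c. nabla X (\<lambda>p c. s *\<^sub>R Y p c) p c + nabla X (\<lambda>p c. t *\<^sub>R Y' p c) p c)"
    by (rule nabla_add[OF assms(1) scale(2)[OF assms(2)] scale(2)[OF assms(3)]])
  then show ?thesis using scale(1) assms by simp
qed

lemma K_mem:
  "u \<in> tangent_bundle A \<Longrightarrow> a \<in> tangent_space (bundle_atlas A) u \<Longrightarrow> K u a \<in> tangent_space A (fst u)"
  using connector unfolding connector_def by blast

lemma K_lincomb:
  assumes "u \<in> tangent_bundle A" "a \<in> tangent_space (bundle_atlas A) u" "b \<in> tangent_space (bundle_atlas A) u"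
  shows "K u (\<lambda>d. r *\<^sub>R a d + s *\<^sub>R b d) = (\<lambda>c. r *\<^sub>R K u a c + s *\<^sub>R K u b c)"
  using connector assms unfolding connector_def by blast

definition kloc :: "('m, 'e) chart \<Rightarrow> 'm \<times> ('m, 'e) tvec \<Rightarrow> 'e \<times> 'e \<Rightarrow> 'e" where
  "kloc c u a = K u (tvec_at (bundle_atlas A) (bundle_chart A c) u a) c"

lemma kloc_linear:
  assumes "u \<in> tangent_bundle A" "c \<in> A" "fst u \<in> fst c" shows "linear (kloc c u)"
proof -
  have u: "u \<in> fst (bundle_chart A c)" using assms by (simp add: fst_bundle_chart)
  note C = bundle_chart_mem[OF assms(2)]
  have lc: "kloc c u (r *\<^sub>R a + s *\<^sub>R b) = r *\<^sub>R kloc c u a + s *\<^sub>R kloc c u b" for r s a b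
    unfolding kloc_def TM.tvec_at_lincomb[OF C u]
    by (subst K_lincomb[OF assms(1) TM.tvec_at_mem[OF C u] TM.tvec_at_mem[OF C u]]) (rule refl)
  show ?thesis
    by (rule linearI) (use lc[of 1 _ 1] lc[of _ _ 0 0] in auto)
qed

text \<open>The connector identity in coordinates. It reaches only vectors tangent to sections; the
  values of \<open>kloc\<close> elsewhere follow from suitable fields and linearity.\<close>

lemma nabla_kloc:
  assumes "vector_field A X" "vector_field A Y" "c \<in> A" "p \<in> fst c"
    and "((\<lambda>x. Y (chart_inv c x) c) has_derivative D) (at (snd c p))"
  shows "nabla X Y p c = kloc c (p, Y p) (X p c, D (X p c))"
proof -
  have p: "p \<in> mpoints A" using chart_mpoints assms by blast
  then have "nabla X Y p = K (p, Y p) (differential A (bundle_atlas A) (\<lambda>q. (q, Y q)) p (X p))"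
    using connector assms unfolding connector_def by blast
  then show ?thesis
    using differential_section[OF assms(3,4) _ assms(2,5)] assms(1) p by (simp add: kloc_def vector_field_def)
qed

text \<open>On vertical vectors the connector is the identity: compare the covariant derivatives of a field \<open>Y\<close>
  and of \<open>Y + f Z\<close>, where \<open>f\<close> vanishes at the point considered but its derivative does not.\<close>

lemma kloc_vertical:
  assumes "u \<in> tangent_bundle A" "c \<in> A" "fst u \<in> fst c" shows "kloc c u (0, z) = z"
proof -
  define p where "p = fst u" define a where "a = snd c p"
  have p: "p \<in> fst c" "p \<in> mpoints A" "snd u \<in> tangent_space A p"
    using assms chart_mpoints by (auto simp: p_def tangent_bundle_def)
  have a: "a \<in> snd c ` fst c" "chart_inv c a = p" using p assms by (auto simp: a_def)
  then obtain r where r: "r > 0" "cball a r \<subseteq> snd c ` fst c"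
    using open_chart_image[OF assms(2)] open_contains_cball by blast
  \<comment> \<open>The bump is not 1 at its centre. The fields below take the values b i for X and
    b z for Z at p, while Y is divided by b in order to pass exactly through u.\<close>
  define b where "b = bump a r a"
  have b: "b > 0" unfolding b_def using r by (subst bump_pos_iff) auto
  obtain i where i: "i \<in> (Basis :: 'e set)" using nonempty_Basis by blast
  define X where "X = bump_field c a r i"
  define Y where "Y = bump_field c a r (snd u c /\<^sub>R b)"
  define Z where "Z = bump_field c a r z"
  \<comment> \<open>A cut-off of the i-th coordinate centred at a: it is 0 at a and has derivative b
    (v . i) there, so f has derivative b * b along X at p.\<close>
  define f' where "f' x = bump a r x * ((x + (- a)) \<bullet> i)" for x
  define f where "f = extend_fun c f'"
  have fields: "vector_field A X" "vector_field A Y" "vector_field A Z"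
    unfolding X_def Y_def Z_def by (intro vector_field_bump_field assms r)+
  have f: "smooth_fun A f"
    unfolding f_def
  proof (rule smooth_fun_extend[OF assms(2) compact_cball r(2)])
    show "smooth_on UNIV f'"
      unfolding f'_def
      by (intro smooth_on_bilinear[OF bounded_bilinear_mult] smooth_on_bump
          smooth_on_linear_comp[OF bounded_linear_inner_left] smooth_on_add smooth_on_const
          smooth_on_bounded_linear bounded_linear_ident open_UNIV)
  qed (use r in \<open>auto simp: f'_def bump_outside\<close>)
  have fZ: "vector_field A (\<lambda>p c. f p *\<^sub>R Z p c)" by (rule vector_field_mult[OF f fields(3)])
  have Xp: "X p c = b *\<^sub>R i" and Zp: "Z p c = b *\<^sub>R z"
    using assms p by (auto simp: X_def Z_def bump_field_chart a_def[symmetric] b_def)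
  have Yp: "Y p = snd u"
    using assms p b tangent_eq_tvec_at[OF p(3) assms(2) p(1)]
    by (simp add: Y_def bump_field_chart a_def[symmetric] b_def)
  have fp: "f p = 0" using p by (simp add: f_def f'_def extend_fun_def a_def)
  have df': "(f' has_derivative (\<lambda>v. b * (v \<bullet> i))) (at a)"
    unfolding f'_def
    by (rule has_derivative_eq_rhs[OF has_derivative_mult[OF bump_has_derivative
          has_derivative_inner_left[OF has_derivative_add_const[OF has_derivative_ident]]]])
      (simp add: b_def fun_eq_iff)
  have df: "((f \<circ> chart_inv c) has_derivative (\<lambda>v. b * (v \<bullet> i))) (at a)"
    by (rule has_derivative_transform_within_open[OF df' open_chart_image[OF assms(2)] a(1)])
      (use assms in \<open>auto simp: f_def extend_fun_def\<close>)
  then have dd: "dir_deriv A p (X p) f = b * b"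
    using dir_deriv_chart[OF assms(2) p(1) _ df[unfolded a_def]] fields(1) p(2) Xp i
    by (simp add: vector_field_def inner_Basis)
  define D where "D v = frechet_derivative (bump a r) (at a) v *\<^sub>R (snd u c /\<^sub>R b)" for v
  have dY: "((\<lambda>x. Y (chart_inv c x) c) has_derivative D) (at (snd c p))"
    unfolding Y_def D_def a_def[symmetric] by (rule bump_field_has_derivative[OF assms(2) a(1)])
  have dfZ: "((\<lambda>x. f (chart_inv c x) *\<^sub>R Z (chart_inv c x) c) has_derivative
      (\<lambda>v. (b * (v \<bullet> i)) *\<^sub>R (b *\<^sub>R z))) (at (snd c p))"
    unfolding a_def[symmetric]
    by (rule has_derivative_eq_rhs[OF has_derivative_scaleR[OF df[unfolded o_def]
          bump_field_has_derivative[OF assms(2) a(1), of a r z, folded Z_def]]])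
      (simp add: fp a Zp)
  have u: "(p, Y p) = u" unfolding Yp by (simp add: p_def)
  have fZp: "Y p = (\<lambda>c. Y p c + f p *\<^sub>R Z p c)" by (simp add: fp)
  have "kloc c u (b *\<^sub>R i, D (b *\<^sub>R i) + b *\<^sub>R b *\<^sub>R b *\<^sub>R z) = nabla X (\<lambda>p c. Y p c + f p *\<^sub>R Z p c) p c"
    using nabla_kloc[OF fields(1) vector_field_add[OF fields(2) fZ] assms(2) p(1)
        has_derivative_add[OF dY dfZ]] i
    by (simp add: Xp fZp[symmetric] u mult.assoc)
  also have "\<dots> = nabla X Y p c + nabla X (\<lambda>p c. f p *\<^sub>R Z p c) p c"
    using nabla_add[OF fields(1,2) fZ] by simp
  also have "nabla X (\<lambda>p c. f p *\<^sub>R Z p c) p c = f p *\<^sub>R nabla X Z p c + dir_deriv A p (X p) f *\<^sub>R Z p c"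
    using nabla_mult[OF fields(1,3) f] by simp
  also have "nabla X Y p c = kloc c u (b *\<^sub>R i, D (b *\<^sub>R i))"
    using nabla_kloc[OF fields(1,2) assms(2) p(1) dY] by (simp add: Xp u)
  finally have "kloc c u (b *\<^sub>R i, D (b *\<^sub>R i) + b *\<^sub>R b *\<^sub>R b *\<^sub>R z) =
      kloc c u (b *\<^sub>R i, D (b *\<^sub>R i)) + b *\<^sub>R b *\<^sub>R b *\<^sub>R z"
    by (simp add: fp dd Zp)
  \<comment> \<open>Linearity splits off the vertical vector. Its factor b^3 collects one b each
    from X, from the derivative of f and from Z, and cancels against the same factor obtained from
    the Leibniz rule.\<close>
  moreover have "kloc c u (b *\<^sub>R i, D (b *\<^sub>R i) + b *\<^sub>R b *\<^sub>R b *\<^sub>R z) =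
      kloc c u (b *\<^sub>R i, D (b *\<^sub>R i)) + b *\<^sub>R b *\<^sub>R b *\<^sub>R kloc c u (0, z)"
    using linear_add[OF kloc_linear[OF assms], of "(b *\<^sub>R i, D (b *\<^sub>R i))" "b *\<^sub>R b *\<^sub>R b *\<^sub>R (0, z)"]
    by (simp only: linear_cmul[OF kloc_linear[OF assms]]) simp
  ultimately show ?thesis using b by simp
qed

text \<open>\<open>christoffel c x v w\<close> has components \<open>\<Gamma>\<^sup>k\<^sub>i\<^sub>j(x) v\<^sup>i w\<^sup>j\<close>.\<close>

definition christoffel :: "('m, 'e) chart \<Rightarrow> 'e \<Rightarrow> 'e \<Rightarrow> 'e \<Rightarrow> 'e" where
  "christoffel c x v w = kloc c (chart_inv c x, tvec_at A c (chart_inv c x) w) (v, 0)"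

text \<open>Split (v, z) into the vertical vector (0, z), which the connector fixes, and (v, 0),
  whose image is \<Gamma>(v, w) by definition.\<close>

lemma kloc_eq:
  assumes "u \<in> tangent_bundle A" "c \<in> A" "fst u \<in> fst c"
  shows "kloc c u (v, z) = z + christoffel c (snd c (fst u)) v (snd u c)"
proof -
  have "snd u \<in> tangent_space A (fst u)" using assms by (auto simp: tangent_bundle_def)
  then have "(fst u, tvec_at A c (fst u) (snd u c)) = u"
    using tangent_eq_tvec_at[OF _ assms(2,3)] by (metis prod.collapse)
  then have "christoffel c (snd c (fst u)) v (snd u c) = kloc c u (v, 0)"
    using assms by (simp add: christoffel_def)
  moreover have "kloc c u (v, z) = kloc c u (0, z) + kloc c u (v, 0)"
    using linear_add[OF kloc_linear[OF assms], of "(0, z)" "(v, 0)"] by simp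
  ultimately show ?thesis using kloc_vertical[OF assms] by simp
qed

lemma tvec_in_bundle:
  assumes "c \<in> A" "x \<in> snd c ` fst c"
  shows "(chart_inv c x, tvec_at A c (chart_inv c x) w) \<in> tangent_bundle A"
  using chart_inv_mem[OF assms(2)] assms(1) tvec_at_mem chart_mpoints by (simp add: tangent_bundle_iff)

text \<open>With \<phi> the bump, the covariant derivative of \<phi> w along \<phi> v is \<phi>
  (D\<phi> v) w + \<phi>^2 \<Gamma>(v, w); solve for \<Gamma>. As this holds on the whole ball,
  properties of \<open>nabla\<close> pass to \<Gamma>.\<close>

lemma christoffel_nabla:
  assumes "c \<in> A" "r > 0" "cball a r \<subseteq> snd c ` fst c" "x \<in> ball a r"
  shows "christoffel c x v w =
    nabla (bump_field c a r v) (bump_field c a r w) (chart_inv c x) c /\<^sub>R (bump a r x * bump a r x) -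
    (frechet_derivative (bump a r) (at x) v / bump a r x) *\<^sub>R w"
proof -
  define p where "p = chart_inv c x" define b where "b = bump a r x"
  have x: "x \<in> snd c ` fst c" using assms by auto
  have p: "p \<in> fst c" "snd c p = x" using x by (auto simp: p_def chart_inv_mem chart_chart_inv)
  have b: "b \<noteq> 0" using assms by (simp add: b_def bump_eq_0_iff)
  \<comment> \<open>Dividing w by the bump value at x makes the section pass through w itself over
    x; the factor is taken out again by linearity of \<open>nabla\<close>.\<close>
  let ?E = "bump_field c a r" let ?w = "w /\<^sub>R b" let ?D = "frechet_derivative (bump a r) (at x)"
  note E = vector_field_bump_field[OF assms(1-3)]
  have lin: "linear ?D" using bump_has_derivative has_derivative_linear by blast
  have u: "(p, tvec_at A c p w) \<in> tangent_bundle A" using tvec_in_bundle[OF assms(1) x] by (simp add: p_def)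
  have Ew: "?E ?w p = tvec_at A c p w" "?E v p c = b *\<^sub>R v"
    using assms p b by (auto simp: bump_field_chart b_def)
  have "nabla (?E v) (?E ?w) p c = kloc c (p, tvec_at A c p w) (b *\<^sub>R v, ?D (b *\<^sub>R v) *\<^sub>R ?w)"
    using nabla_kloc[OF E E assms(1) p(1)] bump_field_has_derivative[OF assms(1) x, of a r ?w] p(2)
    by (simp only: Ew)
  also have "\<dots> = ?D (b *\<^sub>R v) *\<^sub>R ?w + kloc c (p, tvec_at A c p w) (b *\<^sub>R (v, 0))"
    using kloc_eq[OF u assms(1)] p assms(1) by simp
  also have "\<dots> = ?D v *\<^sub>R w + b *\<^sub>R christoffel c x v w"
    using b by (subst linear_cmul[OF kloc_linear[OF u assms(1)]])
      (auto simp: p linear_cmul[OF lin] christoffel_def p_def[symmetric])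
  also have "nabla (?E v) (?E ?w) p c = nabla (?E v) (?E w) p c /\<^sub>R b"
    using nabla_lincomb[OF E[of v] E[of w] E[of w], where s = "inverse b" and t = 0] bump_field_lincomb[OF assms(1), of a r "inverse b" w 0 w]
    by simp
  finally have "b *\<^sub>R christoffel c x v w = nabla (?E v) (?E w) p c /\<^sub>R b - ?D v *\<^sub>R w" by simp
  then have "inverse b *\<^sub>R b *\<^sub>R christoffel c x v w = inverse b *\<^sub>R (nabla (?E v) (?E w) p c /\<^sub>R b - ?D v *\<^sub>R w)"
    by simp
  then show ?thesis using b
    by (simp add: p_def[symmetric] b_def[symmetric] scaleR_diff_right divide_inverse mult.commute)
qed

text \<open>Linearity in v is linearity of the connector on one fibre. A change of w changes the
  fibre \<open>T\<^sub>u(TM)\<close>, so linearity in w comes from the connection instead.\<close>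

lemma christoffel_linear:
  assumes "c \<in> A" "x \<in> snd c ` fst c"
  shows "linear (\<lambda>v. christoffel c x v w)" "linear (\<lambda>w. christoffel c x v w)"
proof -
  note lin = kloc_linear[OF tvec_in_bundle[OF assms] assms(1)]
  have p: "fst (chart_inv c x, tvec_at A c (chart_inv c x) w) \<in> fst c" for w
    using chart_inv_mem[OF assms(2)] by simp
  show "linear (\<lambda>v. christoffel c x v w)"
    unfolding christoffel_def
    by (rule linearI)
      (use linear_add[OF lin[OF p], of w "(_, 0)" "(_, 0)"] linear_cmul[OF lin[OF p], of w _ "(_, 0)"] in auto)
  obtain r where r: "r > 0" "cball x r \<subseteq> snd c ` fst c"
    using open_chart_image[OF assms(1)] assms(2) open_contains_cball by blast
  note E = vector_field_bump_field[OF assms(1) r]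
  have "christoffel c x v (s *\<^sub>R w + t *\<^sub>R w') = s *\<^sub>R christoffel c x v w + t *\<^sub>R christoffel c x v w'" for s t w w'
    unfolding christoffel_nabla[OF assms(1) r centre_in_ball[THEN iffD2, OF r(1)]]
      bump_field_lincomb[OF assms(1)] nabla_lincomb[OF E E E]
    by (simp add: algebra_simps)
  from this[of 1 _ 1] this[of _ _ 0 0] show "linear (\<lambda>w. christoffel c x v w)"
    by (intro linearI) auto
qed

text \<open>\<open>nabla\<close> maps smooth fields to smooth fields, so the right-hand side of
  \<open>christoffel_nabla\<close> is continuous on every ball in the chart.\<close>

lemma christoffel_continuous:
  assumes "c \<in> A" shows "continuous_on (snd c ` fst c) (\<lambda>x. christoffel c x v w)"
proof (rule continuous_at_imp_continuous_on, intro ballI)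
  fix a assume "a \<in> snd c ` fst c"
  then obtain r where r: "r > 0" "cball a r \<subseteq> snd c ` fst c"
    using open_chart_image[OF assms] open_contains_cball by blast
  note E = vector_field_bump_field[OF assms r]
  have "vector_field A (nabla (bump_field c a r v) (bump_field c a r w))"
    by (rule nabla_field[OF E E])
  then have "continuous_on (ball a r) (\<lambda>x. nabla (bump_field c a r v) (bump_field c a r w) (chart_inv c x) c)"
    using assms r(2) ball_subset_cball unfolding vector_field_def
    by (meson continuous_on_subset order_trans smooth_on_continuous)
  moreover have "continuous_on (ball a r) (\<lambda>x. frechet_derivative (bump a r) (at x) v)"
    "continuous_on (ball a r) (bump a r)"
    by (rule continuous_on_subset[OF smooth_on_continuous[OF smooth_on_deriv[OF smooth_on_bump]] subset_UNIV],
        rule continuous_on_subset[OF smooth_on_continuous[OF smooth_on_bump] subset_UNIV])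
  ultimately have "continuous_on (ball a r) (\<lambda>x.
      nabla (bump_field c a r v) (bump_field c a r w) (chart_inv c x) c /\<^sub>R (bump a r x * bump a r x) -
      (frechet_derivative (bump a r) (at x) v / bump a r x) *\<^sub>R w)"
    by (intro continuous_intros) (use r in \<open>auto simp: bump_eq_0_iff\<close>)
  then have "continuous_on (ball a r) (\<lambda>x. christoffel c x v w)"
    by (rule continuous_on_eq) (simp add: christoffel_nabla[OF assms r])
  then show "isCont (\<lambda>x. christoffel c x v w) a" using r(1) by (simp add: continuous_on_eq_continuous_at)
qed

lemma christoffel_expand:
  assumes "c \<in> A" "x \<in> snd c ` fst c"
  shows "christoffel c x v w = (\<Sum>i\<in>Basis. \<Sum>j\<in>Basis. ((v \<bullet> i) * (w \<bullet> j)) *\<^sub>R christoffel c x i j)"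
proof -
  have "christoffel c x v w = (\<Sum>i\<in>Basis. (v \<bullet> i) *\<^sub>R christoffel c x i w)"
    by (rule linear_euclidean_sum[OF christoffel_linear(1)[OF assms]])
  also have "\<dots> = (\<Sum>i\<in>Basis. (v \<bullet> i) *\<^sub>R (\<Sum>j\<in>Basis. (w \<bullet> j) *\<^sub>R christoffel c x i j))"
    by (intro sum.cong refl arg_cong2[of _ _ _ _ scaleR]
        linear_euclidean_sum[OF christoffel_linear(2)[OF assms]])
  finally show ?thesis by (simp add: scaleR_sum_right)
qed

text \<open>Origin of the constant B: finitely many continuous coefficients are bounded on a compact
  set, and each coordinate of a vector is at most its norm.\<close>

lemma christoffel_bound:
  assumes "c \<in> A" "compact C" "C \<subseteq> snd c ` fst c"
  shows "\<exists>B\<ge>0. \<forall>x\<in>C. \<forall>v w. norm (christoffel c x v w) \<le> B * norm v * norm w"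
proof -
  have "\<exists>M. \<forall>x\<in>C. norm (christoffel c x i j) \<le> M" for i j
    using compact_imp_bounded[OF compact_continuous_image[OF
          continuous_on_subset[OF christoffel_continuous[OF assms(1)] assms(3)] assms(2)], of i j]
    by (simp add: bounded_iff)
  then obtain M where M: "\<And>i j x. x \<in> C \<Longrightarrow> norm (christoffel c x i j) \<le> M i j" by metis
  define B where "B = (\<Sum>i\<in>Basis. \<Sum>j\<in>Basis. \<bar>M i j\<bar>)"
  have "norm (christoffel c x v w) \<le> B * norm v * norm w" if x: "x \<in> C" for x v w
  proof -
    have "norm (((v \<bullet> i) * (w \<bullet> j)) *\<^sub>R christoffel c x i j) \<le> (norm v * norm w) * \<bar>M i j\<bar>"
      if "i \<in> Basis" "j \<in> Basis" for i j
      using M[OF x, of i j] that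
      by (simp add: abs_mult) (intro mult_mono Basis_le_norm; simp)
    then have "norm (christoffel c x v w) \<le> (\<Sum>i\<in>Basis. \<Sum>j\<in>Basis. (norm v * norm w) * \<bar>M i j\<bar>)"
      unfolding christoffel_expand[OF assms(1) subsetD[OF assms(3) x], of v w]
      by (intro sum_norm_le) auto
    also have "\<dots> = B * norm v * norm w"
      by (simp add: B_def sum_distrib_left sum_distrib_right mult_ac)
    finally show ?thesis .
  qed
  moreover have "B \<ge> 0" by (auto simp: B_def intro!: sum_nonneg)
  ultimately show ?thesis by blast
qed

section \<open>Dombrowski's metric in bundle charts\<close>

abbreviation dmetric where "dmetric \<equiv> dombrowski_metric A h K"

text \<open>In the chart the projection of a has coordinates v and its image under the connector has
  coordinates k, so the metric is the sum of the two squared lengths.\<close>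

lemma dombrowski_chart:
  assumes "u \<in> tangent_bundle A" "c \<in> A" "fst u \<in> fst c"
    and "a \<in> tangent_space (bundle_atlas A) u" "a (bundle_chart A c) = (v, z)"
    and "x = snd c (fst u)" "k = z + christoffel c x v (snd u c)"
  shows "dmetric u a a = hloc c x v v + hloc c x k k"
proof -
  have u: "u \<in> fst (bundle_chart A c)" using assms by (simp add: fst_bundle_chart)
  have "a = tvec_at (bundle_atlas A) (bundle_chart A c) u (v, z)"
    using TM.tangent_eq_tvec_at[OF assms(4) bundle_chart_mem[OF assms(2)] u] assms(5) by simp
  then have "K u a c = k"
    using kloc_eq[OF assms(1-3), of v z] assms by (simp add: kloc_def)
  then have "K u a = tvec_at A c (fst u) k"
    using tangent_eq_tvec_at[OF K_mem[OF assms(1,4)] assms(2,3)] by simp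
  moreover have "differential (bundle_atlas A) A fst u a = tvec_at A c (fst u) v"
    using differential_fst[OF assms(1,4,2,3)] assms(5) by simp
  ultimately show ?thesis
    using assms by (simp add: dombrowski_metric_def hloc_def)
qed

lemma metric_atlas_dombrowski: "metric_atlas (bundle_atlas A) dmetric"
proof
  fix u assume "u \<in> mpoints (bundle_atlas A)"
  then have u: "u \<in> tangent_bundle A" "\<exists>c\<in>A. fst u \<in> fst c"
    by (auto simp: mpoints_def bundle_atlas_def fst_bundle_chart)
  then obtain c where c: "c \<in> A" "fst u \<in> fst c" by blast
  then have x: "snd c (fst u) \<in> snd c ` fst c" by blast
  show "0 \<le> dmetric u a a" if a: "a \<in> tangent_space (bundle_atlas A) u" for a
  proof -
    obtain v z where vz: "a (bundle_chart A c) = (v, z)" by (cases "a (bundle_chart A c)")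
    show ?thesis
      unfolding dombrowski_chart[OF u(1) c a vz refl refl] by (intro add_nonneg_nonneg hloc_nonneg c x)
  qed
  show "dmetric u (\<lambda>c. 0) (\<lambda>c. 0) = 0"
    using dombrowski_chart[OF u(1) c TM.zero_tangent _ refl refl, of 0 0]
    by (simp add: zero_prod_def hloc_0[OF c(1) x] linear_0[OF christoffel_linear(1)[OF c(1) x]])
next
  fix C assume "C \<in> bundle_atlas A"
  then obtain c where c: "c \<in> A" "C = bundle_chart A c" by (auto simp: bundle_atlas_def)
  let ?S = "(snd c ` fst c \<times> (UNIV :: 'e set)) \<times> (UNIV :: ('e \<times> 'e) set)"
  have S: "(snd C ` fst C) \<times> (UNIV :: ('e \<times> 'e) set) = ?S" using c bundle_chart_image by simp
  \<comment> \<open>A tangent vector of TM is encoded as y = ((x, w), (v, z)): the point with its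
    fibre coordinate, followed by the two components of the vector.\<close>
  let ?k = "\<lambda>y::('e \<times> 'e) \<times> ('e \<times> 'e). snd (snd y) + christoffel c (fst (fst y)) (fst (snd y)) (snd (fst y))"
  have "continuous_on ?S (\<lambda>y. christoffel c (fst (fst y)) i j)" for i j
    by (rule continuous_on_compose2[OF christoffel_continuous[OF c(1)]]) (auto intro!: continuous_intros)
  then have "continuous_on ?S (\<lambda>y. \<Sum>i\<in>Basis. \<Sum>j\<in>Basis.
      ((fst (snd y) \<bullet> i) * (snd (fst y) \<bullet> j)) *\<^sub>R christoffel c (fst (fst y)) i j)"
    by (intro continuous_intros)
  then have "continuous_on ?S (\<lambda>y. christoffel c (fst (fst y)) (fst (snd y)) (snd (fst y)))"
    by (rule continuous_on_eq) (auto intro!: christoffel_expand[OF c(1), symmetric])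
  then have k: "continuous_on ?S ?k" by (intro continuous_intros)
  have "continuous_on ?S (\<lambda>y. (fst (fst y), fst (snd y)))" "continuous_on ?S (\<lambda>y. (fst (fst y), ?k y))"
    by (intro continuous_intros k)+
  then have "continuous_on ?S (\<lambda>y. hloc c (fst (fst y)) (fst (snd y)) (fst (snd y)))"
    "continuous_on ?S (\<lambda>y. hloc c (fst (fst y)) (?k y) (?k y))"
    using continuous_on_compose2[OF hloc_jointly_continuous[OF c(1)]] by fastforce+
  then have "continuous_on ?S (\<lambda>y. hloc c (fst (fst y)) (fst (snd y)) (fst (snd y)) +
      hloc c (fst (fst y)) (?k y) (?k y))"
    by (rule continuous_on_add)
  then have "continuous_on ?S (\<lambda>y. dmetric (chart_inv C (fst y))
      (tvec_at (bundle_atlas A) C (chart_inv C (fst y)) (snd y))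
      (tvec_at (bundle_atlas A) C (chart_inv C (fst y)) (snd y)))"
  proof (rule continuous_on_eq)
    fix y assume "y \<in> ?S"
    then obtain p w v z where y: "p \<in> fst c" "y = ((snd c p, w), (v, z))" by auto
    define u where "u = (p, tvec_at A c p w)"
    have inv: "chart_inv C (fst y) = u" using c y by (simp add: u_def bundle_chart_inv)
    have u: "u \<in> tangent_bundle A" "fst u \<in> fst c" "u \<in> fst C"
      using c y chart_mpoints tvec_at_mem by (auto simp: u_def tangent_bundle_iff fst_bundle_chart)
    have C: "C \<in> bundle_atlas A" using c bundle_chart_mem by simp
    show "hloc c (fst (fst y)) (fst (snd y)) (fst (snd y)) + hloc c (fst (fst y)) (?k y) (?k y) =
      dmetric (chart_inv C (fst y)) (tvec_at (bundle_atlas A) C (chart_inv C (fst y)) (snd y))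
        (tvec_at (bundle_atlas A) C (chart_inv C (fst y)) (snd y))"
      unfolding inv
      by (rule dombrowski_chart[OF u(1) c(1) u(2) TM.tvec_at_mem[OF C u(3)], symmetric])
        (use c y u C in \<open>auto simp: u_def\<close>)
  qed
  then show "continuous_on ((snd C ` fst C) \<times> UNIV) (\<lambda>y. dmetric (chart_inv C (fst y))
      (tvec_at (bundle_atlas A) C (chart_inv C (fst y)) (snd y))
      (tvec_at (bundle_atlas A) C (chart_inv C (fst y)) (snd y)))"
    unfolding S .
qed

sublocale TM: metric_atlas "bundle_atlas A" dmetric by (rule metric_atlas_dombrowski)

end

section \<open>Completeness\<close>

lemma complete_distD:
  fixes x :: "nat \<Rightarrow> 'a"
  assumes "complete_dist S d" "range x \<subseteq> S"
    and "\<forall>\<epsilon>>0. \<exists>N. \<forall>m\<ge>N. \<forall>n\<ge>N. d (x m) (x n) < ereal \<epsilon>"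
  shows "\<exists>l\<in>S. \<forall>\<epsilon>>0. \<exists>N. \<forall>n\<ge>N. d (x n) l < ereal \<epsilon>"
  by (rule assms(1)[unfolded complete_dist_def, THEN spec, THEN mp, OF conjI[OF assms(2,3)]])

section \<open>Curves confined to a coordinate ball\<close>

context manifold
begin

text \<open>An application of \<open>trapped_interval\<close> to the times spent in the open and in
  the closed ball. The assumption \<open>trap\<close> is the place where a bound on the length
  enters.\<close>

lemma curve_trapped:
  assumes "piecewise_C1_curve A \<gamma>" "c \<in> A" "cball a r \<subseteq> snd c ` fst c"
    and s: "s \<in> {0..1}" "\<gamma> s \<in> fst c" "snd c (\<gamma> s) \<in> ball a r"
    and trap: "\<And>t. t \<in> {0..1} \<Longrightarrow>
      \<forall>\<tau>\<in>closed_segment s t. \<gamma> \<tau> \<in> fst c \<and> snd c (\<gamma> \<tau>) \<in> cball a r \<Longrightarrow> snd c (\<gamma> t) \<in> ball a r"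
    and t: "t \<in> {0..1}"
  shows "\<gamma> t \<in> fst c \<and> snd c (\<gamma> t) \<in> ball a r"
proof -
  define G where "G = {t \<in> {0..1}. \<gamma> t \<in> fst c \<and> snd c (\<gamma> t) \<in> ball a r}"
  define C where "C = {t \<in> {0..1}. \<gamma> t \<in> fst c \<and> snd c (\<gamma> t) \<in> cball a r}"
  have C_iff: "t \<in> C \<longleftrightarrow> \<gamma> t \<in> chart_inv c ` cball a r" if "t \<in> {0..1}" for t
  proof
    assume "t \<in> C"
    then show "\<gamma> t \<in> chart_inv c ` cball a r"
      using chart_inv_chart[OF assms(2)] unfolding C_def by (metis (mono_tags, lifting) imageI mem_Collect_eq)
  next
    assume "\<gamma> t \<in> chart_inv c ` cball a r"
    then obtain x where x: "x \<in> cball a r" "\<gamma> t = chart_inv c x" by blast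
    then have "x \<in> snd c ` fst c" using assms(3) by blast
    then show "t \<in> C" using x that by (simp add: C_def chart_inv_mem chart_chart_inv)
  qed
  have "{0..1} \<subseteq> G"
  proof (rule trapped_interval)
    show "openin (top_of_set {0..1}) G"
      unfolding openin_euclidean_subtopology_iff
    proof (intro conjI ballI)
      fix t assume "t \<in> G"
      then show "\<exists>e>0. \<forall>t'\<in>{0..1}. dist t' t < e \<longrightarrow> t' \<in> G"
        using curve_continuous[OF assms(1) _ assms(2) _ open_ball, of t a r] unfolding G_def by auto
    qed (auto simp: G_def)
    \<comment> \<open>The danger is that the curve leaves the chart domain in the limit of times in
      C. At a time outside C, a chart d around the point and \<open>open_minus_compact\<close> show
      that nearby times are outside C as well.\<close>
    have "openin (top_of_set {0..1}) ({0..1} - C)"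
      unfolding openin_euclidean_subtopology_iff
    proof (intro conjI ballI)
      fix t assume "t \<in> {0..1} - C"
      then have t: "t \<in> {0..1}" "\<gamma> t \<notin> chart_inv c ` cball a r" using C_iff by auto
      then obtain d where d: "d \<in> A" "\<gamma> t \<in> fst d"
        using curve_mpoints[OF assms(1) t(1)] unfolding mpoints_def by blast
      obtain e where e: "e > 0" "\<And>t'. t' \<in> {0..1} \<Longrightarrow> dist t' t < e \<Longrightarrow>
          \<gamma> t' \<in> fst d \<and> snd d (\<gamma> t') \<in> snd d ` (fst d - chart_inv c ` cball a r)"
        using curve_continuous[OF assms(1) t(1) d open_minus_compact[OF assms(2) d(1) compact_cball assms(3)]] t d
        by auto
      have "t' \<in> {0..1} - C" if t': "t' \<in> {0..1}" "dist t' t < e" for t'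
      proof -
        have "\<gamma> t' \<in> fst d" "snd d (\<gamma> t') \<in> snd d ` (fst d - chart_inv c ` cball a r)" using e(2)[OF t'] by auto
        then have "\<gamma> t' \<notin> chart_inv c ` cball a r"
          using inj_on_image_mem_iff[OF inj_chart[OF d(1)], of "\<gamma> t'" "fst d - chart_inv c ` cball a r"] by auto
        then show ?thesis using C_iff t' by auto
      qed
      then show "\<exists>e>0. \<forall>t'\<in>{0..1}. dist t' t < e \<longrightarrow> t' \<in> {0..1} - C" using e(1) by blast
    qed auto
    then show "closedin (top_of_set {0..1}) C"
      unfolding closedin_def by (auto simp: C_def)
    show "s \<in> G" using s by (simp add: G_def)
    show "t \<in> G" if t: "t \<in> {0..1}" "closed_segment s t \<subseteq> C" for t
    proof -
      have "\<forall>\<tau>\<in>closed_segment s t. \<gamma> \<tau> \<in> fst c \<and> snd c (\<gamma> \<tau>) \<in> cball a r"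
        using t(2) by (auto simp: C_def subset_iff)
      then have "snd c (\<gamma> t) \<in> ball a r" "\<gamma> t \<in> fst c" using trap[OF t(1)] by auto
      then show ?thesis using t(1) by (simp add: G_def)
    qed
  qed (auto simp: G_def C_def)
  then show ?thesis using t by (auto simp: G_def)
qed

end

context riemannian_manifold
begin

lemma speed_hloc:
  assumes "c \<in> A" "\<gamma> t \<in> fst c" "velocity A \<gamma> t \<in> tangent_space A (\<gamma> t)"
  shows "speed \<gamma> t = sqrt (hloc c (snd c (\<gamma> t)) (velocity A \<gamma> t c) (velocity A \<gamma> t c))"
  using assms tangent_eq_tvec_at[OF assms(3,1,2)] by (simp add: speed_def hloc_def)

text \<open>In the chart the derivative of the curve is at most its speed divided by m; integrate
  over the part of the curve that lies in C.\<close>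

lemma curve_displacement:
  assumes "piecewise_C1_curve A \<gamma>" "c \<in> A" "0 < m"
    and m: "\<And>x v. x \<in> C \<Longrightarrow> m * norm v \<le> sqrt (hloc c x v v)"
    and st: "s \<in> {0..1}" "t \<in> {0..1}"
    and C: "\<And>\<tau>. \<tau> \<in> closed_segment s t \<Longrightarrow> \<gamma> \<tau> \<in> fst c \<and> snd c (\<gamma> \<tau>) \<in> C"
  shows "m * norm (snd c (\<gamma> t) - snd c (\<gamma> s)) \<le> curve_length A h \<gamma>"
proof -
  obtain P where reg: "regular_off \<gamma> P" using curve_regular[OF assms(1)] by blast
  note P = regular_offD[OF reg] and f = speed_off[OF assms(1) reg]
  let ?f = "speed_off \<gamma> P"
  \<comment> \<open>The time s may come after t, as curves are also followed backwards; the estimate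
    is proved for ordered end points and used in either direction.\<close>
  have *: "norm ((snd c \<circ> \<gamma>) v - (snd c \<circ> \<gamma>) u) \<le> 1 / m * integral {0..1} ?f"
    if uv: "u \<le> v" "{u..v} = closed_segment s t" for u v
  proof (rule norm_diff_le_integral[OF _ P(1)])
    have uv': "{u..v} \<subseteq> {0..1}" using st uv(2) closed_segment_subset[of s "{0..1}" t] by simp
    moreover have "u \<in> {u..v}" "v \<in> {u..v}" using uv(1) by auto
    ultimately have bounds: "0 \<le> u" "v \<le> 1" using atLeastAtMost_iff by blast+
    then show "0 \<le> u" "v \<le> 1" "u \<le> v" using uv(1) by auto
    show "continuous_on {u..v} (snd c \<circ> \<gamma>)"
      by (rule curve_continuous_on[OF assms(1,2) uv']) (use C uv(2) in auto)
    fix \<tau> assume \<tau>: "\<tau> \<in> {u<..<v} - P"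
    then have \<tau>': "\<tau> \<in> {0<..<1} - P" "\<tau> \<in> closed_segment s t" using bounds unfolding uv(2)[symmetric] by auto
    let ?v = "velocity A \<gamma> \<tau> c"
    have "m * norm ?v \<le> ?f \<tau>"
      using m C[OF \<tau>'(2)] \<tau>'(1) speed_hloc[OF assms(2) _ P(2)[OF \<tau>'(1)]] by (simp add: speed_off_def)
    then have "norm ?v \<le> 1 / m * ?f \<tau>" using assms(3) by (simp add: field_simps)
    then show "\<exists>y'. ((snd c \<circ> \<gamma>) has_vector_derivative y') (at \<tau>) \<and> norm y' \<le> 1 / m * ?f \<tau>"
      using P(3)[OF \<tau>'(1) assms(2)] C[OF \<tau>'(2)] by blast
  qed (use f assms(3) in auto)
  have "norm (snd c (\<gamma> t) - snd c (\<gamma> s)) \<le> 1 / m * integral {0..1} ?f"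
  proof (cases "s \<le> t")
    case True
    then show ?thesis using *[of s t] by (simp add: closed_segment_eq_real_ivl)
  next
    case False
    then show ?thesis using *[of t s] by (simp add: closed_segment_eq_real_ivl norm_minus_commute)
  qed
  then show ?thesis using f(3) assms(3) by (simp add: field_simps)
qed

text \<open>Starting within r / 2 of the centre, the curve moves less than r / 2 as long as it is in
  the closed ball, so it never gets to the boundary.\<close>

lemma curve_stays:
  assumes "piecewise_C1_curve A \<gamma>" "c \<in> A" "0 < m" "cball a r \<subseteq> snd c ` fst c"
    and m: "\<And>x v. x \<in> cball a r \<Longrightarrow> m * norm v \<le> sqrt (hloc c x v v)"
    and s: "s \<in> {0..1}" "\<gamma> s \<in> fst c" "dist a (snd c (\<gamma> s)) < r / 2"
    and len: "curve_length A h \<gamma> < m * (r / 2)" and t: "t \<in> {0..1}"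
  shows "\<gamma> t \<in> fst c \<and> snd c (\<gamma> t) \<in> ball a r"
proof (rule curve_trapped[OF assms(1,2,4) s(1,2) _ _ t])
  have "0 \<le> dist a (snd c (\<gamma> s))" by simp
  then show "snd c (\<gamma> s) \<in> ball a r" using s(3) by (simp del: zero_le_dist)
  fix t assume t: "t \<in> {0..1}" "\<forall>\<tau>\<in>closed_segment s t. \<gamma> \<tau> \<in> fst c \<and> snd c (\<gamma> \<tau>) \<in> cball a r"
  have "m * norm (snd c (\<gamma> t) - snd c (\<gamma> s)) < m * (r / 2)"
    using curve_displacement[OF assms(1,2,3) m s(1) t(1)] t(2) len by (meson le_less_trans)
  then have "dist (snd c (\<gamma> s)) (snd c (\<gamma> t)) < r / 2"
    using assms(3) by (simp add: dist_norm norm_minus_commute)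
  then show "snd c (\<gamma> t) \<in> ball a r"
    using s(3) dist_triangle[of a "snd c (\<gamma> t)" "snd c (\<gamma> s)"] by simp
qed

end

context dombrowski_manifold
begin

section \<open>Projection and zero section\<close>

lemma mpoints_bundle: "mpoints (bundle_atlas A) = tangent_bundle A"
  by (fastforce simp: mpoints_def bundle_atlas_def fst_bundle_chart tangent_bundle_def)

lemma C1_curve_on_project:
  assumes "C1_curve_on (bundle_atlas A) \<Gamma> a b" shows "C1_curve_on A (fst \<circ> \<Gamma>) a b"
  unfolding C1_curve_on_def Let_def
proof
  fix t assume "t \<in> {a..b}"
  with assms obtain C e D where C: "C \<in> bundle_atlas A" "e > 0" "\<Gamma> ` ({a..b} \<inter> ball t e) \<subseteq> fst C"
    "\<forall>s\<in>{a..b} \<inter> ball t e. ((snd C \<circ> \<Gamma>) has_vector_derivative D s) (at s within {a..b} \<inter> ball t e)"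
    "continuous_on ({a..b} \<inter> ball t e) D"
    unfolding C1_curve_on_def Let_def by meson
  then obtain c where c: "c \<in> A" "C = bundle_chart A c" by (auto simp: bundle_atlas_def)
  have eq: "fst \<circ> (snd C \<circ> \<Gamma>) = snd c \<circ> (fst \<circ> \<Gamma>)" by (auto simp: c snd_bundle_chart fun_eq_iff)
  have "((snd c \<circ> (fst \<circ> \<Gamma>)) has_vector_derivative fst (D s)) (at s within {a..b} \<inter> ball t e)"
    if "s \<in> {a..b} \<inter> ball t e" for s
    unfolding eq[symmetric] using bounded_linear.has_vector_derivative[OF bounded_linear_fst] C(4) that
    by (fastforce simp: o_def)
  then show "\<exists>c\<in>A. \<exists>e>0. (fst \<circ> \<Gamma>) ` ({a..b} \<inter> ball t e) \<subseteq> fst c \<and>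
      (\<exists>D. (\<forall>s\<in>{a..b} \<inter> ball t e. ((snd c \<circ> (fst \<circ> \<Gamma>)) has_vector_derivative D s) (at s within {a..b} \<inter> ball t e)) \<and>
        continuous_on ({a..b} \<inter> ball t e) D)"
    using C c by (intro bexI[of _ c] exI[of _ e] conjI exI[of _ "fst \<circ> D"])
      (auto simp: fst_bundle_chart image_subset_iff o_def intro!: continuous_on_fst)
qed

lemma piecewise_project:
  "piecewise_C1_curve (bundle_atlas A) \<Gamma> \<Longrightarrow> piecewise_C1_curve A (fst \<circ> \<Gamma>)"
  unfolding piecewise_C1_curve_def using C1_curve_on_project by meson

lemma C1_curve_on_zero_section:
  assumes "C1_curve_on A \<gamma> a b" shows "C1_curve_on (bundle_atlas A) (\<lambda>t. (\<gamma> t, \<lambda>c. 0)) a b"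
  unfolding C1_curve_on_def Let_def
proof
  fix t assume "t \<in> {a..b}"
  with assms obtain c e D where c: "c \<in> A" "e > 0" "\<gamma> ` ({a..b} \<inter> ball t e) \<subseteq> fst c"
    "\<forall>s\<in>{a..b} \<inter> ball t e. ((snd c \<circ> \<gamma>) has_vector_derivative D s) (at s within {a..b} \<inter> ball t e)"
    "continuous_on ({a..b} \<inter> ball t e) D"
    unfolding C1_curve_on_def Let_def by meson
  let ?\<Gamma> = "\<lambda>t. (\<gamma> t, (\<lambda>c. 0) :: ('m, 'e) tvec)" let ?C = "bundle_chart A c"
  have eq: "snd ?C \<circ> ?\<Gamma> = (\<lambda>s. ((snd c \<circ> \<gamma>) s, 0))" by (auto simp: snd_bundle_chart fun_eq_iff)
  have "((snd ?C \<circ> ?\<Gamma>) has_vector_derivative (D s, 0)) (at s within {a..b} \<inter> ball t e)"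
    if "s \<in> {a..b} \<inter> ball t e" for s
    unfolding eq using that by (intro has_vector_derivative_Pair has_vector_derivative_const c(4)[rule_format])
  then show "\<exists>C\<in>bundle_atlas A. \<exists>e>0. ?\<Gamma> ` ({a..b} \<inter> ball t e) \<subseteq> fst C \<and>
      (\<exists>D. (\<forall>s\<in>{a..b} \<inter> ball t e. ((snd C \<circ> ?\<Gamma>) has_vector_derivative D s) (at s within {a..b} \<inter> ball t e)) \<and>
        continuous_on ({a..b} \<inter> ball t e) D)"
    using c by (intro bexI[of _ ?C] exI[of _ e] conjI exI[of _ "\<lambda>s. (D s, 0)"] bundle_chart_mem)
      (auto simp: fst_bundle_chart image_subset_iff tangent_bundle_iff zero_tangent chart_mpoints
        intro!: continuous_on_Pair)
qed

lemma piecewise_zero_section: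
  "piecewise_C1_curve A \<gamma> \<Longrightarrow> piecewise_C1_curve (bundle_atlas A) (\<lambda>t. (\<gamma> t, \<lambda>c. 0))"
  unfolding piecewise_C1_curve_def using C1_curve_on_zero_section by meson

lemma velocity_bundle_chart:
  assumes "c \<in> A" "\<Gamma> t \<in> fst (bundle_chart A c)"
    and "((snd c \<circ> (fst \<circ> \<Gamma>)) has_vector_derivative velocity A (fst \<circ> \<Gamma>) t c) (at t)"
    and "((snd (bundle_chart A c) \<circ> \<Gamma>) has_vector_derivative velocity (bundle_atlas A) \<Gamma> t (bundle_chart A c)) (at t)"
  shows "fst (velocity (bundle_atlas A) \<Gamma> t (bundle_chart A c)) = velocity A (fst \<circ> \<Gamma>) t c"
    and "((\<lambda>s. snd (\<Gamma> s) c) has_vector_derivative snd (velocity (bundle_atlas A) \<Gamma> t (bundle_chart A c))) (at t)"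
proof -
  have "fst \<circ> (snd (bundle_chart A c) \<circ> \<Gamma>) = snd c \<circ> (fst \<circ> \<Gamma>)"
    "snd \<circ> (snd (bundle_chart A c) \<circ> \<Gamma>) = (\<lambda>s. snd (\<Gamma> s) c)"
    by (auto simp: snd_bundle_chart fun_eq_iff)
  then have "((snd c \<circ> (fst \<circ> \<Gamma>)) has_vector_derivative fst (velocity (bundle_atlas A) \<Gamma> t (bundle_chart A c))) (at t)"
    "((\<lambda>s. snd (\<Gamma> s) c) has_vector_derivative snd (velocity (bundle_atlas A) \<Gamma> t (bundle_chart A c))) (at t)"
    using bounded_linear.has_vector_derivative[OF bounded_linear_fst assms(4)]
      bounded_linear.has_vector_derivative[OF bounded_linear_snd assms(4)] by (simp_all add: o_def)
  then show "fst (velocity (bundle_atlas A) \<Gamma> t (bundle_chart A c)) = velocity A (fst \<circ> \<Gamma>) t c"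
    "((\<lambda>s. snd (\<Gamma> s) c) has_vector_derivative snd (velocity (bundle_atlas A) \<Gamma> t (bundle_chart A c))) (at t)"
    using assms(3) vector_derivative_unique_at by blast+
qed

lemma bundle_speed:
  assumes "c \<in> A" "\<Gamma> t \<in> fst (bundle_chart A c)"
    and "velocity (bundle_atlas A) \<Gamma> t \<in> tangent_space (bundle_atlas A) (\<Gamma> t)"
    and "velocity (bundle_atlas A) \<Gamma> t (bundle_chart A c) = (v, z)"
    and "x = snd c (fst (\<Gamma> t))" "k = z + christoffel c x v (snd (\<Gamma> t) c)"
  shows "TM.speed \<Gamma> t = sqrt (hloc c x v v + hloc c x k k)"
  using assms dombrowski_chart[of "\<Gamma> t" c "velocity (bundle_atlas A) \<Gamma> t" v z x k]
  by (simp add: TM.speed_def fst_bundle_chart)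

text \<open>A common exceptional set allows the speeds of a curve in TM and of its projection to be
  compared pointwise.\<close>

lemma bundle_curve_regular:
  assumes "piecewise_C1_curve (bundle_atlas A) \<Gamma>"
  shows "\<exists>P. TM.regular_off \<Gamma> P \<and> regular_off (fst \<circ> \<Gamma>) P"
proof -
  obtain P Q where P: "TM.regular_off \<Gamma> P" and Q: "regular_off (fst \<circ> \<Gamma>) Q"
    using TM.curve_regular[OF assms] curve_regular[OF piecewise_project[OF assms]] by blast
  have "finite (P \<union> Q)" using TM.regular_offD(1)[OF P] regular_offD(1)[OF Q] by simp
  then show ?thesis
    using TM.regular_off_superset[OF P] regular_off_superset[OF Q]
    by (intro exI[of _ "P \<union> Q"] conjI) auto
qed

text \<open>In a bundle chart the velocity is \<open>(v, z)\<close>, where \<open>v\<close> is the velocity of the projected curve, and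
  \<open>k\<close> is its image under the connector.\<close>

lemma bundle_curve_chart:
  assumes P: "TM.regular_off \<Gamma> P" "regular_off (fst \<circ> \<Gamma>) P" and t: "t \<in> {0<..<1} - P"
    and c: "c \<in> A" "\<Gamma> t \<in> fst (bundle_chart A c)" and x: "x = snd c (fst (\<Gamma> t))"
  shows "\<exists>v z k. ((\<lambda>s. snd (\<Gamma> s) c) has_vector_derivative z) (at t) \<and>
    k = z + christoffel c x v (snd (\<Gamma> t) c) \<and>
    speed_off (fst \<circ> \<Gamma>) P t = sqrt (hloc c x v v) \<and>
    TM.speed_off \<Gamma> P t = sqrt (hloc c x v v + hloc c x k k)"
proof -
  let ?C = "bundle_chart A c"
  have mem: "(fst \<circ> \<Gamma>) t \<in> fst c" using c(2) by (simp add: fst_bundle_chart)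
  obtain v z where vz: "velocity (bundle_atlas A) \<Gamma> t ?C = (v, z)"
    by (cases "velocity (bundle_atlas A) \<Gamma> t ?C")
  note V = velocity_bundle_chart[OF c regular_offD(3)[OF P(2) t c(1) mem]
      TM.regular_offD(3)[OF P(1) t bundle_chart_mem[OF c(1)] c(2)]]
  have "velocity A (fst \<circ> \<Gamma>) t c = v" using V(1) vz by simp
  then have "speed (fst \<circ> \<Gamma>) t = sqrt (hloc c x v v)"
    using speed_hloc[OF c(1) mem regular_offD(2)[OF P(2) t]] x by simp
  moreover have "((\<lambda>s. snd (\<Gamma> s) c) has_vector_derivative z) (at t)" using V(2) vz by simp
  moreover note bundle_speed[OF c TM.regular_offD(2)[OF P(1) t] vz x refl]
  ultimately show ?thesis using t by (auto simp: speed_off_def TM.speed_off_def)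
qed

lemma curve_bundle_chart:
  assumes "piecewise_C1_curve (bundle_atlas A) \<Gamma>" "t \<in> {0..1}"
  obtains c where "c \<in> A" "\<Gamma> t \<in> fst (bundle_chart A c)"
  using TM.curve_mpoints[OF assms] unfolding mpoints_def bundle_atlas_def by blast

lemma speed_off_mono:
  assumes "piecewise_C1_curve (bundle_atlas A) \<Gamma>" "TM.regular_off \<Gamma> P" "regular_off (fst \<circ> \<Gamma>) P"
  shows "speed_off (fst \<circ> \<Gamma>) P t \<le> TM.speed_off \<Gamma> P t"
proof (cases "t \<in> {0<..<1} - P")
  case True
  then obtain c where c: "c \<in> A" "\<Gamma> t \<in> fst (bundle_chart A c)"
    using curve_bundle_chart[OF assms(1), of t] by auto
  then have "snd c (fst (\<Gamma> t)) \<in> snd c ` fst c" by (simp add: fst_bundle_chart)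
  then show ?thesis
    using bundle_curve_chart[OF assms(2,3) True c refl] hloc_nonneg[OF c(1)] by fastforce
qed (auto simp: speed_off_def TM.speed_off_def)

lemma curve_length_project:
  assumes "piecewise_C1_curve (bundle_atlas A) \<Gamma>"
  shows "curve_length A h (fst \<circ> \<Gamma>) \<le> curve_length (bundle_atlas A) dmetric \<Gamma>"
proof -
  obtain P where P: "TM.regular_off \<Gamma> P" "regular_off (fst \<circ> \<Gamma>) P"
    using bundle_curve_regular[OF assms] by blast
  note f = speed_off[OF piecewise_project[OF assms] P(2)] and g = TM.speed_off[OF assms P(1)]
  have "integral {0..1} (speed_off (fst \<circ> \<Gamma>) P) \<le> integral {0..1} (TM.speed_off \<Gamma> P)"
    by (rule integral_le[OF f(2) g(2)]) (rule speed_off_mono[OF assms P])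
  then show ?thesis using f(3) g(3) by simp
qed

text \<open>The fibre coordinate is constantly 0, so its derivative vanishes, and \<Gamma>(v, 0) = 0
  by linearity in w. Hence k = 0 and only the velocity in the base contributes.\<close>

lemma curve_length_zero_section:
  assumes "piecewise_C1_curve A \<gamma>"
  shows "curve_length (bundle_atlas A) dmetric (\<lambda>t. (\<gamma> t, \<lambda>c. 0)) = curve_length A h \<gamma>"
proof -
  let ?\<Gamma> = "\<lambda>t. (\<gamma> t, (\<lambda>c. 0) :: ('m, 'e) tvec)"
  have \<gamma>: "fst \<circ> ?\<Gamma> = \<gamma>" by (simp add: fun_eq_iff)
  note pw = piecewise_zero_section[OF assms]
  obtain P where P: "TM.regular_off ?\<Gamma> P" "regular_off (fst \<circ> ?\<Gamma>) P"
    using bundle_curve_regular[OF pw] by blast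
  have "TM.speed_off ?\<Gamma> P t = speed_off \<gamma> P t" for t
  proof (cases "t \<in> {0<..<1} - P")
    case True
    obtain c where c: "c \<in> A" "?\<Gamma> t \<in> fst (bundle_chart A c)"
      using curve_bundle_chart[OF pw, of t] True by auto
    let ?x = "snd c (\<gamma> t)"
    have x: "?x \<in> snd c ` fst c" using c by (simp add: fst_bundle_chart)
    obtain v z k where vzk: "((\<lambda>s. snd (?\<Gamma> s) c) has_vector_derivative z) (at t)"
      "k = z + christoffel c ?x v (snd (?\<Gamma> t) c)"
      "speed_off (fst \<circ> ?\<Gamma>) P t = sqrt (hloc c ?x v v)"
      "TM.speed_off ?\<Gamma> P t = sqrt (hloc c ?x v v + hloc c ?x k k)"
      using bundle_curve_chart[OF P True c, of ?x] by auto
    have "z = 0"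
      using vector_derivative_unique_at[OF vzk(1)] has_vector_derivative_const[of 0 "at t"] by simp
    then have "k = 0"
      using vzk(2) linear_0[OF christoffel_linear(2)[OF c(1) x]] by simp
    then show ?thesis
      using vzk(3,4) hloc_0[OF c(1) x] by (simp add: \<gamma>)
  qed (auto simp: speed_off_def TM.speed_off_def)
  then have "TM.speed_off ?\<Gamma> P = speed_off \<gamma> P" by blast
  then show ?thesis
    using TM.speed_off(3)[OF pw P(1)] speed_off(3)[OF assms P(2)[unfolded \<gamma>]] by simp
qed

lemma dist_project:
  assumes "riemannian_dist (bundle_atlas A) dmetric u u' < ereal \<epsilon>"
  shows "riemannian_dist A h (fst u) (fst u') < ereal \<epsilon>"
proof -
  obtain \<Gamma> where \<Gamma>: "piecewise_C1_curve (bundle_atlas A) \<Gamma>" "\<Gamma> 0 = u" "\<Gamma> 1 = u'"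
    "curve_length (bundle_atlas A) dmetric \<Gamma> < \<epsilon>"
    using riemannian_dist_lessD[OF assms] by blast
  show ?thesis
    by (rule riemannian_dist_lessI[OF piecewise_project[OF \<Gamma>(1)]])
      (use \<Gamma> curve_length_project[OF \<Gamma>(1)] in auto)
qed

lemma dist_zero_section:
  assumes "riemannian_dist A h p q < ereal \<epsilon>"
  shows "riemannian_dist (bundle_atlas A) dmetric (p, \<lambda>c. 0) (q, \<lambda>c. 0) < ereal \<epsilon>"
proof -
  obtain \<gamma> where \<gamma>: "piecewise_C1_curve A \<gamma>" "\<gamma> 0 = p" "\<gamma> 1 = q" "curve_length A h \<gamma> < \<epsilon>"
    using riemannian_dist_lessD[OF assms] by blast
  show ?thesis
    by (rule riemannian_dist_lessI[OF piecewise_zero_section[OF \<gamma>(1)]])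
      (use \<gamma> curve_length_zero_section[OF \<gamma>(1)] in auto)
qed

lemma complete_base:
  assumes "complete_dist (tangent_bundle A) (riemannian_dist (bundle_atlas A) dmetric)"
  shows "complete_dist (mpoints A) (riemannian_dist A h)"
  unfolding complete_dist_def
proof (intro allI impI)
  fix x :: "nat \<Rightarrow> 'm"
  assume x: "range x \<subseteq> mpoints A \<and> (\<forall>\<epsilon>>0. \<exists>N. \<forall>m\<ge>N. \<forall>n\<ge>N. riemannian_dist A h (x m) (x n) < ereal \<epsilon>)"
  let ?u = "\<lambda>n. (x n, (\<lambda>c. 0) :: ('m, 'e) tvec)"
  have "range ?u \<subseteq> tangent_bundle A" using x zero_tangent by (auto simp: tangent_bundle_iff)
  moreover have "\<forall>\<epsilon>>0. \<exists>N. \<forall>m\<ge>N. \<forall>n\<ge>N. riemannian_dist (bundle_atlas A) dmetric (?u m) (?u n) < ereal \<epsilon>"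
    using x dist_zero_section by meson
  ultimately obtain u where u: "u \<in> tangent_bundle A"
    "\<forall>\<epsilon>>0. \<exists>N. \<forall>n\<ge>N. riemannian_dist (bundle_atlas A) dmetric (?u n) u < ereal \<epsilon>"
    using complete_distD[OF assms, of ?u] by blast
  \<comment> \<open>The limit u is an arbitrary tangent vector, not known to lie on the zero
    section; its base point is the limit sought in M.\<close>
  then have "fst u \<in> mpoints A" by (auto simp: tangent_bundle_def)
  moreover have "\<forall>\<epsilon>>0. \<exists>N. \<forall>n\<ge>N. riemannian_dist A h (x n) (fst u) < ereal \<epsilon>"
  proof (intro allI impI)
    fix \<epsilon> :: real assume "\<epsilon> > 0"
    then obtain N where N: "\<And>n. n \<ge> N \<Longrightarrow> riemannian_dist (bundle_atlas A) dmetric (?u n) u < ereal \<epsilon>"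
      using u(2) by blast
    show "\<exists>N. \<forall>n\<ge>N. riemannian_dist A h (x n) (fst u) < ereal \<epsilon>"
      using dist_project[OF N] by auto
  qed
  ultimately show "\<exists>l\<in>mpoints A. \<forall>\<epsilon>>0. \<exists>N. \<forall>n\<ge>N. riemannian_dist A h (x n) l < ereal \<epsilon>"
    by blast
qed

section \<open>Fibre estimates and completeness of the bundle\<close>

lemma fiber_derivative_bound:
  assumes "TM.regular_off \<Gamma> P" "regular_off (fst \<circ> \<Gamma>) P" "t \<in> {0<..<1} - P"
    and c: "c \<in> A" "\<Gamma> t \<in> fst (bundle_chart A c)" "snd c (fst (\<Gamma> t)) \<in> C"
    and "0 < m" "0 \<le> B"
    and m: "\<And>x v. x \<in> C \<Longrightarrow> m * norm v \<le> sqrt (hloc c x v v)"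
    and B: "\<And>x v w. x \<in> C \<Longrightarrow> norm (christoffel c x v w) \<le> B * norm v * norm w"
  shows "\<exists>z. ((\<lambda>s. snd (\<Gamma> s) c) has_vector_derivative z) (at t) \<and>
    norm z \<le> (1 + B * norm (snd (\<Gamma> t) c)) / m * TM.speed_off \<Gamma> P t"
proof -
  let ?x = "snd c (fst (\<Gamma> t))" let ?w = "snd (\<Gamma> t) c" let ?S = "TM.speed_off \<Gamma> P t"
  have x: "?x \<in> snd c ` fst c" using c(2) by (simp add: fst_bundle_chart)
  obtain v z k where vzk: "((\<lambda>s. snd (\<Gamma> s) c) has_vector_derivative z) (at t)"
    "k = z + christoffel c ?x v ?w" "?S = sqrt (hloc c ?x v v + hloc c ?x k k)"
    using bundle_curve_chart[OF assms(1-5) refl] by blast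
  \<comment> \<open>The squared speed is a sum of two nonnegative terms, so its root dominates the
    length of each of v and k.\<close>
  have "m * norm v \<le> ?S" "m * norm k \<le> ?S"
    using m[OF c(3), of v] m[OF c(3), of k] hloc_nonneg[OF c(1) x, of v] hloc_nonneg[OF c(1) x, of k]
      real_sqrt_le_mono[of "hloc c ?x v v" "hloc c ?x v v + hloc c ?x k k"]
      real_sqrt_le_mono[of "hloc c ?x k k" "hloc c ?x v v + hloc c ?x k k"]
    unfolding vzk(3) by linarith+
  then have v: "norm v \<le> ?S / m" and k: "norm k \<le> ?S / m"
    using assms(7) by (simp_all add: field_simps)
  have "norm z = norm (k - christoffel c ?x v ?w)" using vzk(2) by simp
  also have "\<dots> \<le> norm k + norm (christoffel c ?x v ?w)" by (rule norm_triangle_ineq4)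
  also have "\<dots> \<le> ?S / m + B * (?S / m) * norm ?w"
  proof (rule add_mono[OF k order_trans[OF B[OF c(3)]]])
    show "B * norm v * norm ?w \<le> B * (?S / m) * norm ?w"
      by (intro mult_right_mono mult_left_mono v assms(8) norm_ge_zero)
  qed
  also have "\<dots> = (1 + B * norm ?w) / m * ?S"
    by (simp add: algebra_simps add_divide_distrib)
  finally show ?thesis using vzk(1) by blast
qed

text \<open>Gronwall's inequality for the fiber coordinate, by bounding the derivative of \<open>ln (1 + |w|\<^sup>2)\<close>.\<close>

lemma fiber_growth:
  assumes \<Gamma>: "piecewise_C1_curve (bundle_atlas A) \<Gamma>" and c: "c \<in> A"
    and C: "\<And>t. t \<in> {0..1} \<Longrightarrow> \<Gamma> t \<in> fst (bundle_chart A c) \<and> snd c (fst (\<Gamma> t)) \<in> C"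
    and mB: "0 < m" "0 \<le> B"
    and m: "\<And>x v. x \<in> C \<Longrightarrow> m * norm v \<le> sqrt (hloc c x v v)"
    and B: "\<And>x v w. x \<in> C \<Longrightarrow> norm (christoffel c x v w) \<le> B * norm v * norm w"
  defines "w \<equiv> \<lambda>t. snd (\<Gamma> t) c"
  shows "t \<in> {0..1} \<Longrightarrow> ln (1 + (norm (w t))\<^sup>2) \<le> ln (1 + (norm (w 0))\<^sup>2) +
      (1 + 2 * B) / m * curve_length (bundle_atlas A) dmetric \<Gamma>"
    and "(\<And>t. t \<in> {0..1} \<Longrightarrow> norm (w t) \<le> R) \<Longrightarrow>
      norm (w 1 - w 0) \<le> (1 + B * R) / m * curve_length (bundle_atlas A) dmetric \<Gamma>"
proof -
  obtain P where P: "TM.regular_off \<Gamma> P" "regular_off (fst \<circ> \<Gamma>) P"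
    using bundle_curve_regular[OF \<Gamma>] by blast
  note f = TM.speed_off[OF \<Gamma> P(1)]
  let ?S = "TM.speed_off \<Gamma> P"
  have deriv: "\<exists>z. (w has_vector_derivative z) (at t) \<and> norm z \<le> (1 + B * norm (w t)) / m * ?S t"
    if "t \<in> {0<..<1} - P" for t
    unfolding w_def
    by (rule fiber_derivative_bound[OF P that c _ _ mB m B]) (use C[of t] that in auto)
  have "continuous_on {0..1} (snd (bundle_chart A c) \<circ> \<Gamma>)"
    by (rule TM.curve_continuous_on[OF \<Gamma> bundle_chart_mem[OF c]]) (use C in auto)
  then have "continuous_on {0..1} (\<lambda>t. snd ((snd (bundle_chart A c) \<circ> \<Gamma>) t))"
    by (rule continuous_on_snd)
  then have w: "continuous_on {0..1} w" by (simp add: snd_bundle_chart w_def)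
  have pos: "0 < 1 + (norm y)\<^sup>2" for y :: 'e by (simp add: add_pos_nonneg)
  show "ln (1 + (norm (w t))\<^sup>2) \<le> ln (1 + (norm (w 0))\<^sup>2) +
      (1 + 2 * B) / m * curve_length (bundle_atlas A) dmetric \<Gamma>" if t: "t \<in> {0..1}"
  proof -
    \<comment> \<open>Unlike the norm, its square is differentiable where w vanishes; the 1 keeps
      the argument of ln positive.\<close>
    let ?y = "\<lambda>t. ln (1 + w t \<bullet> w t)"
    have "norm (?y t - ?y 0) \<le> (1 + 2 * B) / m * integral {0..1} ?S"
    proof (rule norm_diff_le_integral[where y = ?y, OF _ TM.regular_offD(1)[OF P(1)]])
      show "continuous_on {0..t} ?y"
        using pos t by (intro continuous_on_ln continuous_intros continuous_on_subset[OF w])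
          (auto simp: power2_norm_eq_inner less_imp_neq[symmetric])
      fix \<tau> assume "\<tau> \<in> {0<..<t} - P"
      then have "\<tau> \<in> {0<..<1} - P" using t by auto
      then obtain z where z: "(w has_vector_derivative z) (at \<tau>)"
        "norm z \<le> (1 + B * norm (w \<tau>)) / m * ?S \<tau>" using deriv by blast
      let ?q = "1 + w \<tau> \<bullet> w \<tau>" let ?n = "norm (w \<tau>)"
      have q: "?q = 1 + ?n\<^sup>2" "?q > 0" using pos[of "w \<tau>"] by (auto simp: power2_norm_eq_inner)
      have "((\<lambda>t. 1 + w t \<bullet> w t) has_real_derivative 2 * (w \<tau> \<bullet> z)) (at \<tau>)"
        using z(1) unfolding has_vector_derivative_def has_field_derivative_def
        by (auto intro!: derivative_eq_intros simp: inner_commute algebra_simps)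
      then have "(?y has_real_derivative 2 * (w \<tau> \<bullet> z) / ?q) (at \<tau>)"
        using DERIV_chain2[where g = "\<lambda>t. 1 + w t \<bullet> w t", OF DERIV_ln_divide[OF q(2)]] by simp
      moreover have "norm (2 * (w \<tau> \<bullet> z) / ?q) \<le> (1 + 2 * B) / m * ?S \<tau>"
      proof -
        have wz: "\<bar>w \<tau> \<bullet> z\<bar> \<le> ?n * ((1 + B * ?n) / m * ?S \<tau>)"
          using Cauchy_Schwarz_ineq2[of "w \<tau>" z] mult_left_mono[OF z(2), of ?n] by simp
        have "norm (2 * (w \<tau> \<bullet> z) / ?q) = 2 * \<bar>w \<tau> \<bullet> z\<bar> / ?q"
          using q(2) by (simp add: abs_mult)
        also have "\<dots> \<le> 2 * (?n * ((1 + B * ?n) / m * ?S \<tau>)) / ?q"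
          by (rule divide_right_mono[OF mult_left_mono[OF wz]]) (use q(2) in auto)
        also have "\<dots> = (2 * ?n * (1 + B * ?n) / ?q) * (?S \<tau> / m)" by (simp add: mult_ac)
        also have "\<dots> \<le> (1 + 2 * B) * (?S \<tau> / m)"
        proof (rule mult_right_mono)
          \<comment> \<open>Origin of 1 + 2 B: with n = |w| both 2 n and n^2 are at most 1 +
            n^2.\<close>
          have "0 \<le> (1 - ?n)\<^sup>2" by simp
          then have "2 * ?n \<le> ?q" by (simp add: q(1) power2_eq_square algebra_simps)
          moreover have "2 * B * ?n\<^sup>2 \<le> 2 * B * ?q" using mB(2) by (intro mult_left_mono) (auto simp: q(1))
          ultimately have "2 * ?n * (1 + B * ?n) \<le> (1 + 2 * B) * ?q"
            by (simp add: power2_eq_square algebra_simps)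
          then show "2 * ?n * (1 + B * ?n) / ?q \<le> 1 + 2 * B" using q(2) by (simp add: pos_divide_le_eq)
        qed (use f(1)[of \<tau>] mB(1) in auto)
        finally show ?thesis by simp
      qed
      ultimately show "\<exists>y'. (?y has_vector_derivative y') (at \<tau>) \<and> norm y' \<le> (1 + 2 * B) / m * ?S \<tau>"
        by (auto simp: has_real_derivative_iff_has_vector_derivative)
    qed (use t f mB in auto)
    then show ?thesis using f(3) by (simp add: power2_norm_eq_inner abs_le_iff)
  qed
  show "norm (w 1 - w 0) \<le> (1 + B * R) / m * curve_length (bundle_atlas A) dmetric \<Gamma>"
    if R: "\<And>t. t \<in> {0..1} \<Longrightarrow> norm (w t) \<le> R"
  proof -
    have R0: "0 \<le> R" using order_trans[OF norm_ge_zero R[of 0]] by simp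
    have "norm (w 1 - w 0) \<le> (1 + B * R) / m * integral {0..1} ?S"
    proof (rule norm_diff_le_integral[OF w TM.regular_offD(1)[OF P(1)]])
      fix \<tau> assume \<tau>: "\<tau> \<in> {0<..<1} - P"
      then obtain z where z: "(w has_vector_derivative z) (at \<tau>)"
        "norm z \<le> (1 + B * norm (w \<tau>)) / m * ?S \<tau>" using deriv by blast
      have "(1 + B * norm (w \<tau>)) / m * ?S \<tau> \<le> (1 + B * R) / m * ?S \<tau>"
        using R[of \<tau>] \<tau> mB f(1)
        by (intro mult_right_mono divide_right_mono add_left_mono mult_left_mono) auto
      with z show "\<exists>y'. (w has_vector_derivative y') (at \<tau>) \<and> norm y' \<le> (1 + B * R) / m * ?S \<tau>"
        by (meson order_trans)
    qed (use f mB R0 in auto)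
    then show ?thesis using f(3) by simp
  qed
qed

lemma complete_total:
  assumes "complete_dist (mpoints A) (riemannian_dist A h)"
  shows "complete_dist (tangent_bundle A) (riemannian_dist (bundle_atlas A) dmetric)"
  unfolding complete_dist_def
proof (intro allI impI)
  let ?\<rho> = "riemannian_dist (bundle_atlas A) dmetric" let ?d = "riemannian_dist A h"
  fix u :: "nat \<Rightarrow> 'm \<times> ('m, 'e) tvec"
  assume "range u \<subseteq> tangent_bundle A \<and> (\<forall>\<epsilon>>0. \<exists>N. \<forall>m\<ge>N. \<forall>n\<ge>N. ?\<rho> (u m) (u n) < ereal \<epsilon>)"
  then have u: "u n \<in> tangent_bundle A"
    and cauchy: "\<epsilon> > 0 \<Longrightarrow> \<exists>N. \<forall>m\<ge>N. \<forall>n\<ge>N. ?\<rho> (u m) (u n) < ereal \<epsilon>" for n \<epsilon> by auto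
  define p where "p n = fst (u n)" for n
  have "range p \<subseteq> mpoints A" using u by (auto simp: p_def tangent_bundle_def case_prod_beta)
  moreover have "\<forall>\<epsilon>>0. \<exists>N. \<forall>m\<ge>N. \<forall>n\<ge>N. ?d (p m) (p n) < ereal \<epsilon>"
    unfolding p_def using cauchy dist_project by meson
  ultimately obtain l where l: "l \<in> mpoints A" "\<And>\<epsilon>. \<epsilon> > 0 \<Longrightarrow> \<exists>N. \<forall>n\<ge>N. ?d (p n) l < ereal \<epsilon>"
    using complete_distD[OF assms, of p] by blast
  obtain c where c: "c \<in> A" "l \<in> fst c" using l(1) by (auto simp: mpoints_def)
  define a where "a = snd c l"
  obtain r where r: "r > 0" "cball a r \<subseteq> snd c ` fst c"
    using open_chart_image[OF c(1)] c(2) open_contains_cball unfolding a_def by blast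
  obtain m where m: "m > 0" "\<And>x v. x \<in> cball a r \<Longrightarrow> m * norm v \<le> sqrt (hloc c x v v)"
    using hloc_lower_bound[OF c(1) compact_cball r(2)] by blast
  obtain B where B: "B \<ge> 0"
    "\<And>x v w. x \<in> cball a r \<Longrightarrow> norm (christoffel c x v w) \<le> B * norm v * norm w"
    using christoffel_bound[OF c(1) compact_cball r(2)] by blast
  \<comment> \<open>The length threshold of \<open>curve_stays\<close>: a shorter curve starting
    within r / 2 of a stays in the ball.\<close>
  define \<delta> where "\<delta> = m * (r / 2)"
  have \<delta>: "\<delta> > 0" using m r by (simp add: \<delta>_def)
  define x where "x n = snd c (p n)" for n
  define w where "w n = snd (u n) c" for n
  have base: "p n \<in> fst c \<and> m * dist (x n) a < \<epsilon>" if dist: "?d (p n) l < ereal \<epsilon>" "\<epsilon> \<le> \<delta>" for n \<epsilon>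
  proof -
    obtain \<gamma> where \<gamma>: "piecewise_C1_curve A \<gamma>" "\<gamma> 0 = p n" "\<gamma> 1 = l" "curve_length A h \<gamma> < \<epsilon>"
      using riemannian_dist_lessD[OF dist(1)] by blast
    \<comment> \<open>The curve is traced back from time 1: only its end l is known to lie in the
      chart, at the centre of the ball.\<close>
    have stay: "\<gamma> t \<in> fst c \<and> snd c (\<gamma> t) \<in> ball a r" if "t \<in> {0..1}" for t
      by (rule curve_stays[OF \<gamma>(1) c(1) m(1) r(2) m(2), of 1])
        (use that \<gamma>(3,4) c(2) r(1) dist(2) in \<open>auto simp: a_def \<delta>_def\<close>)
    have "m * norm (snd c (\<gamma> 1) - snd c (\<gamma> 0)) \<le> curve_length A h \<gamma>"
      by (rule curve_displacement[where C = "cball a r", OF \<gamma>(1) c(1) m(1)])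
        (use m(2) stay in \<open>auto simp: closed_segment_eq_real_ivl less_imp_le\<close>)
    then show ?thesis
      using \<gamma> stay[of 0] by (simp add: dist_norm norm_minus_commute a_def x_def)
  qed
  obtain N1 where N1: "\<And>n. n \<ge> N1 \<Longrightarrow> ?d (p n) l < ereal \<delta>" using l(2)[OF \<delta>] by blast
  obtain N2 where N2: "\<And>i j. i \<ge> N2 \<Longrightarrow> j \<ge> N2 \<Longrightarrow> ?\<rho> (u i) (u j) < ereal \<delta>" using cauchy[OF \<delta>] by blast
  define N where "N = max N1 N2"
  \<comment> \<open>\<open>base\<close> with \<epsilon> = \<delta> gives m * dist (x n) a < m * (r /
    2), so every later curve starts within r / 2 of the centre.\<close>
  have near: "p n \<in> fst c" "dist a (x n) < r / 2" if "n \<ge> N" for n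
    using base[OF N1[of n] order_refl] that m(1) by (auto simp: N_def \<delta>_def dist_commute)
  have stay: "\<Gamma> t \<in> fst (bundle_chart A c) \<and> snd c (fst (\<Gamma> t)) \<in> cball a r"
    if \<Gamma>: "piecewise_C1_curve (bundle_atlas A) \<Gamma>" "\<Gamma> 0 = u i" "curve_length (bundle_atlas A) dmetric \<Gamma> < \<delta>"
      and "i \<ge> N" and t: "t \<in> {0..1}" for \<Gamma> i t
  proof -
    have "(fst \<circ> \<Gamma>) t \<in> fst c \<and> snd c ((fst \<circ> \<Gamma>) t) \<in> ball a r"
      by (rule curve_stays[OF piecewise_project[OF \<Gamma>(1)] c(1) m(1) r(2) m(2), of 0])
        (use near[OF \<open>i \<ge> N\<close>] curve_length_project[OF \<Gamma>(1)] \<Gamma> t in \<open>auto simp: \<delta>_def p_def x_def\<close>)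
    then show ?thesis
      using TM.curve_mpoints[OF \<Gamma>(1) t] by (auto simp: fst_bundle_chart mpoints_bundle)
  qed
  \<comment> \<open>The most that ln (1 + |w|^2) can gain along one curve of length below
    \<delta>.\<close>
  define q where "q = (1 + 2 * B) / m * \<delta>"
  have growth: "ln (1 + (norm (snd (\<Gamma> t) c))\<^sup>2) \<le> ln (1 + (norm (w i))\<^sup>2) + q"
    if \<Gamma>: "piecewise_C1_curve (bundle_atlas A) \<Gamma>" "\<Gamma> 0 = u i" "curve_length (bundle_atlas A) dmetric \<Gamma> < \<delta>"
      and "i \<ge> N" and t: "t \<in> {0..1}" for \<Gamma> i t
  proof -
    have "(1 + 2 * B) / m * curve_length (bundle_atlas A) dmetric \<Gamma> \<le> q"
      unfolding q_def using \<Gamma>(3) B(1) m(1) by (intro mult_left_mono) auto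
    then show ?thesis
      using fiber_growth(1)[OF \<Gamma>(1) c(1) stay[OF \<Gamma> \<open>i \<ge> N\<close>] m(1) B(1) m(2) B(2) t] \<Gamma>(2)
      by (simp add: w_def)
  qed
  have curve: "\<exists>\<Gamma>. piecewise_C1_curve (bundle_atlas A) \<Gamma> \<and> \<Gamma> 0 = u i \<and> \<Gamma> 1 = u j \<and>
      curve_length (bundle_atlas A) dmetric \<Gamma> < \<epsilon>" if "?\<rho> (u i) (u j) < ereal \<epsilon>" for i j \<epsilon>
    using riemannian_dist_lessD[OF that] .
  have wbound: "ln (1 + (norm (w n))\<^sup>2) \<le> ln (1 + (norm (w N))\<^sup>2) + q" if n: "n \<ge> N" for n
  proof -
    have "?\<rho> (u N) (u n) < ereal \<delta>" using n N2 by (simp add: N_def)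
    then obtain \<Gamma> where "piecewise_C1_curve (bundle_atlas A) \<Gamma>" "\<Gamma> 0 = u N" "\<Gamma> 1 = u n"
      "curve_length (bundle_atlas A) dmetric \<Gamma> < \<delta>" using curve by blast
    then show ?thesis using growth[of \<Gamma> N 1] by (simp add: w_def)
  qed
  \<comment> \<open>One q accounts for the way from \<open>u N\<close> to \<open>u i\<close>, the
    other for the curve that starts at \<open>u i\<close>. The bound is uniform over all those
    curves, not only over the members of the sequence.\<close>
  define R where "R = sqrt (exp (ln (1 + (norm (w N))\<^sup>2) + q + q))"
  have R: "norm (snd (\<Gamma> t) c) \<le> R"
    if \<Gamma>: "piecewise_C1_curve (bundle_atlas A) \<Gamma>" "\<Gamma> 0 = u i" "curve_length (bundle_atlas A) dmetric \<Gamma> < \<delta>"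
      and "i \<ge> N" and t: "t \<in> {0..1}" for \<Gamma> i t
  proof -
    let ?n = "norm (snd (\<Gamma> t) c)"
    have pos: "0 < 1 + ?n\<^sup>2" by (simp add: add_pos_nonneg)
    have "ln (1 + ?n\<^sup>2) \<le> ln (1 + (norm (w N))\<^sup>2) + q + q"
      using growth[OF \<Gamma> \<open>i \<ge> N\<close> t] wbound[OF \<open>i \<ge> N\<close>] by linarith
    then have "1 + ?n\<^sup>2 \<le> exp (ln (1 + (norm (w N))\<^sup>2) + q + q)"
      using pos by (metis exp_le_cancel_iff exp_ln)
    then have "?n\<^sup>2 \<le> exp (ln (1 + (norm (w N))\<^sup>2) + q + q)" by linarith
    then show ?thesis unfolding R_def by (rule real_le_rsqrt)
  qed
  have R0: "0 \<le> R" by (simp add: R_def)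
  define M where "M = (1 + B * R) / m"
  have M: "M > 0" using B(1) R0 m(1) by (simp add: M_def add_pos_nonneg)
  have "Cauchy w"
    unfolding Cauchy_def
  proof (intro allI impI)
    fix \<epsilon> :: real assume \<epsilon>: "0 < \<epsilon>"
    \<comment> \<open>Below \<delta> the curves stay in the ball; below \<epsilon> / M the Lipschitz
      bound for w gives \<epsilon>.\<close>
    define \<eta> where "\<eta> = min \<delta> (\<epsilon> / M)"
    have "\<eta> > 0" using \<epsilon> M \<delta> by (simp add: \<eta>_def)
    then obtain N' where N': "\<And>i j. i \<ge> N' \<Longrightarrow> j \<ge> N' \<Longrightarrow> ?\<rho> (u i) (u j) < ereal \<eta>" using cauchy by blast
    have "dist (w i) (w j) < \<epsilon>" if ij: "i \<ge> max N N'" "j \<ge> max N N'" for i j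
    proof -
      have "?\<rho> (u i) (u j) < ereal \<eta>" using N' ij by simp
      then obtain \<Gamma> where \<Gamma>: "piecewise_C1_curve (bundle_atlas A) \<Gamma>" "\<Gamma> 0 = u i" "\<Gamma> 1 = u j"
        "curve_length (bundle_atlas A) dmetric \<Gamma> < \<eta>" using curve by blast
      have len: "curve_length (bundle_atlas A) dmetric \<Gamma> < \<delta>" using \<Gamma>(4) by (simp add: \<eta>_def)
      have i: "i \<ge> N" using ij by simp
      have "norm (w j - w i) \<le> M * curve_length (bundle_atlas A) dmetric \<Gamma>"
        using fiber_growth(2)[OF \<Gamma>(1) c(1) stay[OF \<Gamma>(1,2) len i] m(1) B(1) m(2) B(2) R[OF \<Gamma>(1,2) len i]] \<Gamma>(2,3)
        by (simp add: w_def M_def)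
      also have "\<dots> < M * (\<epsilon> / M)" using \<Gamma>(4) M by (intro mult_strict_left_mono) (auto simp: \<eta>_def)
      finally show ?thesis using M by (simp add: dist_norm norm_minus_commute)
    qed
    then show "\<exists>M. \<forall>m\<ge>M. \<forall>n\<ge>M. dist (w m) (w n) < \<epsilon>" by blast
  qed
  then obtain b where b: "w \<longlonglongrightarrow> b" using Cauchy_convergent convergent_def by blast
  have xa: "x \<longlonglongrightarrow> a"
    unfolding lim_sequentially
  proof (intro allI impI)
    fix \<epsilon> :: real assume \<epsilon>: "0 < \<epsilon>"
    \<comment> \<open>The bound \<delta> makes \<open>base\<close> applicable, and m * \<epsilon>
      compensates the factor m in its conclusion.\<close>
    then have "min \<delta> (m * \<epsilon>) > 0" using \<delta> m(1) by simp
    then obtain N' where "\<And>n. n \<ge> N' \<Longrightarrow> ?d (p n) l < ereal (min \<delta> (m * \<epsilon>))" using l(2) by blast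
    then have "m * dist (x n) a < m * \<epsilon>" if "n \<ge> N'" for n using base[of n "min \<delta> (m * \<epsilon>)"] that by simp
    then show "\<exists>no. \<forall>n\<ge>no. dist (x n) a < \<epsilon>" using m(1) by auto
  qed
  let ?C = "bundle_chart A c" let ?l = "chart_inv ?C (a, b)"
  note C = bundle_chart_mem[OF c(1)]
  \<comment> \<open>The fibre coordinate of a bundle chart is unrestricted, so the limit of the
    coordinates is automatically a point of TM.\<close>
  have ab: "(a, b) \<in> snd ?C ` fst ?C" using c by (simp add: bundle_chart_image a_def)
  have lim: "(\<lambda>n. (x n, w n)) \<longlonglongrightarrow> (a, b)" by (rule tendsto_Pair[OF xa b])
  have un: "chart_inv ?C (x n, w n) = u n" if "n \<ge> N" for n
  proof -
    have "u n \<in> fst ?C" using u near(1)[OF that] by (simp add: fst_bundle_chart p_def)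
    then show ?thesis using TM.chart_inv_chart[OF C] by (simp add: snd_bundle_chart x_def w_def p_def)
  qed
  have "?l \<in> tangent_bundle A" using chart_inv_mem[OF ab] by (simp add: fst_bundle_chart)
  moreover have "\<forall>\<epsilon>>0. \<exists>N. \<forall>n\<ge>N. ?\<rho> (u n) ?l < ereal \<epsilon>"
  proof (intro allI impI)
    fix \<epsilon> :: real assume "\<epsilon> > 0"
    then obtain \<eta> where \<eta>: "\<eta> > 0" "\<And>y. dist y (a, b) < \<eta> \<Longrightarrow> ?\<rho> (chart_inv ?C y) ?l < ereal \<epsilon>"
      using TM.dist_tendsto_0[OF C ab] by blast
    obtain N' where "\<And>n. n \<ge> N' \<Longrightarrow> dist (x n, w n) (a, b) < \<eta>"
      using lim \<eta>(1) unfolding lim_sequentially by blast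
    then have "?\<rho> (u n) ?l < ereal \<epsilon>" if "n \<ge> max N N'" for n
      using \<eta>(2)[of "(x n, w n)"] un[of n] that by simp
    then show "\<exists>N. \<forall>n\<ge>N. ?\<rho> (u n) ?l < ereal \<epsilon>" by blast
  qed
  ultimately show "\<exists>l\<in>tangent_bundle A. \<forall>\<epsilon>>0. \<exists>N. \<forall>n\<ge>N. ?\<rho> (u n) l < ereal \<epsilon>" by blast
qed

end

theorem proposition2p15:
  fixes T :: "'m topology"
    and A :: "('m, 'e::euclidean_space) chart set"
    and h :: "'m \<Rightarrow> ('m, 'e) tvec \<Rightarrow> ('m, 'e) tvec \<Rightarrow> real"
    and nabla nabla_star :: "('m, 'e) connection"
    and K :: "'m \<times> ('m, 'e) tvec \<Rightarrow> ('m \<times> ('m, 'e) tvec, 'e \<times> 'e) tvec \<Rightarrow> ('m, 'e) tvec"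
  assumes "smooth_manifold T A"
    and "dually_flat A h nabla nabla_star"
    and "connector A nabla K"
  shows "complete_dist (tangent_bundle A) (riemannian_dist (bundle_atlas A) (dombrowski_metric A h K)) \<longleftrightarrow>
         complete_dist (mpoints A) (riemannian_dist A h)"
proof -
  interpret manifold A by (rule smooth_manifold_imp_manifold[OF assms(1)])
  interpret dombrowski_manifold A h nabla K
    by unfold_locales (use assms(2,3) in \<open>auto simp: dually_flat_def\<close>)
  show ?thesis using complete_base complete_total by blast
qed

end
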